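(* Let $n\geq 1$ and $\sigma\in S_n$. The graph $\mathcal{B}(\sigma)$ is toroidal if and only if it is (isomorphic, as an undirected graph, to) a single point, a single edge, the edge graph of a square, of a (3-dimensional) cube, or of a $4$-dimensional cube, or the complete bipartite graph $K_{3,3}$.
   Context: The length $\ell(\pi)$ of $\pi\in S_n$ is the minimum number of adjacent transpositions $(i\ i+1)$ whose product is $\pi$; equivalently, it is the number of inversions, i.e. pairs $i<j$ with $\pi(i)>\pi(j)$. For $\sigma,\tau\in S_n$ write $\sigma\prec\tau$ if $\ell(\sigma)<\ell(\tau)$ and there is a transposition $t=(i\ j)$ (not necessarily adjacent) with $\sigma=\tau t$. Bruhat order $\leq$ on $S_n$ is the reflexive transitive closure of $\prec$. The Bruhat graph of $S_n$ is the directed graph with vertex set $S_n$ and an edge $\sigma\to\tau$ whenever $\sigma\prec\tau$ (the difference $\ell(\tau)-\ell(\sigma)$ need not be $1$). For $\pi\in S_n$, the Bruhat graph $\mathcal{B}(\pi)$ is the induced subgraph on the vertices $\sigma\in S_n$ with $\sigma\leq\pi$ in Bruhat order. A graph is toroidal if it can be drawn on the surface of a torus without edges crossing; for $\mathcal{B}(\sigma)$ this refers to the underlying undirected graph. (In particular planar graphs are toroidal.) *)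

theory Defs
  imports
    "HOL-Analysis.Analysis"
    "HOL-Combinatorics.Permutations"
    "Graph_Theory.Graph_Theory"
begin

section \<open>Length and Bruhat order on \<open>S\<^sub>n\<close>\<close>

text \<open>\<open>S\<^sub>n\<close> is the set of functions \<open>\<pi>\<close> with \<open>\<pi> permutes {1..n}\<close>; the product is composition.\<close>

definition adj_word_prod :: "nat list \<Rightarrow> nat \<Rightarrow> nat" where
  "adj_word_prod is = foldr (\<lambda>i f. Transposition.transpose i (Suc i) \<circ> f) is id"

text \<open>Only meaningful for \<open>\<pi> permutes {1..n}\<close>, where the minimum exists.\<close>

definition perm_length :: "nat \<Rightarrow> (nat \<Rightarrow> nat) \<Rightarrow> nat" where
  "perm_length n \<pi> = (LEAST k. \<exists>is. length is = k \<and> set is \<subseteq> {1..<n} \<and> \<pi> = adj_word_prod is)"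

definition inversion_set :: "nat \<Rightarrow> (nat \<Rightarrow> nat) \<Rightarrow> (nat \<times> nat) set" where
  "inversion_set n \<pi> = {(i, j). i \<in> {1..n} \<and> j \<in> {1..n} \<and> i < j \<and> \<pi> i > \<pi> j}"

definition bruhat_step :: "nat \<Rightarrow> (nat \<Rightarrow> nat) \<Rightarrow> (nat \<Rightarrow> nat) \<Rightarrow> bool" where
  "bruhat_step n \<sigma> \<tau> \<longleftrightarrow>
     \<sigma> permutes {1..n} \<and> \<tau> permutes {1..n} \<and> perm_length n \<sigma> < perm_length n \<tau> \<and>
     (\<exists>i j. i \<in> {1..n} \<and> j \<in> {1..n} \<and> i \<noteq> j \<and> \<sigma> = \<tau> \<circ> Transposition.transpose i j)"

definition bruhat_le :: "nat \<Rightarrow> (nat \<Rightarrow> nat) \<Rightarrow> (nat \<Rightarrow> nat) \<Rightarrow> bool" where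
  "bruhat_le n = (bruhat_step n)\<^sup>*\<^sup>*"

section \<open>Bruhat graphs\<close>

definition bruhat_graph :: "nat \<Rightarrow> (nat \<Rightarrow> nat) pair_pre_digraph" where
  "bruhat_graph n = \<lparr> pverts = {\<sigma>. \<sigma> permutes {1..n}}, parcs = {(\<sigma>, \<tau>). bruhat_step n \<sigma> \<tau>} \<rparr>"

definition lower_bruhat_graph ::
    "nat \<Rightarrow> (nat \<Rightarrow> nat) \<Rightarrow> (nat \<Rightarrow> nat, (nat \<Rightarrow> nat) \<times> (nat \<Rightarrow> nat)) pre_digraph" where
  "lower_bruhat_graph n \<pi> = with_proj (bruhat_graph n) \<restriction> {\<sigma>. \<sigma> permutes {1..n} \<and> bruhat_le n \<sigma> \<pi>}"

text \<open>Undirected graphs are represented by symmetric digraphs, as in the Graph_Theory library.\<close>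

definition underlying_graph :: "('a, 'b) pre_digraph \<Rightarrow> ('a, 'a \<times> 'a) pre_digraph" where
  "underlying_graph G = with_proj (mk_symmetric G)"

text \<open>The edge graph of the \<open>d\<close>-dimensional cube, with the vertices of \<open>{0,1}\<^sup>d\<close> as bit lists.\<close>

definition cube_graph :: "nat \<Rightarrow> (bool list, bool list \<times> bool list) pre_digraph" where
  "cube_graph d = with_proj
     \<lparr> pverts = {xs. length xs = d},
       parcs = {(xs, ys). length xs = d \<and> length ys = d \<and> card {i. i < d \<and> xs ! i \<noteq> ys ! i} = 1} \<rparr>"

section \<open>Drawings without crossings\<close>

definition undirected_edges :: "('a, 'b) pre_digraph \<Rightarrow> 'a set set" where
  "undirected_edges G = {{u, v} | u v. (u, v) \<in> arcs_ends G}"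

text \<open>Vertices are drawn as distinct points of \<open>S\<close> and edges as simple arcs in \<open>S\<close>, which pass
  through no vertices but their own ends and meet each other only in common ends.  Each undirected
  edge is drawn once, so antiparallel or parallel arcs share a curve.  A simple arc has distinct
  ends, so a graph with loops has no drawing in this sense.\<close>

definition crossing_free_drawing ::
    "'p::topological_space set \<Rightarrow> ('a, 'b) pre_digraph \<Rightarrow> ('a \<Rightarrow> 'p) \<Rightarrow> ('a set \<Rightarrow> real \<Rightarrow> 'p) \<Rightarrow> bool"
  where
  "crossing_free_drawing S G p \<gamma> \<longleftrightarrow>
     inj_on p (verts G) \<and> p ` verts G \<subseteq> S \<and>
     (\<forall>e \<in> undirected_edges G.
        arc (\<gamma> e) \<and> path_image (\<gamma> e) \<subseteq> S \<and>
        {pathstart (\<gamma> e), pathfinish (\<gamma> e)} = p ` e \<and>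
        path_image (\<gamma> e) \<inter> p ` verts G = p ` e) \<and>
     (\<forall>e \<in> undirected_edges G. \<forall>f \<in> undirected_edges G. e \<noteq> f \<longrightarrow>
        path_image (\<gamma> e) \<inter> path_image (\<gamma> f) = p ` (e \<inter> f))"

definition torus :: "(complex \<times> complex) set" where
  "torus = sphere 0 1 \<times> sphere 0 1"

definition toroidal :: "('a, 'b) pre_digraph \<Rightarrow> bool" where
  "toroidal G \<longleftrightarrow> (\<exists>p \<gamma>. crossing_free_drawing torus G p \<gamma>)"

section \<open>The length is the number of inversions\<close>

lemma adj_word_prod_simps [simp]:
  "adj_word_prod [] = id"
  "adj_word_prod (i # is) = Transposition.transpose i (Suc i) \<circ> adj_word_prod is"
  by (simp_all add: adj_word_prod_def)

lemma adj_transpose_permutes: "a \<in> {1..<n} \<Longrightarrow> Transposition.transpose a (Suc a) permutes {1..n}"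
  by (intro permutes_swap_id) auto

lemma adj_word_prod_permutes: "set is \<subseteq> {1..<n} \<Longrightarrow> adj_word_prod is permutes {1..n}"
  by (induction "is") (simp_all add: permutes_compose adj_transpose_permutes permutes_id del: One_nat_def)

lemma finite_inversion_set: "finite (inversion_set n \<pi>)"
  by (rule finite_subset[of _ "{1..n} \<times> {1..n}"]) (auto simp: inversion_set_def)

lemma adj_transpose_less_iff:
  assumes "x \<noteq> y" "\<not> (x = a \<and> y = Suc a)" "\<not> (x = Suc a \<and> y = a)"
  shows "Transposition.transpose a (Suc a) x < Transposition.transpose a (Suc a) y \<longleftrightarrow> x < y"
  using assms by (auto simp: Transposition.transpose_def)

lemma set_eq_insertI:
  "\<lbrakk>r \<in> A; s \<notin> A; s \<notin> B; \<And>x. x \<noteq> r \<Longrightarrow> x \<noteq> s \<Longrightarrow> x \<in> A \<longleftrightarrow> x \<in> B\<rbrakk> \<Longrightarrow> A = insert r B"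
  by (rule set_eqI) (metis insert_iff)

lemma inversion_set_adj_transpose:
  assumes \<pi>: "\<pi> permutes {1..n}" and a: "a \<in> {1..<n}"
  defines "p \<equiv> inv \<pi> a" and "q \<equiv> inv \<pi> (Suc a)"
  shows "p < q \<Longrightarrow> (p, q) \<notin> inversion_set n \<pi> \<and>
           inversion_set n (Transposition.transpose a (Suc a) \<circ> \<pi>) = insert (p, q) (inversion_set n \<pi>)"
    and "q < p \<Longrightarrow> (q, p) \<in> inversion_set n \<pi> \<and>
           inversion_set n (Transposition.transpose a (Suc a) \<circ> \<pi>) = inversion_set n \<pi> - {(q, p)}"
proof -
  let ?s = "Transposition.transpose a (Suc a)"
  have pq: "\<pi> p = a" "\<pi> q = Suc a"
    using permutes_inverses(1)[OF \<pi>] by (auto simp: p_def q_def)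
  have mem: "p \<in> {1..n}" "q \<in> {1..n}"
    using permutes_in_image[OF permutes_inv[OF \<pi>]] a by (auto simp: p_def q_def)
  have uniq: "\<pi> i = a \<longleftrightarrow> i = p" "\<pi> i = Suc a \<longleftrightarrow> i = q" for i
    using permutes_inverses[OF \<pi>] by (metis p_def, metis q_def)
  have eq: "(i, j) \<in> inversion_set n (?s \<circ> \<pi>) \<longleftrightarrow> (i, j) \<in> inversion_set n \<pi>"
    if "(i, j) \<noteq> (p, q)" "(i, j) \<noteq> (q, p)" for i j
  proof (cases "i = j")
    case False
    then have "\<pi> i \<noteq> \<pi> j" using permutes_inj[OF \<pi>] by (auto dest: injD)
    then have "?s (\<pi> j) < ?s (\<pi> i) \<longleftrightarrow> \<pi> j < \<pi> i"
      using that uniq by (intro adj_transpose_less_iff) auto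
    then show ?thesis by (auto simp: inversion_set_def)
  qed (auto simp: inversion_set_def)
  have eq2: "x \<in> inversion_set n (?s \<circ> \<pi>) \<longleftrightarrow> x \<in> inversion_set n \<pi>"
    if "x \<noteq> (p, q)" "x \<noteq> (q, p)" for x
    using eq[of "fst x" "snd x"] that by simp
  show "(p, q) \<notin> inversion_set n \<pi> \<and> inversion_set n (?s \<circ> \<pi>) = insert (p, q) (inversion_set n \<pi>)"
    if "p < q"
  proof -
    have "(p, q) \<notin> inversion_set n \<pi>" "(q, p) \<notin> inversion_set n \<pi>"
      "(p, q) \<in> inversion_set n (?s \<circ> \<pi>)" "(q, p) \<notin> inversion_set n (?s \<circ> \<pi>)"
      using that pq mem by (auto simp: inversion_set_def)
    then show ?thesis using set_eq_insertI[OF _ _ _ eq2] by simp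
  qed
  show "(q, p) \<in> inversion_set n \<pi> \<and> inversion_set n (?s \<circ> \<pi>) = inversion_set n \<pi> - {(q, p)}"
    if "q < p"
  proof -
    have "(p, q) \<notin> inversion_set n \<pi>" "(q, p) \<in> inversion_set n \<pi>"
      "(p, q) \<notin> inversion_set n (?s \<circ> \<pi>)" "(q, p) \<notin> inversion_set n (?s \<circ> \<pi>)"
      using that pq mem by (auto simp: inversion_set_def)
    moreover from this have "inversion_set n \<pi> = insert (q, p) (inversion_set n (?s \<circ> \<pi>))"
      using eq2 by (intro set_eq_insertI[of "(q, p)" _ "(p, q)"]) simp_all
    ultimately show ?thesis by simp
  qed
qed

lemma card_inversion_set_adj_word_prod:
  "set is \<subseteq> {1..<n} \<Longrightarrow> card (inversion_set n (adj_word_prod is)) \<le> length is"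
proof (induction "is")
  case Nil
  have "inversion_set n id = {}" by (auto simp: inversion_set_def)
  then show ?case by (simp only: adj_word_prod_simps card.empty le0)
next
  case (Cons a "is")
  let ?\<pi> = "adj_word_prod is"
  have \<pi>: "?\<pi> permutes {1..n}" and a: "a \<in> {1..<n}"
    using Cons.prems adj_word_prod_permutes[of "is" n] by auto
  have "inv ?\<pi> a \<noteq> inv ?\<pi> (Suc a)"
    using permutes_inverses(1)[OF \<pi>] by (metis n_not_Suc_n)
  then have "card (inversion_set n (Transposition.transpose a (Suc a) \<circ> ?\<pi>))
      \<le> Suc (card (inversion_set n ?\<pi>))"
    using inversion_set_adj_transpose[OF \<pi> a] finite_inversion_set[of n ?\<pi>]
    by (cases "inv ?\<pi> a < inv ?\<pi> (Suc a)") (auto simp: card_Diff_singleton_if)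
  moreover have "card (inversion_set n ?\<pi>) \<le> length is" using Cons by simp
  ultimately show ?case unfolding adj_word_prod_simps list.size by linarith
qed

lemma permutes_no_descent_imp_id:
  assumes \<rho>: "\<rho> permutes {1..n}" and le: "\<And>a. a \<in> {1..<n} \<Longrightarrow> \<rho> a < \<rho> (Suc a)"
  shows "\<rho> = id"
proof -
  have mem: "\<rho> a \<in> {1..n} \<longleftrightarrow> a \<in> {1..n}" for a using permutes_in_image[OF \<rho>] .
  have ge: "a \<le> n \<Longrightarrow> a \<le> \<rho> a" for a
  proof (induction a)
    case (Suc a)
    then show ?case using le[of a] mem[of 1] by (cases a) auto
  qed simp
  have up: "k \<le> n - 1 \<Longrightarrow> \<rho> (n - k) \<le> n - k" for k
  proof (induction k)
    case 0
    then show ?case using mem[of n] permutes_not_in[OF \<rho>, of n] by (cases "n = 0") auto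
  next
    case (Suc k)
    then have "\<rho> (n - Suc k) < \<rho> (Suc (n - Suc k))" by (intro le) auto
    also have "Suc (n - Suc k) = n - k" using Suc.prems by simp
    finally show ?case using Suc by simp
  qed
  have "\<rho> a = a" for a
  proof (cases "a \<in> {1..n}")
    case True
    then show ?thesis using ge[of a] up[of "n - a"] by auto
  qed (simp add: permutes_not_in[OF \<rho>])
  then show ?thesis by auto
qed

lemma ex_adj_word:
  "\<pi> permutes {1..n} \<Longrightarrow>
     \<exists>is. length is = card (inversion_set n \<pi>) \<and> set is \<subseteq> {1..<n} \<and> \<pi> = adj_word_prod is"
proof (induction "card (inversion_set n \<pi>)" arbitrary: \<pi> rule: less_induct)
  case less
  note \<pi> = less.prems
  show ?case
  proof (cases "\<exists>a \<in> {1..<n}. inv \<pi> (Suc a) < inv \<pi> a")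
    case True
    then obtain a where a: "a \<in> {1..<n}" "inv \<pi> (Suc a) < inv \<pi> a" by blast
    let ?s = "Transposition.transpose a (Suc a)"
    have c: "card (inversion_set n \<pi>) = Suc (card (inversion_set n (?s \<circ> \<pi>)))"
      using inversion_set_adj_transpose(2)[OF \<pi> a] finite_inversion_set[of n \<pi>]
      by (metis card.remove)
    have "?s \<circ> \<pi> permutes {1..n}" using \<pi> a by (intro permutes_compose adj_transpose_permutes)
    then obtain "is" where "is": "length is = card (inversion_set n (?s \<circ> \<pi>))" "set is \<subseteq> {1..<n}"
        "?s \<circ> \<pi> = adj_word_prod is"
      using less.hyps[of "?s \<circ> \<pi>"] c by auto
    have "\<pi> = adj_word_prod (a # is)" by (simp flip: "is"(3) add: fun_eq_iff)
    then show ?thesis using a "is" c by (intro exI[of _ "a # is"]) auto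
  next
    case False
    have ne: "inv \<pi> a \<noteq> inv \<pi> (Suc a)" for a
      using permutes_inverses(1)[OF \<pi>] by (metis n_not_Suc_n)
    have "inv \<pi> = id"
      using False ne by (intro permutes_no_descent_imp_id[OF permutes_inv[OF \<pi>]]) (metis nat_neq_iff)
    then have "\<pi> = id" using \<pi> by (metis permutes_inv_inv inv_id)
    moreover have "inversion_set n id = {}" by (auto simp: inversion_set_def)
    ultimately show ?thesis
      by (intro exI[of _ "[]"]) (simp only: adj_word_prod_simps card.empty list.size list.set empty_subsetI simp_thms)
  qed
qed

lemma perm_length_eq_card_inversion_set:
  assumes "\<pi> permutes {1..n}"
  shows "perm_length n \<pi> = card (inversion_set n \<pi>)"
  unfolding perm_length_def
proof (rule Least_equality)
  show "\<exists>is. length is = card (inversion_set n \<pi>) \<and> set is \<subseteq> {1..<n} \<and> \<pi> = adj_word_prod is"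
    using ex_adj_word[OF assms] .
next
  show "card (inversion_set n \<pi>) \<le> k"
    if "\<exists>is. length is = k \<and> set is \<subseteq> {1..<n} \<and> \<pi> = adj_word_prod is" for k
    using that card_inversion_set_adj_word_prod by blast
qed

end

theory Submission
  imports Defs "HOL-Library.Sublist"
begin

text \<open>
  Two disjoint closed curves on the torus cannot have linearly independent homology classes, and a
  torus drawing of \<open>K\<^sub>3\<^sub>,\<^sub>3\<close> whose cycles have cyclic holonomy in \<open>\<int>\<^sup>2\<close> would lift to an annulus, hence
  give a plane drawing.  So a closed curve that avoids some \<open>K\<^sub>3\<^sub>,\<^sub>3\<close> (or a subdivision of it) is
  null-homologous.  A graph is therefore not toroidal as soon as it contains a \<open>K\<^sub>3\<^sub>,\<^sub>3\<close> such that all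
  cycles off one fixed edge avoid other copies of \<open>K\<^sub>3\<^sub>,\<^sub>3\<close>: its holonomy is generated by one element.
  No face counting is needed; for the interval below \<open>s\<^sub>2 s\<^sub>1 s\<^sub>3 s\<^sub>2\<close> this replaces Euler's formula.

  The vertices of \<open>\<B>(\<sigma>)\<close> are the products of the subwords of a reduced word of \<open>\<sigma>\<close>, and two of them
  are adjacent when they differ by a transposition.  If the letters are distinct, \<open>\<B>(\<sigma>)\<close> is a cube, and
  the five-dimensional cube contains two disjoint subdivisions of \<open>K\<^sub>3\<^sub>,\<^sub>3\<close>.  If some letter repeats,
  take two occurrences at minimal distance: unless \<open>\<sigma> = s\<^sub>i s\<^sub>j s\<^sub>i\<close>, either the dihedral subgroup of
  two neighbouring letters and one of its cosets, two disjoint \<open>K\<^sub>3\<^sub>,\<^sub>3\<close>, lie below \<open>\<sigma>\<close>, or a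
  translate of the pattern \<open>s\<^sub>2 s\<^sub>1 s\<^sub>3 s\<^sub>2\<close> does.\<close>


section \<open>Chords of a Jordan curve and \<open>K\<^sub>3\<^sub>,\<^sub>3\<close>\<close>

text \<open>Homology enters only through lifts: a closed curve on the torus is lifted to the complex
  plane, and its class is the displacement of the lift, a Gaussian integer. One edge of K33 may be
  left out because the cycle space has dimension 9 - 6 + 1 = 4 and the four-cycles a_i b_j a_1 b_1
  with i, j in {0, 2} form a basis. Three of them avoid the edge a_0 b_0. Once these are
  null-homologous, every holonomy is a multiple of that of the fourth, and a cyclic group of
  holonomies is what an annulus can absorb. In the fourteen-vertex graph below s_2 s_1 s_3 s_2 each
  of the three cycles is given a K33 of its own, so the criterion lets the disjoint K33 depend on
  the cycle. For a repeated letter a, what matters is which of a - 1 and a + 1 occur between two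
  closest occurrences of a: none contradicts reducedness, exactly one gives a dihedral subgroup of
  order 6, both give the pattern s_2 s_1 s_3 s_2.\<close>

lemma arc_open_image:
  assumes "arc d"
  shows "path_image d - {pathstart d, pathfinish d} = d ` {0<..<1}"
proof -
  have inj: "inj_on d {0..1}" using assms by (simp add: arc_def)
  have "d s \<noteq> d 0" "d s \<noteq> d 1" if "s \<in> {0<..<1}" for s
    using that inj_onD[OF inj, of s 0] inj_onD[OF inj, of s 1] by auto
  then show ?thesis
    unfolding path_image_def pathstart_def pathfinish_def
    by (auto simp: less_le)
qed

lemma connected_open_arc:
  assumes "arc d"
  shows "Topological_Spaces.connected (path_image d - {pathstart d, pathfinish d})"
  unfolding arc_open_image[OF assms]
  using assms by (force intro: connected_continuous_image continuous_on_subset simp: arc_def path_def)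

text \<open>Makes the ends of a chord limit points of its interior, so that the region containing
  the interior constrains the ends.\<close>

lemma closure_open_arc:
  assumes "arc d"
  shows "path_image d \<subseteq> closure (path_image d - {pathstart d, pathfinish d})"
proof -
  have "d ` closure {0<..<1} \<subseteq> closure (d ` {0<..<1})"
    by (rule image_closure_subset) (use assms in \<open>auto simp: arc_def path_def intro: subsetD[OF closure_subset]\<close>)
  then show ?thesis unfolding arc_open_image[OF assms] by (simp add: path_image_def)
qed

lemma connected_subset_inside:
  assumes "Topological_Spaces.connected D" "D \<inter> J = {}" "D \<inter> inside J \<noteq> {}"
  shows "D \<subseteq> inside J"
  using inside_outside_intersect_connected[of D J] inside_Un_outside[of J] assms by blast

lemma arc_inside_or_outside:
  fixes d :: "real \<Rightarrow> complex"
  assumes "arc d" "path_image d \<inter> J \<subseteq> {pathstart d, pathfinish d}"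
  shows "path_image d - {pathstart d, pathfinish d} \<subseteq> inside J \<or>
         path_image d - {pathstart d, pathfinish d} \<subseteq> outside J"
proof -
  let ?D = "path_image d - {pathstart d, pathfinish d}"
  have con: "Topological_Spaces.connected ?D" using connected_open_arc[OF assms(1)] .
  have dis: "?D \<inter> J = {}" using assms by auto
  show ?thesis
    using connected_subset_inside[OF con dis] dis inside_Un_outside[of J] by blast
qed

section \<open>Chords with alternating ends on a Jordan curve\<close>

text \<open>\<open>c1\<close> and \<open>c2\<close> form a Jordan curve, \<open>c\<close> is a chord
  joining \<open>a\<close> and \<open>b\<close>, and \<open>d\<close> is a chord from a point of
  \<open>c1\<close> to a point of \<open>c2\<close>, so the ends of the two chords alternate. The
  aim is that disjoint chords of this kind cannot lie on the same side of the curve.\<close>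

locale crossing_chords =
  fixes c1 c2 c d :: "real \<Rightarrow> complex" and a b x y :: complex
  assumes arcs: "arc c1" "arc c2" "arc c" "arc d"
    and ends: "pathstart c1 = a" "pathfinish c1 = b" "pathstart c2 = a" "pathfinish c2 = b"
      "pathstart c = a" "pathfinish c = b" "pathstart d = x" "pathfinish d = y"
    and meets: "path_image c1 \<inter> path_image c2 = {a, b}" "path_image c1 \<inter> path_image c = {a, b}"
      "path_image c2 \<inter> path_image c = {a, b}" "path_image d \<inter> path_image c1 = {x}"
      "path_image d \<inter> path_image c2 = {y}" "path_image d \<inter> path_image c = {}"
begin

lemma ends_distinct: "a \<noteq> b"
  using arcs(1) ends(1,2) arc_distinct_ends by blast

text \<open>The chord \<open>c\<close> splits the inside into two regions, bounded by
  \<open>c1\<close> with \<open>c\<close> and by \<open>c2\<close> with \<open>c\<close>. The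
  interior of \<open>d\<close> is connected and lies in one of them, but \<open>y\<close> is not in
  the closure of the first and \<open>x\<close> not in that of the second.\<close>

lemma not_both_inside:
  assumes cin: "path_image c - {a, b} \<subseteq> inside (path_image c1 \<union> path_image c2)"
    and din: "path_image d - {x, y} \<subseteq> inside (path_image c1 \<union> path_image c2)"
  shows False
proof -
  let ?I1 = "inside (path_image c1 \<union> path_image c)" and ?I2 = "inside (path_image c2 \<union> path_image c)"
  let ?J = "path_image c1 \<union> path_image c2" and ?D = "path_image d - {x, y}"
  have "path_image c - {a, b} \<noteq> {}"
    using arc_open_image[OF arcs(3)] ends by auto
  then have ne: "path_image c \<inter> inside ?J \<noteq> {}" using cin by blast
  have sub: "?I1 \<inter> ?I2 = {} \<and> ?I1 \<union> ?I2 \<union> (path_image c - {a, b}) = inside ?J"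
    by (rule split_inside_simple_closed_curve[of c1 a b c2 c])
      (use arcs ends meets ends_distinct ne in \<open>auto intro: arc_imp_simple_path\<close>)
  have con: "Topological_Spaces.connected ?D" using connected_open_arc[OF arcs(4)] ends by simp
  have cl: "x \<in> closure ?D" "y \<in> closure ?D"
    using closure_open_arc[OF arcs(4)] ends pathstart_in_path_image pathfinish_in_path_image by blast+
  have closed: "closed (path_image c1 \<union> path_image c)" "closed (path_image c2 \<union> path_image c)"
    using arcs by (auto intro!: closed_Un closed_arc_image)
  have un: "?I1 \<union> ?I2 \<union> (path_image c - {a, b}) = inside ?J" using sub by simp
  have xy: "x \<noteq> y" "x \<in> path_image d" "y \<in> path_image d" "x \<in> path_image c1" "y \<in> path_image c2"
    using arc_distinct_ends[OF arcs(4)] ends meets(4,5) by auto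
  have notin: "z \<notin> path_image c" if "z \<in> path_image d" for z
    using meets(6) that by (simp add: disjoint_iff)
  have off: "y \<notin> path_image c1 \<union> path_image c" "x \<notin> path_image c2 \<union> path_image c"
    using xy notin meets(4,5) by (simp_all add: set_eq_iff) metis+
  have off_in: "z \<notin> ?I1" "z \<notin> ?I2" if "z \<in> ?J" for z
  proof -
    have "z \<notin> inside ?J" using that inside_no_overlap[of ?J] by (auto simp only: disjoint_iff)
    moreover have "?I1 \<subseteq> inside ?J" "?I2 \<subseteq> inside ?J" unfolding un[symmetric] by auto
    ultimately show "z \<notin> ?I1" "z \<notin> ?I2" by (auto simp only: subset_iff)
  qed
  have "?D \<subseteq> ?I1 \<union> ?I2"
  proof
    fix z assume "z \<in> ?D"
    then have "z \<in> inside ?J" "z \<notin> path_image c" using din notin by (simp_all add: subset_iff)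
    then show "z \<in> ?I1 \<union> ?I2" by (simp flip: un)
  qed
  moreover have "open ?I1" "open ?I2" using closed by (auto intro: open_inside)
  ultimately have "?I1 \<inter> ?D = {} \<or> ?I2 \<inter> ?D = {}"
    using sub by (intro connectedD[OF con]) simp_all
  moreover have "D \<subseteq> A \<or> D \<subseteq> B" if "A \<inter> D = {} \<or> B \<inter> D = {}" "D \<subseteq> A \<union> B" for A B D :: "complex set"
    using that by blast
  ultimately have "?D \<subseteq> ?I1 \<or> ?D \<subseteq> ?I2"
    using \<open>?D \<subseteq> ?I1 \<union> ?I2\<close> by simp
  then show False
  proof
    assume "?D \<subseteq> ?I1"
    then have "y \<in> closure ?I1" using cl closure_mono by blast
    then have "y \<in> ?I1 \<union> (path_image c1 \<union> path_image c)"
      using closure_inside_subset[OF closed(1)] by blast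
    then show False using off off_in xy by simp
  next
    assume "?D \<subseteq> ?I2"
    then have "x \<in> closure ?I2" using cl closure_mono by blast
    then have "x \<in> ?I2 \<union> (path_image c2 \<union> path_image c)"
      using closure_inside_subset[OF closed(2)] by blast
    then show False using off off_in xy by simp
  qed
qed

lemma closed_curve:
  obtains j where "simple_path j" "pathfinish j = pathstart j" "path_image j = path_image c1 \<union> path_image c2"
proof
  show "simple_path (c1 +++ reversepath c2)"
    using arcs ends meets by (intro simple_path_join_loop) (auto intro: arc_reversepath)
  show "pathfinish (c1 +++ reversepath c2) = pathstart (c1 +++ reversepath c2)"
    using ends by simp
  show "path_image (c1 +++ reversepath c2) = path_image c1 \<union> path_image c2"
    using ends by (simp add: path_image_join)
qed

end

text \<open>Inversion at an inner point \<open>w\<close> reduces outer chords to inner ones. The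
  punctured inside is connected and has unbounded image, since \<open>w\<close> is a pole, so this
  image misses the inside of the image curve. That inside is open and nonempty, hence contains
  points other than \<open>0\<close>, and these can only be images of outer points; connectedness of
  the outside does the rest.\<close>

lemma inversion_outside_inside:
  fixes j :: "real \<Rightarrow> complex"
  assumes j: "simple_path j" "pathfinish j = pathstart j" and w: "w \<in> inside (path_image j)"
  defines "f \<equiv> \<lambda>z. 1 / (z - w)"
  shows "f ` outside (path_image j) \<subseteq> inside (f ` path_image j)"
proof -
  let ?J = "path_image j"
  have wJ: "w \<notin> ?J" using w inside_no_overlap by blast
  have wO: "w \<notin> outside ?J" using w inside_Int_outside by blast
  have cont: "continuous_on (- {w}) f" unfolding f_def by (intro continuous_intros) auto
  have inj: "inj_on f (- {w})" by (auto simp: inj_on_def f_def field_simps)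
  have injD: "z = z'" if "f z = f z'" "z \<noteq> w" "z' \<noteq> w" for z z'
    using inj that by (auto simp: inj_on_def)
  have fj: "f ` ?J = path_image (f \<circ> j)" by (simp add: path_image_compose)
  have "simple_path (f \<circ> j)"
    using wJ by (intro simple_path_continuous_image[OF j(1)] continuous_on_subset[OF cont] inj_on_subset[OF inj]) auto
  moreover have "pathfinish (f \<circ> j) = pathstart (f \<circ> j)" using j by (simp add: pathfinish_compose pathstart_compose)
  ultimately have jc: "inside (f ` ?J) \<noteq> {}" "open (inside (f ` ?J))" "bounded (inside (f ` ?J))"
    using Jordan_inside_outside[of "f \<circ> j"] by (auto simp: fj)
  have jo: "Topological_Spaces.connected (inside ?J)" "open (inside ?J)" "Topological_Spaces.connected (outside ?J)" "open (outside ?J)"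
    using Jordan_inside_outside[OF j] by auto
  have outO: "Topological_Spaces.connected (f ` outside ?J)"
    using wO by (intro connected_continuous_image[OF continuous_on_subset[OF cont]] jo) auto
  have disO: "f ` outside ?J \<inter> f ` ?J = {}"
  proof -
    have "f z \<noteq> f z'" if "z \<in> outside ?J" "z' \<in> ?J" for z z'
      using that injD[of z z'] wO wJ outside_no_overlap[of ?J] by blast
    then show ?thesis by blast
  qed
  have conI: "Topological_Spaces.connected (inside ?J - {w})"
    using jo by (intro connected_open_delete) auto
  then have conI: "Topological_Spaces.connected (f ` (inside ?J - {w}))"
    by (intro connected_continuous_image[OF continuous_on_subset[OF cont]]) auto
  have disI: "f ` (inside ?J - {w}) \<inter> f ` ?J = {}"
  proof -
    have "f z \<noteq> f z'" if "z \<in> inside ?J" "z \<noteq> w" "z' \<in> ?J" for z z'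
      using that injD[of z z'] wJ inside_no_overlap[of ?J] by blast
    then show ?thesis by blast
  qed
  have Iout: "f ` (inside ?J - {w}) \<inter> inside (f ` ?J) = {}"
  proof (rule ccontr)
    assume "f ` (inside ?J - {w}) \<inter> inside (f ` ?J) \<noteq> {}"
    then have "f ` (inside ?J - {w}) \<subseteq> inside (f ` ?J)"
      using connected_subset_inside[OF conI disI] by blast
    then have "bounded (f ` (inside ?J - {w}))" using jc bounded_subset by blast
    then obtain B where B: "B > 0" "\<And>z. z \<in> inside ?J - {w} \<Longrightarrow> norm (f z) \<le> B"
      by (auto simp: bounded_pos)
    obtain e where e: "e > 0" "ball w e \<subseteq> inside ?J" using jo(2) w openE by blast
    \<comment> \<open>\<open>r\<close> keeps \<open>w + r\<close> in the ball and makes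
      \<open>1 / r\<close> exceed \<open>B\<close>.\<close>
    define r where "r = min (e/2) (1 / (2 * B))"
    have r: "r > 0" "r < e" "r * B < 1" using e B by (auto simp: r_def min_def field_simps)
    have "w + of_real r \<in> inside ?J - {w}" using e r by (auto simp: dist_norm)
    from B(2)[OF this] have "1 / r \<le> B" using r by (simp add: f_def norm_divide)
    then show False using r by (simp add: field_simps)
  qed
  have "inside (f ` ?J) \<subseteq> f ` outside ?J \<union> {0}"
  proof
    fix u assume u: "u \<in> inside (f ` ?J)"
    show "u \<in> f ` outside ?J \<union> {0}"
    proof (cases "u = 0")
      case False
      define z where "z = w + 1 / u"
      have z: "f z = u" "z \<noteq> w" using False by (auto simp: f_def z_def)
      have "z \<notin> ?J" using u z inside_no_overlap by blast
      moreover have "z \<notin> inside ?J" using u z Iout by blast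
      ultimately show ?thesis using z inside_Un_outside[of ?J] by blast
    qed simp
  qed
  moreover have "\<not> inside (f ` ?J) \<subseteq> {0}"
    using jc open_delete not_open_singleton[of "0::complex"] by (metis subset_singletonD)
  ultimately have "f ` outside ?J \<inter> inside (f ` ?J) \<noteq> {}" by blast
  then show ?thesis using connected_subset_inside[OF outO disO] by blast
qed

context crossing_chords
begin

lemma not_both_outside:
  assumes cout: "path_image c - {a, b} \<subseteq> outside (path_image c1 \<union> path_image c2)"
    and dout: "path_image d - {x, y} \<subseteq> outside (path_image c1 \<union> path_image c2)"
  shows False
proof -
  obtain j where j: "simple_path j" "pathfinish j = pathstart j" "path_image j = path_image c1 \<union> path_image c2"
    using closed_curve .
  obtain w where w: "w \<in> inside (path_image j)"
    using Jordan_inside_outside[OF j(1,2)] by blast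
  define f where "f = (\<lambda>z. 1 / (z - w))"
  have out: "f ` outside (path_image j) \<subseteq> inside (f ` path_image j)"
    unfolding f_def by (rule inversion_outside_inside[OF j(1,2) w])
  have cont: "continuous_on (- {w}) f" unfolding f_def by (intro continuous_intros) auto
  have inj: "inj_on f (- {w})" by (auto simp: inj_on_def f_def field_simps)
  have wJ: "w \<notin> path_image j" "w \<notin> outside (path_image j)"
    using w inside_no_overlap inside_Int_outside by blast+
  \<comment> \<open>The inversion is continuous and injective off \<open>w\<close>, so all four arcs
    have to avoid \<open>w\<close>; the outer chords do because \<open>w\<close> lies
    inside.\<close>
  have sub: "path_image c1 \<subseteq> - {w}" "path_image c2 \<subseteq> - {w}" "path_image c \<subseteq> - {w}" "path_image d \<subseteq> - {w}"
  proof -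
    show "path_image c1 \<subseteq> - {w}" "path_image c2 \<subseteq> - {w}" using wJ(1) unfolding j(3) by auto
    have "path_image c \<subseteq> outside (path_image j) \<union> path_image c1"
      using cout meets(2) unfolding j(3) by auto
    then show "path_image c \<subseteq> - {w}" using wJ unfolding j(3) by auto
    have "path_image d \<subseteq> outside (path_image j) \<union> (path_image c1 \<union> path_image c2)"
      using dout meets(4,5) unfolding j(3) by auto
    then show "path_image d \<subseteq> - {w}" using wJ unfolding j(3) by auto
  qed
  have arcI: "arc (f \<circ> g)" if "arc g" "path_image g \<subseteq> - {w}" for g
    using that continuous_on_subset[OF cont that(2)] inj_on_subset[OF inj that(2)]
    by (auto simp: arc_def path_image_def intro: comp_inj_on path_continuous_image)
  have int: "f ` A \<inter> f ` B = f ` (A \<inter> B)" if "A \<subseteq> - {w}" "B \<subseteq> - {w}" for A B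
    using inj_on_image_Int[OF inj that] by simp
  interpret f: crossing_chords "f \<circ> c1" "f \<circ> c2" "f \<circ> c" "f \<circ> d" "f a" "f b" "f x" "f y"
    by unfold_locales (use arcs ends meets sub in \<open>simp_all add: arcI pathstart_compose pathfinish_compose path_image_compose int\<close>)
  show False
  proof (rule f.not_both_inside)
    have "f ` (path_image c - {a, b}) \<subseteq> inside (f ` path_image j)"
      using out cout j(3) by (metis image_mono order_trans)
    then show "path_image (f \<circ> c) - {f a, f b} \<subseteq> inside (path_image (f \<circ> c1) \<union> path_image (f \<circ> c2))"
      by (auto simp: path_image_compose j(3) image_Un)
    have "f ` (path_image d - {x, y}) \<subseteq> inside (f ` path_image j)"
      using out dout j(3) by (metis image_mono order_trans)
    then show "path_image (f \<circ> d) - {f x, f y} \<subseteq> inside (path_image (f \<circ> c1) \<union> path_image (f \<circ> c2))"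
      by (auto simp: path_image_compose j(3) image_Un)
  qed
qed

end

section \<open>Drawings of K33 and their absence in the plane\<close>

text \<open>A single condition on parameters makes every curve simple, the six vertices distinct and
  the curves disjoint except at common ends. Drawings can thus be transported pointwise, through
  relabelling, lifting and the exponential map.\<close>

definition K33_drawing ::
    "(nat \<Rightarrow> 'p::topological_space) \<Rightarrow> (nat \<Rightarrow> 'p) \<Rightarrow> (nat \<Rightarrow> nat \<Rightarrow> real \<Rightarrow> 'p) \<Rightarrow> bool" where
  "K33_drawing a b \<gamma> \<longleftrightarrow>
     (\<forall>i<3. \<forall>j<3. path (\<gamma> i j) \<and> pathstart (\<gamma> i j) = a i \<and> pathfinish (\<gamma> i j) = b j) \<and>
     (\<forall>i<3. \<forall>j<3. \<forall>k<3. \<forall>l<3. \<forall>s\<in>{0..1}. \<forall>t\<in>{0..1}. \<gamma> i j s = \<gamma> k l t \<longrightarrow>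
        i = k \<and> j = l \<and> s = t \<or> i = k \<and> s = 0 \<and> t = 0 \<or> j = l \<and> s = 1 \<and> t = 1)"

lemma K33_drawingD:
  assumes "K33_drawing a b \<gamma>" "i < 3" "j < 3"
  shows "path (\<gamma> i j)" "pathstart (\<gamma> i j) = a i" "pathfinish (\<gamma> i j) = b j"
    "\<gamma> i j 0 = a i" "\<gamma> i j 1 = b j"
proof -
  show p: "path (\<gamma> i j)" "pathstart (\<gamma> i j) = a i" "pathfinish (\<gamma> i j) = b j"
    using assms unfolding K33_drawing_def by blast+
  show "\<gamma> i j 0 = a i" "\<gamma> i j 1 = b j"
    using p(2,3) by (simp_all add: pathstart_def pathfinish_def)
qed

lemma K33_drawing_inj:
  assumes "K33_drawing a b \<gamma>" "i < 3" "j < 3" "k < 3" "l < 3" "s \<in> {0..1}" "t \<in> {0..1}" "\<gamma> i j s = \<gamma> k l t"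
  shows "i = k \<and> j = l \<and> s = t \<or> i = k \<and> s = 0 \<and> t = 0 \<or> j = l \<and> s = 1 \<and> t = 1"
  using conjunct2[OF assms(1)[unfolded K33_drawing_def], rule_format, OF assms(2-8)] .

lemma K33_drawing_arc:
  assumes "K33_drawing a b \<gamma>" "i < 3" "j < 3"
  shows "arc (\<gamma> i j)"
proof -
  have "inj_on (\<gamma> i j) {0..1}"
    by (rule inj_onI) (use K33_drawing_inj[OF assms assms(2,3)] in blast)
  then show ?thesis using K33_drawingD[OF assms] by (simp add: arc_def)
qed

lemma K33_drawing_vertices:
  assumes K: "K33_drawing a b \<gamma>" and ij: "i < 3" "k < 3"
  shows "a i = a k \<longleftrightarrow> i = k" "b i = b k \<longleftrightarrow> i = k" "a i \<noteq> b k" "b k \<noteq> a i"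
proof -
  show "a i = a k \<longleftrightarrow> i = k"
    using K33_drawing_inj[OF K, of i 0 k 0 0 0] K33_drawingD[OF K, of i 0] K33_drawingD[OF K, of k 0] ij by auto
  show "b i = b k \<longleftrightarrow> i = k"
    using K33_drawing_inj[OF K, of 0 i 0 k 1 1] K33_drawingD[OF K, of 0 i] K33_drawingD[OF K, of 0 k] ij by auto
  show "a i \<noteq> b k" "b k \<noteq> a i"
    using K33_drawing_inj[OF K, of i k i k 0 1] K33_drawingD[OF K, of i k] ij by auto
qed

lemma K33_drawing_Int:
  assumes K: "K33_drawing a b \<gamma>" and ij: "i < 3" "j < 3" "k < 3" "l < 3" "(i, j) \<noteq> (k, l)"
  shows "path_image (\<gamma> i j) \<inter> path_image (\<gamma> k l) =
    (if i = k then {a i} else {}) \<union> (if j = l then {b j} else {})" (is "?L = ?R")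
proof
  show "?L \<subseteq> ?R"
  proof
    fix z assume "z \<in> ?L"
    then obtain s t where st: "s \<in> {0..1}" "t \<in> {0..1}" "z = \<gamma> i j s" "\<gamma> i j s = \<gamma> k l t"
      unfolding path_image_def by auto
    from K33_drawing_inj[OF K ij(1-4) st(1,2,4)] ij(5) st(3) K33_drawingD[OF K ij(1,2)]
    show "z \<in> ?R" by auto
  qed
  show "?R \<subseteq> ?L"
    using K33_drawingD(2,3)[OF K ij(1,2)] K33_drawingD(2,3)[OF K ij(3,4)]
      pathstart_in_path_image[of "\<gamma> i j"] pathfinish_in_path_image[of "\<gamma> i j"]
      pathstart_in_path_image[of "\<gamma> k l"] pathfinish_in_path_image[of "\<gamma> k l"]
    by auto
qed

text \<open>Serves to rotate the hexagon of \<open>K33_not_planar\<close>: one pair of diagonals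
  then stands for all three pairs.\<close>

lemma K33_drawing_relabel:
  assumes "K33_drawing a b \<gamma>" and "inj_on f {..<3}" "f ` {..<3} \<subseteq> {..<3}"
  shows "K33_drawing (a \<circ> f) (b \<circ> f) (\<lambda>i j. \<gamma> (f i) (f j))"
proof -
  have f: "f i < 3" "f i = f k \<longleftrightarrow> i = k" if "i < 3" "k < 3" for i k
    using assms(2,3) that by (auto simp: inj_on_def)
  show ?thesis
    unfolding K33_drawing_def
  proof (intro conjI allI impI ballI)
    fix i j k l :: nat and s t :: real
    assume h: "i < 3" "j < 3" "k < 3" "l < 3" "s \<in> {0..1}" "t \<in> {0..1}" "\<gamma> (f i) (f j) s = \<gamma> (f k) (f l) t"
    show "i = k \<and> j = l \<and> s = t \<or> i = k \<and> s = 0 \<and> t = 0 \<or> j = l \<and> s = 1 \<and> t = 1"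
      using K33_drawing_inj[OF assms(1) _ _ _ _ h(5-7)] f h(1-4) by simp
  qed (use f K33_drawingD[OF assms(1)] in auto)
qed

text \<open>The hexagon a_0 b_0 a_1 b_1 a_2 b_2 is cut at the opposite vertices a_0 and b_1; its
  diagonals a_0 b_1 and a_1 b_2 are the chords.\<close>

lemma K33_drawing_crossing_chords:
  fixes \<gamma> :: "nat \<Rightarrow> nat \<Rightarrow> real \<Rightarrow> complex"
  assumes K: "K33_drawing a b \<gamma>"
  shows "crossing_chords (\<gamma> 0 0 +++ reversepath (\<gamma> 1 0) +++ \<gamma> 1 1) (\<gamma> 0 2 +++ reversepath (\<gamma> 2 2) +++ \<gamma> 2 1)
    (\<gamma> 0 1) (\<gamma> 1 2) (a 0) (b 1) (a 1) (b 2)"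
proof -
  note D = K33_drawingD(2,3)[OF K] and A = K33_drawing_arc[OF K] and V = K33_drawing_vertices[OF K]
    and I = K33_drawing_Int[OF K]
  show ?thesis
  proof
    show "arc (\<gamma> 0 0 +++ reversepath (\<gamma> 1 0) +++ \<gamma> 1 1)" "arc (\<gamma> 0 2 +++ reversepath (\<gamma> 2 2) +++ \<gamma> 2 1)"
      by (intro arc_join arc_reversepath A; simp add: D path_image_join Int_Un_distrib I V del: One_nat_def)+
    show "path_image (\<gamma> 0 0 +++ reversepath (\<gamma> 1 0) +++ \<gamma> 1 1) \<inter> path_image (\<gamma> 0 2 +++ reversepath (\<gamma> 2 2) +++ \<gamma> 2 1) = {a 0, b 1}"
      by (auto simp: D path_image_join Int_Un_distrib Int_Un_distrib2 I V)
    show "path_image (\<gamma> 0 0 +++ reversepath (\<gamma> 1 0) +++ \<gamma> 1 1) \<inter> path_image (\<gamma> 0 1) = {a 0, b 1}"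
      "path_image (\<gamma> 0 2 +++ reversepath (\<gamma> 2 2) +++ \<gamma> 2 1) \<inter> path_image (\<gamma> 0 1) = {a 0, b 1}"
      "path_image (\<gamma> 1 2) \<inter> path_image (\<gamma> 0 0 +++ reversepath (\<gamma> 1 0) +++ \<gamma> 1 1) = {a 1}"
      "path_image (\<gamma> 1 2) \<inter> path_image (\<gamma> 0 2 +++ reversepath (\<gamma> 2 2) +++ \<gamma> 2 1) = {b 2}"
      "path_image (\<gamma> 1 2) \<inter> path_image (\<gamma> 0 1) = {}"
      by (auto simp: D path_image_join Int_Un_distrib Int_Un_distrib2 I V)
  qed (simp_all add: A D)
qed

text \<open>Each of the three long diagonals of the hexagon lies on one side of it. Two of them
  share a side, which \<open>crossing_chords\<close> excludes.\<close>

theorem K33_not_planar: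
  fixes \<gamma> :: "nat \<Rightarrow> nat \<Rightarrow> real \<Rightarrow> complex"
  assumes K: "K33_drawing a b \<gamma>"
  shows False
proof -
  define hexagon where "hexagon \<gamma> = path_image (\<gamma> 0 0) \<union> path_image (\<gamma> 1 0) \<union> path_image (\<gamma> 1 1) \<union>
    path_image (\<gamma> 2 1) \<union> path_image (\<gamma> 2 2) \<union> path_image (\<gamma> 0 2)" for \<gamma> :: "nat \<Rightarrow> nat \<Rightarrow> real \<Rightarrow> complex"
  define chord where "chord i j = path_image (\<gamma> i j) - {a i, b j}" for i j
  have no: "\<not> (path_image (\<gamma> 0 1) - {a 0, b 1} \<subseteq> inside (hexagon \<gamma>) \<and> path_image (\<gamma> 1 2) - {a 1, b 2} \<subseteq> inside (hexagon \<gamma>))"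
       "\<not> (path_image (\<gamma> 0 1) - {a 0, b 1} \<subseteq> outside (hexagon \<gamma>) \<and> path_image (\<gamma> 1 2) - {a 1, b 2} \<subseteq> outside (hexagon \<gamma>))"
    if K: "K33_drawing a b \<gamma>" for a b \<gamma>
  proof -
    interpret crossing_chords "\<gamma> 0 0 +++ reversepath (\<gamma> 1 0) +++ \<gamma> 1 1" "\<gamma> 0 2 +++ reversepath (\<gamma> 2 2) +++ \<gamma> 2 1"
        "\<gamma> 0 1" "\<gamma> 1 2" "a 0" "b 1" "a 1" "b 2"
      by (rule K33_drawing_crossing_chords[OF K])
    have "path_image (\<gamma> 0 0 +++ reversepath (\<gamma> 1 0) +++ \<gamma> 1 1) \<union> path_image (\<gamma> 0 2 +++ reversepath (\<gamma> 2 2) +++ \<gamma> 2 1) = hexagon \<gamma>"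
      by (simp add: path_image_join K33_drawingD[OF K] hexagon_def Un_ac)
    then show "\<not> (path_image (\<gamma> 0 1) - {a 0, b 1} \<subseteq> inside (hexagon \<gamma>) \<and> path_image (\<gamma> 1 2) - {a 1, b 2} \<subseteq> inside (hexagon \<gamma>))"
       "\<not> (path_image (\<gamma> 0 1) - {a 0, b 1} \<subseteq> outside (hexagon \<gamma>) \<and> path_image (\<gamma> 1 2) - {a 1, b 2} \<subseteq> outside (hexagon \<gamma>))"
      using not_both_inside not_both_outside by metis+
  qed
  \<comment> \<open>The cyclic shifts of the indices by 1 and -1 modulo 3; they preserve the hexagon
    and permute its diagonals.\<close>
  let ?f = "\<lambda>i::nat. if i = 2 then 0 else i + 1" and ?g = "\<lambda>i::nat. if i = 0 then 2 else i - 1"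
  have K1: "K33_drawing (a \<circ> ?f) (b \<circ> ?f) (\<lambda>i j. \<gamma> (?f i) (?f j))"
    and K2: "K33_drawing (a \<circ> ?g) (b \<circ> ?g) (\<lambda>i j. \<gamma> (?g i) (?g j))"
    by (auto intro!: K33_drawing_relabel[OF K] simp: inj_on_def)
  have h: "hexagon (\<lambda>i j. \<gamma> (?f i) (?f j)) = hexagon \<gamma>" "hexagon (\<lambda>i j. \<gamma> (?g i) (?g j)) = hexagon \<gamma>"
    by (auto simp: hexagon_def numeral_2_eq_2)
  have side: "chord i j \<subseteq> inside (hexagon \<gamma>) \<or> chord i j \<subseteq> outside (hexagon \<gamma>)"
    if "(i, j) \<in> {(0, 1), (1, 2), (2, 0)}" for i j
  proof -
    have "path_image (\<gamma> i j) \<inter> hexagon \<gamma> \<subseteq> {pathstart (\<gamma> i j), pathfinish (\<gamma> i j)}"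
      using that by (elim insertE emptyE; simp add: hexagon_def Int_Un_distrib K33_drawing_Int[OF K] K33_drawingD[OF K] del: One_nat_def)
    then show ?thesis
      using arc_inside_or_outside[OF K33_drawing_arc[OF K], of i j "hexagon \<gamma>"] that
      by (auto simp: chord_def K33_drawingD[OF K])
  qed
  have n0: "\<not> (chord 0 1 \<subseteq> inside (hexagon \<gamma>) \<and> chord 1 2 \<subseteq> inside (hexagon \<gamma>))"
    "\<not> (chord 0 1 \<subseteq> outside (hexagon \<gamma>) \<and> chord 1 2 \<subseteq> outside (hexagon \<gamma>))"
    using no[OF K] unfolding chord_def by simp_all
  have n1: "\<not> (chord 1 2 \<subseteq> inside (hexagon \<gamma>) \<and> chord 2 0 \<subseteq> inside (hexagon \<gamma>))"
    "\<not> (chord 1 2 \<subseteq> outside (hexagon \<gamma>) \<and> chord 2 0 \<subseteq> outside (hexagon \<gamma>))"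
    using no[OF K1] unfolding h chord_def by (simp_all add: numeral_2_eq_2)
  have n2: "\<not> (chord 2 0 \<subseteq> inside (hexagon \<gamma>) \<and> chord 0 1 \<subseteq> inside (hexagon \<gamma>))"
    "\<not> (chord 2 0 \<subseteq> outside (hexagon \<gamma>) \<and> chord 0 1 \<subseteq> outside (hexagon \<gamma>))"
    using no[OF K2] unfolding h chord_def by simp_all
  show False
    using n0 n1 n2 side[of 0 1] side[of 1 2] side[of 2 0] by simp metis
qed

section \<open>The universal cover of the torus\<close>

definition torus_cover :: "complex \<Rightarrow> complex \<times> complex" where
  "torus_cover z = (cis (2 * pi * Re z), cis (2 * pi * Im z))"

definition lattice :: "complex set" where
  "lattice = {z. Re z \<in> \<int> \<and> Im z \<in> \<int>}"

lemma lattice_simps [simp]: "0 \<in> lattice" "1 \<in> lattice" "z \<in> lattice \<Longrightarrow> - z \<in> lattice"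
  "z \<in> lattice \<Longrightarrow> w \<in> lattice \<Longrightarrow> z + w \<in> lattice" "z \<in> lattice \<Longrightarrow> w \<in> lattice \<Longrightarrow> z - w \<in> lattice"
  "z \<in> lattice \<Longrightarrow> of_int k * z \<in> lattice"
  by (auto simp: lattice_def)

lemma cis_2pi_eq_iff: "cis (2 * pi * x) = cis (2 * pi * y) \<longleftrightarrow> x - y \<in> \<int>"
proof -
  have "cis (2 * pi * x) = cis (2 * pi * y) \<longleftrightarrow> cis (2 * pi * (x - y)) = 1"
    by (simp add: right_diff_distrib flip: cis_divide)
  also have "\<dots> \<longleftrightarrow> (\<exists>k::int. 2 * pi * (x - y) = 2 * pi * of_int k)"
    unfolding cis_conv_exp exp_eq_1 by (auto simp: mult_ac)
  also have "\<dots> \<longleftrightarrow> x - y \<in> \<int>" by (auto elim!: Ints_cases)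
  finally show ?thesis .
qed

lemma torus_cover_eq_iff: "torus_cover z = torus_cover w \<longleftrightarrow> z - w \<in> lattice"
  by (simp add: torus_cover_def cis_2pi_eq_iff lattice_def)

section \<open>Lifting of paths and crossing of independent loops\<close>

text \<open>The lift is a continuous logarithm along the contractible parameter interval; on the
  unit circle it is purely imaginary.\<close>

lemma lift_circle_path:
  assumes "path \<gamma>" "path_image \<gamma> \<subseteq> sphere 0 1"
  obtains \<theta> :: "real \<Rightarrow> real" where "continuous_on {0..1} \<theta>" "\<And>t. t \<in> {0..1} \<Longrightarrow> \<gamma> t = cis (2 * pi * \<theta> t)"
proof -
  have nz: "norm (\<gamma> t) = 1" if "t \<in> {0..1}" for t
    using subsetD[OF assms(2), of "\<gamma> t"] that by (simp add: path_image_def)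
  have "contractible {0..1::real}" by (intro convex_imp_contractible) auto
  then obtain g where g: "continuous_on {0..1} g" "\<And>t. t \<in> {0..1} \<Longrightarrow> \<gamma> t = exp (g t)"
    using assms(1) nz unfolding path_def
    by (metis continuous_logarithm_on_contractible norm_zero zero_neq_one)
  show thesis
  proof
    show "continuous_on {0..1} (\<lambda>t. Im (g t) / (2 * pi))"
      by (intro continuous_intros g) auto
    show "\<gamma> t = cis (2 * pi * (Im (g t) / (2 * pi)))" if "t \<in> {0..1}" for t
    proof -
      have "Re (g t) = 0" using nz[OF that] by (simp add: g(2)[OF that])
      then show ?thesis using g(2)[OF that] by (simp add: exp_eq_polar)
    qed
  qed
qed

lemma lift_torus_path:
  assumes "path \<gamma>" "path_image \<gamma> \<subseteq> torus"
  obtains L where "path L" "\<And>t. t \<in> {0..1} \<Longrightarrow> \<gamma> t = torus_cover (L t)"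
proof -
  obtain \<theta> where \<theta>: "continuous_on {0..1} \<theta>" "\<And>t. t \<in> {0..1} \<Longrightarrow> (fst \<circ> \<gamma>) t = cis (2 * pi * \<theta> t)"
    by (rule lift_circle_path[of "fst \<circ> \<gamma>"])
      (use assms in \<open>auto simp: path_def path_image_def torus_def intro!: continuous_intros\<close>)
  obtain \<psi> where \<psi>: "continuous_on {0..1} \<psi>" "\<And>t. t \<in> {0..1} \<Longrightarrow> (snd \<circ> \<gamma>) t = cis (2 * pi * \<psi> t)"
    by (rule lift_circle_path[of "snd \<circ> \<gamma>"])
      (use assms in \<open>auto simp: path_def path_image_def torus_def intro!: continuous_intros\<close>)
  show thesis
  proof
    show "path (\<lambda>t. Complex (\<theta> t) (\<psi> t))"
      unfolding path_def Complex_eq by (intro continuous_intros \<theta> \<psi>)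
    show "\<gamma> t = torus_cover (Complex (\<theta> t) (\<psi> t))" if "t \<in> {0..1}" for t
      using \<theta>(2)[OF that] \<psi>(2)[OF that] by (simp add: torus_cover_def prod_eq_iff)
  qed
qed

text \<open>Extends the periodic part of a lifted loop to the whole line; the pieces over successive
  unit intervals fit together because of \<open>P 0 = P 1\<close>.\<close>

lemma continuous_on_frac_loop:
  fixes P :: "real \<Rightarrow> 'a::topological_space"
  assumes "continuous_on {0..1} P" "P 0 = P 1"
  shows "continuous_on UNIV (\<lambda>x. P (frac x))"
proof -
  have seg: "continuous_on {of_int k..of_int k + 1} (\<lambda>x. P (frac x))" for k :: int
  proof (rule continuous_on_eq)
    show "continuous_on {of_int k..of_int k + 1} (\<lambda>x. P (x - of_int k))"
      by (rule continuous_on_compose2[OF assms(1)]) (auto intro!: continuous_intros)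
    show "P (x - of_int k) = P (frac x)" if "x \<in> {of_int k..of_int k + 1}" for x
    proof (cases "x = of_int k + 1")
      case True
      then show ?thesis using assms(2) by simp
    next
      case False
      then have "\<lfloor>x\<rfloor> = k" using that by (intro floor_unique) auto
      then show ?thesis by (simp add: frac_def)
    qed
  qed
  have "isCont (\<lambda>x. P (frac x)) x" for x :: real
  proof -
    \<comment> \<open>Rounding up makes \<open>x\<close> interior to the union of two adjacent unit
      intervals, even if \<open>x\<close> is an integer.\<close>
    define k where "k = \<lceil>x\<rceil> - 1"
    have k: "of_int k < x" "x \<le> of_int k + 1" unfolding k_def by linarith+
    have "continuous_on ({of_int k..of_int k + 1} \<union> {of_int (k + 1)..of_int (k + 1) + 1}) (\<lambda>x. P (frac x))"
      by (intro continuous_on_closed_Un seg) auto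
    then have "continuous_on {of_int k<..<of_int k + 2} (\<lambda>x. P (frac x))"
      by (rule continuous_on_subset) auto
    then show ?thesis
      using k by (simp add: continuous_on_eq_continuous_at)
  qed
  then show ?thesis by (simp add: continuous_at_imp_continuous_on)
qed

text \<open>Periodic curves in independent directions \<open>g\<close> and \<open>h\<close> cross: writing \<open>L\<close> and \<open>M\<close> as lines
  with a bounded perturbation, a crossing is a fixed point of a bounded map of the parameters.\<close>

lemma independent_loops_meet:
  fixes L M :: "real \<Rightarrow> complex"
  assumes L: "path L" "L 1 - L 0 \<in> lattice" and M: "path M" "M 1 - M 0 \<in> lattice"
    and ind: "Im (cnj (L 1 - L 0) * (M 1 - M 0)) \<noteq> 0"
  obtains s t where "s \<in> {0..1}" "t \<in> {0..1}" "L s - M t \<in> lattice"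
proof -
  define g where "g = L 1 - L 0"
  define h where "h = M 1 - M 0"
  define D where "D = Im (cnj g * h)"
  have D: "D \<noteq> 0" using ind by (simp add: D_def g_def h_def)
  define P where "P s = L s - of_real s * g" for s
  define Q where "Q t = M t - of_real t * h" for t
  define W where "W z = Q (frac (Im z)) - P (frac (Re z))" for z
  \<comment> \<open>Cramer's rule: with s and t the real and imaginary parts of \<open>F z\<close>,
    one has s g - t h = \<open>W z\<close>. A fixed point is therefore a pair of parameters at which
    the extensions of \<open>L\<close> and \<open>M\<close> to the whole line agree.\<close>
  define F where "F z = Complex (- Im (cnj h * W z) / D) (- Im (cnj g * W z) / D)" for z
  have contP: "continuous_on {0..1} P" and contQ: "continuous_on {0..1} Q"
    using L(1) M(1) unfolding P_def Q_def path_def by (auto intro!: continuous_intros)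
  have loops: "P 0 = P 1" "Q 0 = Q 1" by (simp_all add: P_def Q_def g_def h_def)
  have "continuous_on UNIV W"
    unfolding W_def
    by (intro continuous_intros continuous_on_compose2[OF continuous_on_frac_loop[OF contP loops(1)]]
        continuous_on_compose2[OF continuous_on_frac_loop[OF contQ loops(2)]]) auto
  then have contF: "continuous_on UNIV F"
    unfolding F_def Complex_eq using D by (intro continuous_intros) auto
  have "compact (P ` {0..1})" "compact (Q ` {0..1})"
    by (auto intro: compact_continuous_image contP contQ)
  then have "bounded (P ` {0..1})" "bounded (Q ` {0..1})" by (auto intro: compact_imp_bounded)
  then obtain B C where B: "\<And>s. s \<in> {0..1} \<Longrightarrow> norm (P s) \<le> B" "\<And>s. s \<in> {0..1} \<Longrightarrow> norm (Q s) \<le> C"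
    unfolding bounded_iff by (metis imageI)
  have frac01: "frac x \<in> {0..1}" for x :: real by (simp add: frac_ge_0 less_imp_le[OF frac_lt_1])
  have W: "norm (W z) \<le> C + B" for z
    unfolding W_def using norm_triangle_ineq4 B frac01 by (meson add_mono order_trans)
  define R where "R = (norm h * (C + B) + norm g * (C + B)) / \<bar>D\<bar> + 1"
  have F: "norm (F z) < R" for z
  proof -
    have "\<bar>Im (cnj h * W z)\<bar> \<le> norm h * (C + B)" "\<bar>Im (cnj g * W z)\<bar> \<le> norm g * (C + B)"
      using abs_Im_le_cmod[of "cnj h * W z"] abs_Im_le_cmod[of "cnj g * W z"] W[of z]
        mult_left_mono[OF W[of z], of "norm h"] mult_left_mono[OF W[of z], of "norm g"]
      by (auto simp: norm_mult simp del: mult.commute)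
    then have "\<bar>Re (F z)\<bar> + \<bar>Im (F z)\<bar> \<le> (norm h * (C + B) + norm g * (C + B)) / \<bar>D\<bar>"
      using D by (simp add: F_def abs_divide add_divide_distrib divide_right_mono add_mono)
    then show ?thesis using cmod_le[of "F z"] by (simp add: R_def)
  qed
  have R: "R > 0" using F[of 0] norm_ge_zero[of "F 0"] by linarith
  obtain z where z: "F z = z"
    by (rule brouwer_ball[OF R, of 0 F]) (use contF F in \<open>auto intro: continuous_on_subset less_imp_le[OF F]\<close>)
  have "D * Re z = - Im (cnj h * W z)" "D * Im z = - Im (cnj g * W z)"
    using D z by (auto simp: F_def complex_eq_iff field_simps)
  then have "of_real D * (of_real (Re z) * g - of_real (Im z) * h) = of_real D * W z"
    unfolding complex_eq_iff D_def by (simp add: algebra_simps) (algebra)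
  then have eq: "of_real (Re z) * g - of_real (Im z) * h = W z"
    using D by simp
  \<comment> \<open>Passing to fractional parts changes \<open>L\<close> and \<open>M\<close> by
    integer multiples of \<open>g\<close> and \<open>h\<close>, which are lattice vectors.\<close>
  have "L (frac (Re z)) - M (frac (Im z)) = of_int \<lfloor>Im z\<rfloor> * h - of_int \<lfloor>Re z\<rfloor> * g"
    using eq by (simp add: W_def P_def Q_def frac_def algebra_simps)
  then have "L (frac (Re z)) - M (frac (Im z)) \<in> lattice"
    using L(2) M(2) by (simp add: g_def h_def)
  then show thesis using that frac01 by blast
qed

text \<open>The generator is \<open>h\<close> divided by the gcd of its coordinates.\<close>

lemma lattice_primitive:
  assumes h: "h \<in> lattice" "h \<noteq> 0"
  obtains g where "g \<in> lattice" "g \<noteq> 0" "\<And>w. w \<in> lattice \<Longrightarrow> Im (cnj h * w) = 0 \<Longrightarrow> \<exists>k::int. w = of_int k * g"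
proof -
  obtain m n :: int where mn: "Re h = of_int m" "Im h = of_int n"
    using h(1) by (auto simp: lattice_def elim!: Ints_cases)
  define d where "d = gcd m n"
  have d: "d \<noteq> 0" using h(2) mn by (auto simp: d_def complex_eq_iff)
  obtain m' n' where mn': "m = m' * d" "n = n' * d" "coprime m' n'"
    using gcd_coprime_exists[of m n] d unfolding d_def by blast
  obtain u v where uv: "u * m' + v * n' = 1"
    using mn'(3) by (metis bezout_int coprime_imp_gcd_eq_1)
  define g where "g = Complex (of_int m') (of_int n')"
  show thesis
  proof
    show "g \<in> lattice" by (simp add: g_def lattice_def)
    show "g \<noteq> 0" using uv by (auto simp: g_def complex_eq_iff)
    fix w assume w: "w \<in> lattice" "Im (cnj h * w) = 0"
    obtain p q :: int where pq: "Re w = of_int p" "Im w = of_int q"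
      using w(1) by (auto simp: lattice_def elim!: Ints_cases)
    have "real_of_int (m * q - n * p) = 0" using w(2) by (simp add: mn pq)
    then have "m * q - n * p = 0" by (simp only: of_int_eq_0_iff)
    then have "d * (m' * q - n' * p) = 0" unfolding mn' by (simp add: algebra_simps)
    then have eq: "m' * q = n' * p" using d by simp
    have "(u * p + v * q) * m' = u * p * m' + v * (m' * q)" by (simp add: algebra_simps)
    also have "\<dots> = p * (u * m' + v * n')" unfolding eq by (simp add: algebra_simps)
    finally have 1: "(u * p + v * q) * m' = p * (u * m' + v * n')" .
    have "(u * p + v * q) * n' = u * (n' * p) + v * q * n'" by (simp add: algebra_simps)
    also have "\<dots> = q * (u * m' + v * n')" unfolding eq[symmetric] by (simp add: algebra_simps)
    finally have 2: "(u * p + v * q) * n' = q * (u * m' + v * n')" .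
    \<comment> \<open>The Bezout combination that takes the value 1 on the coordinates of
      \<open>g\<close> gives the factor when applied to those of \<open>w\<close>.\<close>
    define k where "k = u * p + v * q"
    have "real_of_int p = of_int (k * m')" "real_of_int q = of_int (k * n')"
      unfolding k_def by (simp_all only: 1 2 uv mult_1_right)
    then show "\<exists>k::int. w = of_int k * g"
      by (intro exI[of _ k]) (simp add: complex_eq_iff g_def pq)
  qed
qed

section \<open>Displacements of lifted paths and the holonomy of K33\<close>

text \<open>Only the displacement of the lift is recorded: it is unaffected by translating the lift,
  adds up under concatenation, and for \<open>p = q\<close> is the homology class of the
  loop.\<close>

definition torus_joined :: "(complex \<times> complex) set \<Rightarrow> complex \<times> complex \<Rightarrow> complex \<times> complex \<Rightarrow> complex \<Rightarrow> bool" where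
  "torus_joined S p q \<delta> \<longleftrightarrow> (\<exists>N. path N \<and> (\<forall>t\<in>{0..1}. torus_cover (N t) \<in> S) \<and>
     torus_cover (N 0) = p \<and> torus_cover (N 1) = q \<and> N 1 - N 0 = \<delta>)"

lemma torus_joinedI:
  assumes "path L" "\<And>t. t \<in> {0..1} \<Longrightarrow> \<gamma> t = torus_cover (L t)" "path_image \<gamma> \<subseteq> S"
    "\<gamma> 0 = p" "\<gamma> 1 = q"
  shows "torus_joined S p q (L 1 - L 0)"
proof -
  have "\<gamma> t \<in> S" if "t \<in> {0..1}" for t using assms(3) that by (auto simp: path_image_def)
  then have "torus_cover (L t) \<in> S" if "t \<in> {0..1}" for t using that assms(2)[OF that] by metis
  moreover have "torus_cover (L 0) = p" "torus_cover (L 1) = q"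
    using assms(2)[of 0] assms(2)[of 1] assms(4,5) by simp_all
  ultimately show ?thesis
    unfolding torus_joined_def using assms(1) by (intro exI[of _ L] conjI ballI) simp_all
qed

lemma torus_joined_sym:
  assumes "torus_joined S p q \<delta>"
  shows "torus_joined S q p (- \<delta>)"
proof -
  obtain N where N: "path N" "\<And>t. t\<in>{0..1} \<Longrightarrow> torus_cover (N t) \<in> S"
     "torus_cover (N 0) = p" "torus_cover (N 1) = q" "N 1 - N 0 = \<delta>"
    using assms unfolding torus_joined_def by blast
  have "path (reversepath N)" using N(1) by simp
  moreover have "reversepath N t = N (1 - t)" for t by (simp add: reversepath_def)
  ultimately show ?thesis
    unfolding torus_joined_def using N by (intro exI[of _ "reversepath N"]) auto
qed

lemma torus_joined_trans:
  assumes "torus_joined S p q \<delta>" "torus_joined S q r \<epsilon>"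
  shows "torus_joined S p r (\<delta> + \<epsilon>)"
proof -
  obtain N where N: "path N" "\<And>t. t\<in>{0..1} \<Longrightarrow> torus_cover (N t) \<in> S"
     "torus_cover (N 0) = p" "torus_cover (N 1) = q" "N 1 - N 0 = \<delta>"
    using assms(1) unfolding torus_joined_def by blast
  obtain M where M: "path M" "\<And>t. t\<in>{0..1} \<Longrightarrow> torus_cover (M t) \<in> S"
     "torus_cover (M 0) = q" "torus_cover (M 1) = r" "M 1 - M 0 = \<epsilon>"
    using assms(2) unfolding torus_joined_def by blast
  \<comment> \<open>The second lift is moved by a lattice vector so as to start where the first one
    ends; the curve on the torus stays the same.\<close>
  define M' where "M' t = M t + (N 1 - M 0)" for t
  have M't: "torus_cover (M' t) = torus_cover (M t)" for t
  proof -
    have "N 1 - M 0 \<in> lattice" using N(4) M(3) by (simp flip: torus_cover_eq_iff)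
    then show ?thesis by (simp add: torus_cover_eq_iff M'_def)
  qed
  have pM': "path M'" using M(1) unfolding path_def M'_def by (intro continuous_intros)
  have st: "pathfinish N = pathstart M'" by (simp add: pathfinish_def pathstart_def M'_def)
  have "torus_cover x \<in> S" if "x \<in> path_image (N +++ M')" for x
    using that N(2) M(2) path_image_join_subset[of N M'] by (auto simp: path_image_def M't)
  then have "torus_cover ((N +++ M') t) \<in> S" if "t \<in> {0..1}" for t
    using that by (simp add: path_image_def)
  moreover have "(N +++ M') 0 = N 0" "(N +++ M') 1 = M' 1" by (simp_all add: joinpaths_def)
  moreover have "path (N +++ M')" using N(1) pM' st by simp
  moreover have "M' 1 - N 0 = \<delta> + \<epsilon>" using N(5) M(5) by (simp add: M'_def flip: N(5) M(5))
  ultimately show ?thesis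
    unfolding torus_joined_def using N(3) M(4)
    by (intro exI[of _ "N +++ M'"]) (simp add: M't)
qed

locale torus_K33 =
  fixes a b :: "nat \<Rightarrow> complex \<times> complex" and \<gamma> :: "nat \<Rightarrow> nat \<Rightarrow> real \<Rightarrow> complex \<times> complex"
    and L :: "nat \<Rightarrow> nat \<Rightarrow> real \<Rightarrow> complex"
  assumes K: "K33_drawing a b \<gamma>"
    and path_L: "i < 3 \<Longrightarrow> j < 3 \<Longrightarrow> path (L i j)"
    and lift: "i < 3 \<Longrightarrow> j < 3 \<Longrightarrow> t \<in> {0..1} \<Longrightarrow> \<gamma> i j t = torus_cover (L i j t)"
begin

definition displ :: "nat \<Rightarrow> nat \<Rightarrow> complex" where
  "displ i j = L i j 1 - L i j 0"

text \<open>Displacement along the four-cycle a_i b_j a_1 b_1. It vanishes identically if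
  \<open>i = 1\<close> or \<open>j = 1\<close>; the other four cycles form a basis of the cycle
  space.\<close>

definition hol :: "nat \<Rightarrow> nat \<Rightarrow> complex" where
  "hol i j = displ i j - displ 1 j + displ 1 1 - displ i 1"

definition cycle_image :: "nat \<Rightarrow> nat \<Rightarrow> (complex \<times> complex) set" where
  "cycle_image i j = path_image (\<gamma> i j) \<union> path_image (\<gamma> 1 j) \<union> path_image (\<gamma> 1 1) \<union> path_image (\<gamma> i 1)"

lemma ends_lift:
  assumes "i < 3" "j < 3"
  shows "torus_cover (L i j 0) = a i" "torus_cover (L i j 1) = b j"
  using K33_drawingD(4,5)[OF K assms] lift[OF assms, of 0] lift[OF assms, of 1] by simp_all

lemma joined:
  assumes "i < 3" "j < 3" "path_image (\<gamma> i j) \<subseteq> S"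
  shows "torus_joined S (a i) (b j) (displ i j)"
  unfolding displ_def
  by (rule torus_joinedI[OF path_L[OF assms(1,2)] lift[OF assms(1,2)] assms(3)])
    (simp_all add: K33_drawingD[OF K assms(1,2)])

lemma hol_joined:
  assumes "i < 3" "j < 3"
  shows "torus_joined (cycle_image i j) (a i) (a i) (hol i j)"
proof -
  let ?S = "cycle_image i j"
  have "torus_joined ?S (a i) (b j) (displ i j)" "torus_joined ?S (b j) (a 1) (- displ 1 j)"
    "torus_joined ?S (a 1) (b 1) (displ 1 1)" "torus_joined ?S (b 1) (a i) (- displ i 1)"
    using assms by (intro torus_joined_sym joined; auto simp: cycle_image_def)+
  from torus_joined_trans[OF torus_joined_trans[OF torus_joined_trans[OF this(1,2)] this(3)] this(4)]
  show ?thesis by (simp add: hol_def algebra_simps)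
qed

lemma hol_lattice:
  assumes "i < 3" "j < 3"
  shows "hol i j \<in> lattice"
  using hol_joined[OF assms] unfolding torus_joined_def by (metis torus_cover_eq_iff)

text \<open>If all holonomies are multiples of \<open>g\<close>, the drawing lifts to the annulus \<open>\<complex> / \<int>g\<close>, which
  \<open>z \<mapsto> exp (2\<pi>iz/g)\<close> embeds in the plane.\<close>

lemma hol_not_cyclic:
  assumes g: "g \<in> lattice" "g \<noteq> 0"
  shows "\<exists>i<3. \<exists>j<3. \<forall>k::int. hol i j \<noteq> of_int k * g"
proof (rule ccontr)
  assume "\<not> ?thesis"
  then have cyc: "\<exists>k::int. hol i j = of_int k * g" if "i < 3" "j < 3" for i j using that by blast
  \<comment> \<open>The vertices are lifted along a spanning tree: the lift of b_1 is the end of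
    \<open>L 0 1\<close>, the edges at b_1 place the a_i, and the edges at a_1 then place the
    b_j.\<close>
  define qa where "qa i = L 0 1 1 - displ i 1" for i
  define qb where "qb j = L 0 1 1 - displ 1 1 + displ 1 j" for j
  define \<Gamma> where "\<Gamma> i j t = L i j t + (qa i - L i j 0)" for i j t
  define \<phi> where "\<phi> z = exp (2 * of_real pi * \<i> * (z / g))" for z
  have \<phi>: "\<phi> z = \<phi> w \<longleftrightarrow> (\<exists>k::int. z - w = of_int k * g)" for z w
  proof -
    define u where "u = (z - w) / g"
    have "\<phi> z = \<phi> w \<longleftrightarrow> exp (2 * of_real pi * \<i> * u) = 1"
      unfolding \<phi>_def u_def by (simp add: exp_diff diff_divide_distrib right_diff_distrib)
    also have "\<dots> \<longleftrightarrow> (\<exists>k::int. Im u = 0 \<and> Re u = of_int k)"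
      unfolding exp_eq_1 by auto
    also have "\<dots> \<longleftrightarrow> (\<exists>k::int. (z - w) / g = of_int k)"
      by (simp add: complex_eq_iff conj_commute flip: u_def)
    also have "\<dots> \<longleftrightarrow> (\<exists>k::int. z - w = of_int k * g)" using g(2) by (simp add: field_simps)
    finally show ?thesis .
  qed
  have qa: "qa i - L i j 0 \<in> lattice" if "i < 3" "j < 3" for i j
  proof -
    have "L 0 1 1 - L i 1 1 \<in> lattice" "L i 1 0 - L i j 0 \<in> lattice"
      using that by (simp_all add: ends_lift flip: torus_cover_eq_iff)
    from lattice_simps(4)[OF this] show ?thesis by (simp add: qa_def displ_def algebra_simps)
  qed
  have cover: "torus_cover (\<Gamma> i j t) = \<gamma> i j t" if "i < 3" "j < 3" "t \<in> {0..1}" for i j t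
    using qa[OF that(1,2)] lift[OF that] by (simp add: torus_cover_eq_iff \<Gamma>_def)
  have "K33_drawing (\<phi> \<circ> qa) (\<phi> \<circ> qb) (\<lambda>i j. \<phi> \<circ> \<Gamma> i j)"
    unfolding K33_drawing_def
  proof (intro conjI allI impI ballI)
    fix i j k l :: nat and s t :: real
    assume h: "i < 3" "j < 3" "k < 3" "l < 3" "s \<in> {0..1}" "t \<in> {0..1}" "(\<phi> \<circ> \<Gamma> i j) s = (\<phi> \<circ> \<Gamma> k l) t"
    then have "\<Gamma> i j s - \<Gamma> k l t \<in> lattice" using \<phi> g(1) by auto
    then have "\<gamma> i j s = \<gamma> k l t"
      using h cover by (simp flip: torus_cover_eq_iff)
    then show "i = k \<and> j = l \<and> s = t \<or> i = k \<and> s = 0 \<and> t = 0 \<or> j = l \<and> s = 1 \<and> t = 1"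
      using K33_drawing_inj[OF K h(1-6)] by simp
  next
    fix i j :: nat assume ij: "i < 3" "j < 3"
    show "path (\<phi> \<circ> \<Gamma> i j)"
      using path_L[OF ij] g(2) unfolding path_def \<phi>_def \<Gamma>_def o_def by (auto intro!: continuous_intros)
    show "pathstart (\<phi> \<circ> \<Gamma> i j) = (\<phi> \<circ> qa) i"
      by (simp add: pathstart_def \<Gamma>_def)
    \<comment> \<open>The translated edge misses the lifted end by a holonomy, a multiple of
      \<open>g\<close>, which \<open>\<phi>\<close> does not see.\<close>
    have "\<Gamma> i j 1 - qb j = hol i j"
      by (simp add: \<Gamma>_def qa_def qb_def hol_def displ_def algebra_simps)
    then show "pathfinish (\<phi> \<circ> \<Gamma> i j) = (\<phi> \<circ> qb) j"
      using cyc[OF ij] by (simp add: pathfinish_def \<phi>)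
  qed
  then show False by (rule K33_not_planar)
qed

text \<open>If \<open>h\<close> were nonzero, all classes parallel to \<open>h\<close> would be
  multiples of one primitive vector. As the holonomy is not cyclic, some four-cycle of the K33 has a
  class independent of \<open>h\<close> and so crosses the loop, contrary to disjointness.\<close>

lemma disjoint_loop_trivial:
  assumes j: "torus_joined S p p h" and S: "\<And>i j. i < 3 \<Longrightarrow> j < 3 \<Longrightarrow> S \<inter> path_image (\<gamma> i j) = {}"
  shows "h = 0"
proof (rule ccontr)
  assume h: "h \<noteq> 0"
  obtain M where M: "path M" "\<And>t. t\<in>{0..1} \<Longrightarrow> torus_cover (M t) \<in> S"
     "torus_cover (M 0) = p" "torus_cover (M 1) = p" "M 1 - M 0 = h"
    using j unfolding torus_joined_def by blast
  have hl: "h \<in> lattice" using M by (simp flip: M(5) torus_cover_eq_iff)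
  obtain g where g: "g \<in> lattice" "g \<noteq> 0" "\<And>w. w \<in> lattice \<Longrightarrow> Im (cnj h * w) = 0 \<Longrightarrow> \<exists>k::int. w = of_int k * g"
    using lattice_primitive[OF hl h] by blast
  obtain i j where ij: "i < 3" "j < 3" "\<And>k::int. hol i j \<noteq> of_int k * g"
    using hol_not_cyclic[OF g(1,2)] by blast
  have ind: "Im (cnj h * hol i j) \<noteq> 0" using g(3)[OF hol_lattice] ij by blast
  obtain N where N: "path N" "\<And>t. t\<in>{0..1} \<Longrightarrow> torus_cover (N t) \<in> cycle_image i j" "N 1 - N 0 = hol i j"
    using hol_joined[OF ij(1,2)] unfolding torus_joined_def by blast
  obtain s t where st: "s \<in> {0..1}" "t \<in> {0..1}" "M s - N t \<in> lattice"
    by (rule independent_loops_meet[of M N]) (use M N ind hl hol_lattice ij in auto)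
  then have "torus_cover (M s) = torus_cover (N t)" by (simp add: torus_cover_eq_iff)
  then have "S \<inter> cycle_image i j \<noteq> {}" using M(2)[OF st(1)] N(2)[OF st(2)] by auto
  then show False
    using S[of i j] S[of 1 j] S[of 1 1] S[of i 1] ij by (simp add: cycle_image_def Int_Un_distrib)
qed

end

lemma torus_K33_exists:
  assumes K: "K33_drawing a b \<gamma>" and torus: "\<And>i j. i < 3 \<Longrightarrow> j < 3 \<Longrightarrow> path_image (\<gamma> i j) \<subseteq> torus"
  obtains L where "torus_K33 a b \<gamma> L"
proof -
  have "\<forall>i j. \<exists>L. i < 3 \<and> j < 3 \<longrightarrow> path L \<and> (\<forall>t\<in>{0..1}. \<gamma> i j t = torus_cover (L t))"
    using lift_torus_path[OF K33_drawingD(1)[OF K] torus] by metis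
  then obtain L where "\<And>i j. i < 3 \<and> j < 3 \<longrightarrow> path (L i j) \<and> (\<forall>t\<in>{0..1}. \<gamma> i j t = torus_cover (L i j t))"
    by metis
  then have "torus_K33 a b \<gamma> L" using K by unfold_locales auto
  then show thesis using that by blast
qed

text \<open>The cycles \<open>a\<^sub>i b\<^sub>j a\<^sub>1 b\<^sub>1\<close> in question generate the cycle space of \<open>K\<^sub>3\<^sub>,\<^sub>3\<close> without the edge
  \<open>a\<^sub>0 b\<^sub>0\<close>.  A disjoint \<open>K\<^sub>3\<^sub>,\<^sub>3\<close> makes each of them null-homotopic, so that the holonomy of the
  whole drawing is cyclic.\<close>

theorem torus_K33_cycles_meet:
  assumes K: "K33_drawing a b \<gamma>" and torus: "\<And>i j. i < 3 \<Longrightarrow> j < 3 \<Longrightarrow> path_image (\<gamma> i j) \<subseteq> torus"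
    and other: "\<And>i j. (i, j) \<in> {(0, 2), (2, 2), (2, 0)} \<Longrightarrow> \<exists>a' b' \<gamma>'. K33_drawing a' b' \<gamma>' \<and>
      (\<forall>k<3. \<forall>l<3. path_image (\<gamma>' k l) \<subseteq> torus \<and> (\<forall>u\<in>{i, 1}. \<forall>v\<in>{j, 1}. path_image (\<gamma> u v) \<inter> path_image (\<gamma>' k l) = {}))"
  shows False
proof -
  obtain L where "torus_K33 a b \<gamma> L" using torus_K33_exists[OF K torus] .
  then interpret torus_K33 a b \<gamma> L .
  have zero: "hol i j = 0" if ij: "(i, j) \<in> {(0, 2), (2, 2), (2, 0)}" for i j
  proof -
    obtain a' b' \<gamma>' where K': "K33_drawing a' b' \<gamma>'" and torus': "\<And>k l. k < 3 \<Longrightarrow> l < 3 \<Longrightarrow> path_image (\<gamma>' k l) \<subseteq> torus"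
      and disj: "\<And>k l u v. \<lbrakk>k < 3; l < 3; u \<in> {i, 1}; v \<in> {j, 1}\<rbrakk> \<Longrightarrow> path_image (\<gamma> u v) \<inter> path_image (\<gamma>' k l) = {}"
      using other[OF ij] by blast
    obtain L' where "torus_K33 a' b' \<gamma>' L'" using torus_K33_exists[OF K' torus'] .
    then interpret K': torus_K33 a' b' \<gamma>' L' .
    have "i < 3" "j < 3" using ij by auto
    from hol_joined[OF this] show ?thesis
    proof (rule K'.disjoint_loop_trivial)
      show "cycle_image i j \<inter> path_image (\<gamma>' k l) = {}" if "k < 3" "l < 3" for k l
        using disj[OF that] by (simp add: cycle_image_def Int_Un_distrib2)
    qed
  qed
  \<comment> \<open>The value 1 in the case of trivial holonomy keeps the generator nonzero, as the
    map to the annulus requires.\<close>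
  define g where "g = (if hol 0 0 = 0 then 1 else hol 0 0)"
  have "g \<in> lattice" "g \<noteq> 0" using hol_lattice[of 0 0] by (auto simp: g_def)
  from hol_not_cyclic[OF this] obtain i j where ij: "i < 3" "j < 3" "\<And>k::int. hol i j \<noteq> of_int k * g"
    by blast
  have "hol i j \<in> {0, g}"
  proof -
    have "i \<in> {0, 1, 2}" "j \<in> {0, 1, 2}" using ij by auto
    then show ?thesis
      using zero[of 0 2] zero[of 2 2] zero[of 2 0] by (auto simp: g_def hol_def)
  qed
  then show False using ij(3)[of 0] ij(3)[of 1] by auto
qed

section \<open>Drawings of subdivisions\<close>

lemma undirected_edgesI: "(u, v) \<in> arcs_ends G \<Longrightarrow> {u, v} \<in> undirected_edges G"
  by (auto simp: undirected_edges_def)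

lemma crossing_free_drawingD:
  assumes "crossing_free_drawing S G p \<gamma>"
  shows "inj_on p (verts G)" "p ` verts G \<subseteq> S"
    "e \<in> undirected_edges G \<Longrightarrow> arc (\<gamma> e)"
    "e \<in> undirected_edges G \<Longrightarrow> path_image (\<gamma> e) \<subseteq> S"
    "e \<in> undirected_edges G \<Longrightarrow> {pathstart (\<gamma> e), pathfinish (\<gamma> e)} = p ` e"
    "e \<in> undirected_edges G \<Longrightarrow> path_image (\<gamma> e) \<inter> p ` verts G = p ` e"
    "e \<in> undirected_edges G \<Longrightarrow> f \<in> undirected_edges G \<Longrightarrow> e \<noteq> f \<Longrightarrow>
      path_image (\<gamma> e) \<inter> path_image (\<gamma> f) = p ` (e \<inter> f)"
proof -
  note * = assms[unfolded crossing_free_drawing_def]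
  note edge = *[THEN conjunct2, THEN conjunct2, THEN conjunct1, rule_format]
  note edges = *[THEN conjunct2, THEN conjunct2, THEN conjunct2, rule_format]
  show "inj_on p (verts G)" "p ` verts G \<subseteq> S"
    by (rule *[THEN conjunct1], rule *[THEN conjunct2, THEN conjunct1])
  show "arc (\<gamma> e)" "path_image (\<gamma> e) \<subseteq> S" "{pathstart (\<gamma> e), pathfinish (\<gamma> e)} = p ` e"
    "path_image (\<gamma> e) \<inter> p ` verts G = p ` e" if "e \<in> undirected_edges G"
    using edge[OF that] by blast+
  show "path_image (\<gamma> e) \<inter> path_image (\<gamma> f) = p ` (e \<inter> f)"
    if "e \<in> undirected_edges G" "f \<in> undirected_edges G" "e \<noteq> f"
    by (rule edges[OF that])
qed

lemma crossing_free_drawing_embed: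
  assumes H: "crossing_free_drawing S H p \<gamma>"
    and inj: "inj_on f (verts G)" and V: "f ` verts G \<subseteq> verts H" and wf: "arcs_ends G \<subseteq> verts G \<times> verts G"
    and E: "\<And>u v. (u, v) \<in> arcs_ends G \<Longrightarrow> {f u, f v} \<in> undirected_edges H"
  shows "crossing_free_drawing S G (p \<circ> f) (\<lambda>e. \<gamma> (f ` e))"
proof -
  note D = crossing_free_drawingD[OF H]
  have e: "f ` e \<in> undirected_edges H" "e \<subseteq> verts G" if "e \<in> undirected_edges G" for e
    using that E wf by (auto simp: undirected_edges_def)
  have "inj_on (p \<circ> f) (verts G)"
    using inj V D(1) by (meson comp_inj_on inj_on_subset)
  show ?thesis
    unfolding crossing_free_drawing_def
  proof (intro conjI ballI impI)
    show "inj_on (p \<circ> f) (verts G)" by fact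
    show "(p \<circ> f) ` verts G \<subseteq> S" using V D(2) by auto
  next
    fix d assume d: "d \<in> undirected_edges G"
    show "arc (\<gamma> (f ` d))" "path_image (\<gamma> (f ` d)) \<subseteq> S"
      "{pathstart (\<gamma> (f ` d)), pathfinish (\<gamma> (f ` d))} = (p \<circ> f) ` d"
      using D(3-5)[OF e(1)[OF d]] by (simp_all add: image_comp)
    show "path_image (\<gamma> (f ` d)) \<inter> (p \<circ> f) ` verts G = (p \<circ> f) ` d"
    proof
      show "path_image (\<gamma> (f ` d)) \<inter> (p \<circ> f) ` verts G \<subseteq> (p \<circ> f) ` d"
      proof
        fix z assume z: "z \<in> path_image (\<gamma> (f ` d)) \<inter> (p \<circ> f) ` verts G"
        then have "z \<in> path_image (\<gamma> (f ` d)) \<inter> p ` verts H" using V by auto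
        then show "z \<in> (p \<circ> f) ` d" unfolding D(6)[OF e(1)[OF d]] by (simp add: image_comp)
      qed
      have "(p \<circ> f) ` d \<subseteq> path_image (\<gamma> (f ` d))"
        using D(6)[OF e(1)[OF d]] by (auto simp: image_comp)
      then show "(p \<circ> f) ` d \<subseteq> path_image (\<gamma> (f ` d)) \<inter> (p \<circ> f) ` verts G" using e(2)[OF d] by auto
    qed
    fix d' assume d': "d' \<in> undirected_edges G" "d \<noteq> d'"
    have "f ` d \<noteq> f ` d'" using d' e(2)[OF d] e(2)[OF d'(1)] inj by (simp add: inj_on_image_eq_iff)
    from D(7)[OF e(1)[OF d] e(1)[OF d'(1)] this]
    have "path_image (\<gamma> (f ` d)) \<inter> path_image (\<gamma> (f ` d')) = p ` (f ` d \<inter> f ` d')" .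
    also have "f ` d \<inter> f ` d' = f ` (d \<inter> d')"
      using e(2)[OF d] e(2)[OF d'(1)] inj by (simp add: inj_on_image_Int)
    finally show "path_image (\<gamma> (f ` d)) \<inter> path_image (\<gamma> (f ` d')) = (p \<circ> f) ` (d \<inter> d')"
      by (simp add: image_comp)
  qed
qed

lemma toroidal_embed:
  assumes "toroidal H" "inj_on f (verts G)" "f ` verts G \<subseteq> verts H" "arcs_ends G \<subseteq> verts G \<times> verts G"
    "\<And>u v. (u, v) \<in> arcs_ends G \<Longrightarrow> {f u, f v} \<in> undirected_edges H"
  shows "toroidal G"
  using assms crossing_free_drawing_embed unfolding toroidal_def by metis

section \<open>Vertex paths in a drawing and subdivisions of K33\<close>

fun edges_of :: "'a list \<Rightarrow> 'a set set" where
  "edges_of (u # v # r) = insert {u, v} (edges_of (v # r))"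
| "edges_of _ = {}"

lemma edges_of_subset: "e \<in> edges_of xs \<Longrightarrow> e \<subseteq> set xs"
  by (induction xs rule: edges_of.induct) auto

lemma Union_edges_of: "\<Union>(edges_of xs) \<subseteq> set xs"
  using edges_of_subset by blast

lemma edges_of_nonempty: "e \<in> edges_of xs \<Longrightarrow> e \<noteq> {}"
  by (induction xs rule: edges_of.induct) auto

lemma edges_of_distinct: "e \<in> edges_of xs \<Longrightarrow> distinct xs \<Longrightarrow> \<exists>u v. e = {u, v} \<and> u \<noteq> v"
  by (induction xs rule: edges_of.induct) auto

locale crossing_free =
  fixes S :: "'p::topological_space set" and G :: "('a, 'b) pre_digraph" and p \<gamma>
  assumes drawing: "crossing_free_drawing S G p \<gamma>"
begin

lemmas D = crossing_free_drawingD[OF drawing]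

text \<open>The drawing fixes one curve per undirected edge, in an unspecified direction; this is
  the curve traversed from \<open>u\<close> to \<open>v\<close>.\<close>

definition opath :: "'a \<Rightarrow> 'a \<Rightarrow> real \<Rightarrow> 'p" where
  "opath u v = (if pathstart (\<gamma> {u, v}) = p u then \<gamma> {u, v} else reversepath (\<gamma> {u, v}))"

fun vpath :: "'a list \<Rightarrow> real \<Rightarrow> 'p" where
  "vpath (u # v # w # r) = opath u v +++ vpath (v # w # r)"
| "vpath (u # v # _) = opath u v"
| "vpath _ = undefined"

lemma opath:
  assumes "{u, v} \<in> undirected_edges G"
  shows "arc (opath u v)" "pathstart (opath u v) = p u" "pathfinish (opath u v) = p v"
    "path_image (opath u v) = path_image (\<gamma> {u, v})"
proof -
  have st: "{pathstart (\<gamma> {u, v}), pathfinish (\<gamma> {u, v})} = {p u, p v}" using D(5)[OF assms] by simp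
  show "arc (opath u v)" "path_image (opath u v) = path_image (\<gamma> {u, v})"
    using D(3)[OF assms] by (simp_all add: opath_def arc_reversepath)
  show "pathstart (opath u v) = p u" "pathfinish (opath u v) = p v"
    using st by (auto simp: opath_def doubleton_eq_iff)
qed

text \<open>Curves of different edges share only common ends, so edge-disjoint unions meet only at
  common vertices. This yields both that a path of edges is an arc and that different paths do not
  cross.\<close>

lemma Int_edges:
  assumes "E \<subseteq> undirected_edges G" "F \<subseteq> undirected_edges G" "E \<inter> F = {}"
    "\<Union>E \<subseteq> X" "\<Union>F \<subseteq> Y"
  shows "(\<Union>e\<in>E. path_image (\<gamma> e)) \<inter> (\<Union>e\<in>F. path_image (\<gamma> e)) \<subseteq> p ` (X \<inter> Y)"
proof
  fix z assume "z \<in> (\<Union>e\<in>E. path_image (\<gamma> e)) \<inter> (\<Union>e\<in>F. path_image (\<gamma> e))"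
  then obtain e f where ef: "e \<in> E" "f \<in> F" "z \<in> path_image (\<gamma> e) \<inter> path_image (\<gamma> f)" by blast
  moreover have "e \<noteq> f" using ef assms(3) by blast
  ultimately have "z \<in> p ` (e \<inter> f)" using D(7)[of e f] assms(1,2) by blast
  then show "z \<in> p ` (X \<inter> Y)" using ef assms(4,5) by blast
qed

lemma vpath:
  assumes "2 \<le> length xs" "distinct xs" "set xs \<subseteq> verts G" "edges_of xs \<subseteq> undirected_edges G"
  shows "arc (vpath xs) \<and> pathstart (vpath xs) = p (hd xs) \<and> pathfinish (vpath xs) = p (last xs) \<and>
    path_image (vpath xs) = (\<Union>e\<in>edges_of xs. path_image (\<gamma> e))"
  using assms
proof (induction xs rule: vpath.induct)
  case (1 u v w r)
  let ?ys = "v # w # r"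
  have IH: "arc (vpath ?ys)" "pathstart (vpath ?ys) = p v" "pathfinish (vpath ?ys) = p (last ?ys)"
    "path_image (vpath ?ys) = (\<Union>e\<in>edges_of ?ys. path_image (\<gamma> e))"
    using 1 by auto
  have e: "{u, v} \<in> undirected_edges G" using 1 by simp
  have "{u, v} \<notin> edges_of ?ys" using edges_of_subset[of "{u, v}" ?ys] 1 by auto
  then have disj: "{{u, v}} \<inter> edges_of ?ys = {}" by blast
  have sub: "{{u, v}} \<subseteq> undirected_edges G" "edges_of ?ys \<subseteq> undirected_edges G" "\<Union>{{u, v}} \<subseteq> {u, v}"
    using e 1 by auto
  have "(\<Union>e\<in>{{u, v}}. path_image (\<gamma> e)) \<inter> (\<Union>e\<in>edges_of ?ys. path_image (\<gamma> e)) \<subseteq> p ` ({u, v} \<inter> set ?ys)"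
    by (rule Int_edges[OF sub(1,2) disj sub(3) Union_edges_of])
  also have "{u, v} \<inter> set ?ys = {v}" using 1 by auto
  finally have "path_image (opath u v) \<inter> path_image (vpath ?ys) \<subseteq> {p v}"
    using opath(4)[OF e] IH(4) by simp
  then have "arc (opath u v +++ vpath ?ys)"
    using opath[OF e] IH by (intro arc_join) auto
  then show ?case
    using opath[OF e] IH by (simp add: path_image_join)
qed (auto simp: opath)

end

text \<open>A subdivision of K33 as nine vertex lists in row order: list 3 i + j runs from a_i to
  b_j, and the branch vertices are read off from the first column and the first row. No graph is
  mentioned, so the condition can be checked by evaluation on concrete lists.\<close>

definition K33_paths :: "'a list list \<Rightarrow> bool" where
  "K33_paths ps \<longleftrightarrow> (\<forall>i<3. \<forall>j<3.
     distinct (ps ! (3 * i + j)) \<and> 2 \<le> length (ps ! (3 * i + j)) \<and>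
     hd (ps ! (3 * i + j)) = hd (ps ! (3 * i)) \<and> last (ps ! (3 * i + j)) = last (ps ! j) \<and>
     (\<forall>k<3. \<forall>l<3. (i, j) \<noteq> (k, l) \<longrightarrow> set (ps ! (3 * i + j)) \<inter> set (ps ! (3 * k + l)) \<subseteq>
        (if i = k then {hd (ps ! (3 * i))} else {}) \<union> (if j = l then {last (ps ! j)} else {})))"

definition paths_in :: "('a, 'b) pre_digraph \<Rightarrow> 'a list list \<Rightarrow> bool" where
  "paths_in G ps \<longleftrightarrow> length ps = 9 \<and>
     (\<forall>xs\<in>set ps. set xs \<subseteq> verts G \<and> edges_of xs \<subseteq> undirected_edges G)"

lemma (in crossing_free) K33_paths_drawing:
  assumes ps: "K33_paths ps" "paths_in G ps"
  shows "K33_drawing (\<lambda>i. p (hd (ps ! (3 * i)))) (\<lambda>j. p (last (ps ! j))) (\<lambda>i j. vpath (ps ! (3 * i + j)))" (is ?K)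
    and "i < 3 \<Longrightarrow> j < 3 \<Longrightarrow> path_image (vpath (ps ! (3 * i + j))) = (\<Union>e\<in>edges_of (ps ! (3 * i + j)). path_image (\<gamma> e))"
proof -
  have len: "length ps = 9" using ps(2) by (simp add: paths_in_def)
  have mem: "ps ! (3 * i + j) \<in> set ps" if "i < 3" "j < 3" for i j
    using that len by (intro nth_mem) simp
  have inG: "set (ps ! (3 * i + j)) \<subseteq> verts G" "edges_of (ps ! (3 * i + j)) \<subseteq> undirected_edges G"
    if "i < 3" "j < 3" for i j
    using mem[OF that] ps(2) unfolding paths_in_def by blast+
  have P: "distinct (ps ! (3 * i + j))" "2 \<le> length (ps ! (3 * i + j))"
    "hd (ps ! (3 * i + j)) = hd (ps ! (3 * i))" "last (ps ! (3 * i + j)) = last (ps ! j)" if "i < 3" "j < 3" for i j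
    using ps(1) that unfolding K33_paths_def by blast+
  have int: "set (ps ! (3 * i + j)) \<inter> set (ps ! (3 * k + l)) \<subseteq>
        (if i = k then {hd (ps ! (3 * i))} else {}) \<union> (if j = l then {last (ps ! j)} else {})"
    if "i < 3" "j < 3" "k < 3" "l < 3" "(i, j) \<noteq> (k, l)" for i j k l
    using ps(1) that unfolding K33_paths_def by blast
  have V: "arc (vpath (ps ! (3 * i + j)))" "pathstart (vpath (ps ! (3 * i + j))) = p (hd (ps ! (3 * i)))"
    "pathfinish (vpath (ps ! (3 * i + j))) = p (last (ps ! j))"
    "path_image (vpath (ps ! (3 * i + j))) = (\<Union>e\<in>edges_of (ps ! (3 * i + j)). path_image (\<gamma> e))" if "i < 3" "j < 3" for i j
    using vpath[OF P(2,1)[OF that] inG[OF that]] P(3,4)[OF that] by simp_all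
  show "i < 3 \<Longrightarrow> j < 3 \<Longrightarrow> path_image (vpath (ps ! (3 * i + j))) = (\<Union>e\<in>edges_of (ps ! (3 * i + j)). path_image (\<gamma> e))"
    by (rule V(4))
  show ?K
    unfolding K33_drawing_def
  proof (intro conjI allI impI ballI)
    fix i j k l :: nat and s t :: real
    assume h: "i < 3" "j < 3" "k < 3" "l < 3" "s \<in> {0..1}" "t \<in> {0..1}"
      "vpath (ps ! (3 * i + j)) s = vpath (ps ! (3 * k + l)) t"
    let ?xs = "ps ! (3 * i + j)" and ?ys = "ps ! (3 * k + l)"
    have inj: "inj_on (vpath ?xs) {0..1}" "inj_on (vpath ?ys) {0..1}" using V(1) h by (auto simp: arc_def)
    show "i = k \<and> j = l \<and> s = t \<or> i = k \<and> s = 0 \<and> t = 0 \<or> j = l \<and> s = 1 \<and> t = 1"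
    proof (cases "(i, j) = (k, l)")
      case True
      then show ?thesis using inj h by (auto dest: inj_onD)
    next
      case False
      \<comment> \<open>Different paths share at most one vertex, whereas an edge of a path has
        two.\<close>
      have edges: "edges_of ?xs \<inter> edges_of ?ys = {}"
      proof (rule ccontr)
        assume "edges_of ?xs \<inter> edges_of ?ys \<noteq> {}"
        then obtain e where e: "e \<in> edges_of ?xs" "e \<in> edges_of ?ys" by blast
        then obtain u v where uv: "e = {u, v}" "u \<noteq> v" using edges_of_distinct P(1)[OF h(1,2)] by metis
        have "{u, v} \<subseteq> set ?xs \<inter> set ?ys" using e uv edges_of_subset by blast
        then show False using int[OF h(1-4) False] uv(2) False by (auto split: if_splits)
      qed
      define z where "z = vpath ?xs s"
      have z: "z \<in> path_image (vpath ?xs)" "z \<in> path_image (vpath ?ys)"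
        unfolding path_image_def z_def using imageI[OF h(5)] imageI[OF h(6)] h(7) by metis+
      then have "z \<in> p ` (set ?xs \<inter> set ?ys)"
        unfolding V(4)[OF h(1,2)] V(4)[OF h(3,4)]
        using subsetD[OF Int_edges[OF inG(2)[OF h(1,2)] inG(2)[OF h(3,4)] edges Union_edges_of Union_edges_of], of z] by simp
      then have "i = k \<and> z = p (hd (ps ! (3 * i))) \<or> j = l \<and> z = p (last (ps ! j))"
        using int[OF h(1-4) False] by (auto split: if_splits)
      then show ?thesis
      proof (elim disjE conjE)
        assume "i = k" "z = p (hd (ps ! (3 * i)))"
        then have "vpath ?xs s = vpath ?xs 0" "vpath ?ys t = vpath ?ys 0"
          using V(2)[OF h(1,2)] V(2)[OF h(3,4)] h(7) unfolding z_def pathstart_def by metis+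
        then have "s = 0" "t = 0"
          using inj_onD[OF inj(1) _ h(5), of 0] inj_onD[OF inj(2) _ h(6), of 0] by simp_all
        then show ?thesis using \<open>i = k\<close> by simp
      next
        assume "j = l" "z = p (last (ps ! j))"
        then have "vpath ?xs s = vpath ?xs 1" "vpath ?ys t = vpath ?ys 1"
          using V(3)[OF h(1,2)] V(3)[OF h(3,4)] h(7) unfolding z_def pathfinish_def by metis+
        then have "s = 1" "t = 1"
          using inj_onD[OF inj(1) _ h(5), of 1] inj_onD[OF inj(2) _ h(6), of 1] by simp_all
        then show ?thesis using \<open>j = l\<close> by simp
      qed
    qed
  qed (use V in \<open>auto simp: arc_def\<close>)
qed

text \<open>The combinatorial form of \<open>torus_K33_cycles_meet\<close>. The paths with
  \<open>u\<close> in {i, 1} and \<open>v\<close> in {j, 1} make up one of the three basic cycles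
  off a_0 b_0, and \<open>qs\<close> may vary with the cycle.\<close>

theorem not_toroidalI:
  assumes ps: "K33_paths ps" "paths_in G ps"
    and other: "\<And>i j. (i, j) \<in> {(0, 2), (2, 2), (2, 0)} \<Longrightarrow> \<exists>qs. K33_paths qs \<and> paths_in G qs \<and>
      (\<forall>u\<in>{i, 1}. \<forall>v\<in>{j, 1}. \<forall>ys\<in>set qs. set (ps ! (3 * u + v)) \<inter> set ys = {})"
  shows "\<not> toroidal G"
proof
  assume "toroidal G"
  then obtain p \<gamma> where "crossing_free_drawing torus G p \<gamma>" unfolding toroidal_def by blast
  then interpret crossing_free torus G p \<gamma> by unfold_locales
  have mem: "qs ! (3 * i + j) \<in> set qs" if "paths_in G qs" "i < 3" "j < 3" for qs :: "'a list list" and i j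
    using that by (intro nth_mem) (simp add: paths_in_def)
  have torus: "path_image (vpath (qs ! (3 * i + j))) \<subseteq> torus" if "K33_paths qs" "paths_in G qs" "i < 3" "j < 3" for qs i j
    unfolding K33_paths_drawing(2)[OF that]
  proof (rule UN_least)
    fix e assume "e \<in> edges_of (qs ! (3 * i + j))"
    then have "e \<in> undirected_edges G" using mem[OF that(2-4)] that(2) unfolding paths_in_def by blast
    then show "path_image (\<gamma> e) \<subseteq> torus" by (rule D(4))
  qed
  show False
  proof (rule torus_K33_cycles_meet[OF K33_paths_drawing(1)[OF ps]])
    show "path_image (vpath (ps ! (3 * i + j))) \<subseteq> torus" if "i < 3" "j < 3" for i j
      using torus[OF ps that] .
    fix i j :: nat assume ij: "(i, j) \<in> {(0, 2), (2, 2), (2, 0)}"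
    obtain qs where qs: "K33_paths qs" "paths_in G qs"
      and disj: "\<And>u v ys. \<lbrakk>u \<in> {i, 1}; v \<in> {j, 1}; ys \<in> set qs\<rbrakk> \<Longrightarrow> set (ps ! (3 * u + v)) \<inter> set ys = {}"
      using other[OF ij] by blast
    have "path_image (vpath (ps ! (3 * u + v))) \<inter> path_image (vpath (qs ! (3 * k + l))) = {}"
      if uv: "u \<in> {i, 1}" "v \<in> {j, 1}" and kl: "k < 3" "l < 3" for u v k l
    proof -
      let ?xs = "ps ! (3 * u + v)" and ?ys = "qs ! (3 * k + l)"
      have uv3: "u < 3" "v < 3" using uv ij by auto
      have ys: "?ys \<in> set qs" and xs: "?xs \<in> set ps" using mem qs ps kl uv3 by blast+
      have d: "set ?xs \<inter> set ?ys = {}" using disj[OF uv ys] .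
      have "edges_of ?xs \<inter> edges_of ?ys = {}"
      proof (rule ccontr)
        assume "edges_of ?xs \<inter> edges_of ?ys \<noteq> {}"
        then obtain e where e: "e \<in> edges_of ?xs" "e \<in> edges_of ?ys" by blast
        have "e \<noteq> {}" "e \<subseteq> set ?xs" "e \<subseteq> set ?ys"
          using edges_of_nonempty[OF e(1)] edges_of_subset[OF e(1)] edges_of_subset[OF e(2)] by simp_all
        then show False using d by (auto simp: disjoint_iff)
      qed
      then have "(\<Union>e\<in>edges_of ?xs. path_image (\<gamma> e)) \<inter> (\<Union>e\<in>edges_of ?ys. path_image (\<gamma> e)) \<subseteq> p ` (set ?xs \<inter> set ?ys)"
        using xs ys ps(2) qs(2) edges_of_subset by (intro Int_edges) (auto simp: paths_in_def)
      then show ?thesis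
        using d K33_paths_drawing(2)[OF ps uv3] K33_paths_drawing(2)[OF qs kl] by simp
    qed
    then show "\<exists>a' b' \<gamma>'. K33_drawing a' b' \<gamma>' \<and> (\<forall>k<3. \<forall>l<3. path_image (\<gamma>' k l) \<subseteq> torus \<and>
        (\<forall>u\<in>{i, 1}. \<forall>v\<in>{j, 1}. path_image (vpath (ps ! (3 * u + v))) \<inter> path_image (\<gamma>' k l) = {}))"
      using K33_paths_drawing(1)[OF qs] torus[OF qs] by blast
  qed
qed

text \<open>Lets path lists over indices or bit lists be verified there and then be carried into a
  Bruhat graph or a larger cube.\<close>

lemma K33_paths_map:
  assumes "K33_paths ps" "length ps = 9" "inj_on f (\<Union>(set ` set ps))"
  shows "K33_paths (map (map f) ps)"
proof -
  have nth: "map (map f) ps ! (3 * i + j) = map f (ps ! (3 * i + j))" "ps ! (3 * i + j) \<in> set ps" if "i < 3" "j < 3" for i j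
    using that assms(2) by auto
  have nth': "map (map f) ps ! (3 * i) = map f (ps ! (3 * i))" "ps ! (3 * i) \<in> set ps" "map (map f) ps ! i = map f (ps ! i)"  "ps ! i \<in> set ps"
    if "i < 3" for i using that assms(2) by auto
  have sub: "set (ps ! (3 * i + j)) \<subseteq> \<Union>(set ` set ps)" if "i < 3" "j < 3" for i j
    using nth[OF that] by blast
  have P: "distinct (ps ! (3 * i + j))" "2 \<le> length (ps ! (3 * i + j))"
    "hd (ps ! (3 * i + j)) = hd (ps ! (3 * i))" "last (ps ! (3 * i + j)) = last (ps ! j)" if "i < 3" "j < 3" for i j
    using assms(1) that unfolding K33_paths_def by blast+
  have int: "set (ps ! (3 * i + j)) \<inter> set (ps ! (3 * k + l)) \<subseteq>
        (if i = k then {hd (ps ! (3 * i))} else {}) \<union> (if j = l then {last (ps ! j)} else {})"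
    if "i < 3" "j < 3" "k < 3" "l < 3" "(i, j) \<noteq> (k, l)" for i j k l
    using assms(1) that unfolding K33_paths_def by blast
  have ne: "ps ! (3 * i + j) \<noteq> []" if "i < 3" "j < 3" for i j using P(2)[OF that] by auto
  have ne': "ps ! (3 * i) \<noteq> []" "ps ! i \<noteq> []" if "i < 3" for i using ne[of i 0] ne[of 0 i] that by auto
  show ?thesis
    unfolding K33_paths_def
  proof (intro allI impI conjI)
    fix i j :: nat assume ij: "i < 3" "j < 3"
    show "distinct (map (map f) ps ! (3 * i + j))"
      using P(1)[OF ij] sub[OF ij] assms(3) by (simp add: nth[OF ij] distinct_map inj_on_subset)
    show "2 \<le> length (map (map f) ps ! (3 * i + j))" using P(2)[OF ij] by (simp add: nth[OF ij])
    show "hd (map (map f) ps ! (3 * i + j)) = hd (map (map f) ps ! (3 * i))"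
      "last (map (map f) ps ! (3 * i + j)) = last (map (map f) ps ! j)"
      using P(3,4)[OF ij] ne[OF ij] ij ne' by (simp_all add: nth[OF ij] nth' hd_map last_map)
    fix k l :: nat assume kl: "k < 3" "l < 3" "(i, j) \<noteq> (k, l)"
    have "set (map (map f) ps ! (3 * i + j)) \<inter> set (map (map f) ps ! (3 * k + l)) = f ` (set (ps ! (3 * i + j)) \<inter> set (ps ! (3 * k + l)))"
      using inj_on_image_Int[OF assms(3) sub[OF ij] sub[OF kl(1,2)]] by (simp add: nth ij kl)
    also have "\<dots> \<subseteq> f ` ((if i = k then {hd (ps ! (3 * i))} else {}) \<union> (if j = l then {last (ps ! j)} else {}))"
      by (intro image_mono int ij kl)
    also have "\<dots> = (if i = k then {hd (map (map f) ps ! (3 * i))} else {}) \<union> (if j = l then {last (map (map f) ps ! j)} else {})"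
      using ne' ij by (simp add: image_Un nth' hd_map last_map)
    finally show "set (map (map f) ps ! (3 * i + j)) \<inter> set (map (map f) ps ! (3 * k + l)) \<subseteq>
       (if i = k then {hd (map (map f) ps ! (3 * i))} else {}) \<union> (if j = l then {last (map (map f) ps ! j)} else {})" .
  qed
qed

lemma not_toroidal_disjoint_K33:
  assumes "K33_paths ps" "paths_in G ps" "K33_paths qs" "paths_in G qs"
    "\<And>xs ys. xs \<in> set ps \<Longrightarrow> ys \<in> set qs \<Longrightarrow> set xs \<inter> set ys = {}"
  shows "\<not> toroidal G"
proof (rule not_toroidalI[OF assms(1,2)])
  fix i j :: nat assume "(i, j) \<in> {(0, 2), (2, 2), (2, 0)}"
  then have "\<forall>u\<in>{i, 1}. \<forall>v\<in>{j, 1}. ps ! (3 * u + v) \<in> set ps"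
    using assms(2) by (auto simp: paths_in_def intro!: nth_mem)
  then show "\<exists>qs. K33_paths qs \<and> paths_in G qs \<and>
      (\<forall>u\<in>{i, 1}. \<forall>v\<in>{j, 1}. \<forall>ys\<in>set qs. set (ps ! (3 * u + v)) \<inter> set ys = {})"
    using assms(3-5) by blast
qed

section \<open>Cubes on the torus\<close>

definition product_graph :: "('a, 'b) pre_digraph \<Rightarrow> ('c, 'd) pre_digraph \<Rightarrow> ('a \<times> 'c, ('a \<times> 'c) \<times> ('a \<times> 'c)) pre_digraph" where
  "product_graph G H = with_proj \<lparr> pverts = verts G \<times> verts H,
     parcs = {((u, x), (v, y)). u = v \<and> u \<in> verts G \<and> (x, y) \<in> arcs_ends H \<or> x = y \<and> x \<in> verts H \<and> (u, v) \<in> arcs_ends G} \<rparr>"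

lemma arcs_ends_with_proj [simp]: "arcs_ends (with_proj G) = parcs G"
  by (auto simp: arcs_ends_def arc_to_ends_def)

lemma undirected_edges_product_graph:
  "undirected_edges (product_graph G H) =
     {{u} \<times> f | u f. u \<in> verts G \<and> f \<in> undirected_edges H} \<union> {e \<times> {x} | e x. x \<in> verts H \<and> e \<in> undirected_edges G}"
  (is "?L = ?R")
proof
  show "?L \<subseteq> ?R"
  proof
    fix d assume "d \<in> ?L"
    then obtain u x v y where d: "d = {(u, x), (v, y)}"
      "u = v \<and> u \<in> verts G \<and> (x, y) \<in> arcs_ends H \<or> x = y \<and> x \<in> verts H \<and> (u, v) \<in> arcs_ends G"
      by (auto simp: undirected_edges_def product_graph_def)
    from d(2) show "d \<in> ?R"
    proof (elim disjE conjE)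
      assume "u = v" "u \<in> verts G" "(x, y) \<in> arcs_ends H"
      moreover from this have "d = {u} \<times> {x, y}" using d(1) by auto
      ultimately show ?thesis by (blast intro: undirected_edgesI)
    next
      assume "x = y" "x \<in> verts H" "(u, v) \<in> arcs_ends G"
      moreover from this have "d = {u, v} \<times> {x}" using d(1) by auto
      ultimately show ?thesis by (blast intro: undirected_edgesI)
    qed
  qed
  have "{u} \<times> {x, y} = {(u, x), (u, y)}" "{x, y} \<times> {u'} = {(x, u'), (y, u')}" for u x y u' by auto
  then show "?R \<subseteq> ?L"
    by (auto simp: undirected_edges_def product_graph_def)
qed

text \<open>Edges are drawn in horizontal or vertical fibres. Fibres of the same direction are equal
  or disjoint, and a horizontal and a vertical one meet in a single point, which lies on both drawn
  edges only if it is a common vertex.\<close>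

lemma crossing_free_drawing_product:
  fixes G :: "('a, 'b) pre_digraph" and H :: "('c, 'd) pre_digraph"
  assumes G: "crossing_free_drawing C G p \<gamma>" and H: "crossing_free_drawing D H q \<delta>"
    and wfG: "arcs_ends G \<subseteq> verts G \<times> verts G" and wfH: "arcs_ends H \<subseteq> verts H \<times> verts H"
  shows "crossing_free_drawing (C \<times> D) (product_graph G H) (map_prod p q)
    (\<lambda>e. if \<exists>u. fst ` e = {u} then (\<lambda>t. (p (the_elem (fst ` e)), \<delta> (snd ` e) t))
         else (\<lambda>t. (\<gamma> (fst ` e) t, q (the_elem (snd ` e)))))" (is "crossing_free_drawing _ _ _ ?\<gamma>")
proof -
  note DG = crossing_free_drawingD[OF G] and DH = crossing_free_drawingD[OF H]
  have VG: "e \<subseteq> verts G" if "e \<in> undirected_edges G" for e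
    using that wfG by (auto simp: undirected_edges_def)
  have VH: "e \<subseteq> verts H" "e \<noteq> {}" if "e \<in> undirected_edges H" for e
    using that wfH by (auto simp: undirected_edges_def)
  \<comment> \<open>An edge of a drawn graph has two distinct ends, which is why the first
    projection tells the two kinds of edges apart.\<close>
  have notsing: "\<not> (\<exists>u. e = {u})" "e \<noteq> {}" if "e \<in> undirected_edges G" for e
    using DG(5)[OF that] arc_distinct_ends[OF DG(3)[OF that]] by (auto simp: doubleton_eq_iff)
  have gH: "?\<gamma> ({u} \<times> f) = (\<lambda>t. (p u, \<delta> f t))" if "f \<in> undirected_edges H" for u f
    using VH(2)[OF that] by (auto simp: fst_image_times snd_image_times)
  have gG: "?\<gamma> (e \<times> {x}) = (\<lambda>t. (\<gamma> e t, q x))" if "e \<in> undirected_edges G" for e x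
    using notsing[OF that] by (auto simp: fst_image_times snd_image_times)
  have imH: "path_image (?\<gamma> ({u} \<times> f)) = {p u} \<times> path_image (\<delta> f)" if "f \<in> undirected_edges H" for u f
    unfolding gH[OF that] by (auto simp: path_image_def)
  have imG: "path_image (?\<gamma> (e \<times> {x})) = path_image (\<gamma> e) \<times> {q x}" if "e \<in> undirected_edges G" for e x
    unfolding gG[OF that] by (auto simp: path_image_def)
  have vG: "{p u} \<inter> path_image (\<gamma> e) = p ` ({u} \<inter> e)" if "u \<in> verts G" "e \<in> undirected_edges G" for u e
  proof -
    have "p u \<in> path_image (\<gamma> e) \<longleftrightarrow> p u \<in> p ` e" using DG(6)[OF that(2)] that(1) by blast
    also have "\<dots> \<longleftrightarrow> u \<in> e" using inj_on_image_mem_iff[OF DG(1) that(1) VG[OF that(2)]] .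
    finally show ?thesis by auto
  qed
  have vH: "{q u} \<inter> path_image (\<delta> e) = q ` ({u} \<inter> e)" if "u \<in> verts H" "e \<in> undirected_edges H" for u e
  proof -
    have "q u \<in> path_image (\<delta> e) \<longleftrightarrow> q u \<in> q ` e" using DH(6)[OF that(2)] that(1) by blast
    also have "\<dots> \<longleftrightarrow> u \<in> e" using inj_on_image_mem_iff[OF DH(1) that(1) VH(1)[OF that(2)]] .
    finally show ?thesis by auto
  qed
  have mp: "map_prod p q ` (A \<times> B) = p ` A \<times> q ` B" for A B by (auto simp: map_prod_def image_iff)
  have verts: "verts (product_graph G H) = verts G \<times> verts H" by (simp add: product_graph_def)
  show ?thesis
    unfolding crossing_free_drawing_def verts
  proof (intro conjI ballI impI)
    show "inj_on (map_prod p q) (verts G \<times> verts H)" using DG(1) DH(1) by (rule map_prod_inj_on)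
    show "map_prod p q ` (verts G \<times> verts H) \<subseteq> C \<times> D" unfolding mp using DG(2) DH(2) by blast
  next
    fix d assume "d \<in> undirected_edges (product_graph G H)"
    then consider (H) u f where "d = {u} \<times> f" "u \<in> verts G" "f \<in> undirected_edges H"
      | (G) e x where "d = e \<times> {x}" "x \<in> verts H" "e \<in> undirected_edges G"
      unfolding undirected_edges_product_graph by blast
    then have "arc (?\<gamma> d) \<and> path_image (?\<gamma> d) \<subseteq> C \<times> D \<and>
        {pathstart (?\<gamma> d), pathfinish (?\<gamma> d)} = map_prod p q ` d \<and>
        path_image (?\<gamma> d) \<inter> map_prod p q ` (verts G \<times> verts H) = map_prod p q ` d"
    proof cases
      case H
      have "arc (\<lambda>t. (p u, \<delta> f t))"
        using DH(3)[OF H(3)] unfolding arc_def path_def inj_on_def by (auto intro: continuous_intros)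
      moreover have "{(p u, pathstart (\<delta> f)), (p u, pathfinish (\<delta> f))} = {p u} \<times> q ` f"
        using DH(5)[OF H(3)] by blast
      moreover have "p u \<in> C" using DG(2) H(2) by blast
      moreover have "{p u} \<times> path_image (\<delta> f) \<inter> p ` verts G \<times> q ` verts H = {p u} \<times> q ` f"
        using DH(6)[OF H(3)] H(2) by (simp add: Times_Int_Times)
      ultimately show ?thesis
        using DH(4)[OF H(3)] unfolding H(1) imH[OF H(3)] mp
        unfolding gH[OF H(3)] pathstart_def pathfinish_def by auto
    next
      case G
      have "arc (\<lambda>t. (\<gamma> e t, q x))"
        using DG(3)[OF G(3)] unfolding arc_def path_def inj_on_def by (auto intro: continuous_intros)
      moreover have "{(pathstart (\<gamma> e), q x), (pathfinish (\<gamma> e), q x)} = p ` e \<times> {q x}"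
        using DG(5)[OF G(3)] by blast
      moreover have "q x \<in> D" using DH(2) G(2) by blast
      moreover have "path_image (\<gamma> e) \<times> {q x} \<inter> p ` verts G \<times> q ` verts H = p ` e \<times> {q x}"
        using DG(6)[OF G(3)] G(2) by (simp add: Times_Int_Times)
      ultimately show ?thesis
        using DG(4)[OF G(3)] unfolding G(1) imG[OF G(3)] mp
        unfolding gG[OF G(3)] pathstart_def pathfinish_def by auto
    qed
    then show "arc (?\<gamma> d)" "path_image (?\<gamma> d) \<subseteq> C \<times> D" "{pathstart (?\<gamma> d), pathfinish (?\<gamma> d)} = map_prod p q ` d"
      "path_image (?\<gamma> d) \<inter> map_prod p q ` (verts G \<times> verts H) = map_prod p q ` d" by blast+
  next
    fix d d' assume d: "d \<in> undirected_edges (product_graph G H)" "d' \<in> undirected_edges (product_graph G H)" "d \<noteq> d'"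
    let ?P = "\<lambda>d d'. path_image (?\<gamma> d) \<inter> path_image (?\<gamma> d') = map_prod p q ` (d \<inter> d')"
    have HG: "?P ({u} \<times> f) (e \<times> {x})" if "u \<in> verts G" "f \<in> undirected_edges H" "x \<in> verts H" "e \<in> undirected_edges G" for u f e x
      using vG[OF that(1,4)] vH[OF that(3,2)] unfolding imH[OF that(2)] imG[OF that(4)] Times_Int_Times mp by (simp add: Int_commute)
    have HH: "?P ({u} \<times> f) ({v} \<times> f')" if "u \<in> verts G" "f \<in> undirected_edges H" "v \<in> verts G" "f' \<in> undirected_edges H" "{u} \<times> f \<noteq> {v} \<times> f'" for u v f f'
    proof (cases "u = v")
      case True
      then show ?thesis using DH(7)[OF that(2,4)] that(5) unfolding imH[OF that(2)] imH[OF that(4)] Times_Int_Times mp by auto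
    next
      case False
      then have "p u \<noteq> p v" using DG(1) that by (auto dest: inj_onD)
      then show ?thesis using False unfolding imH[OF that(2)] imH[OF that(4)] Times_Int_Times mp by auto
    qed
    have GG: "?P (e \<times> {x}) (e' \<times> {y})" if "x \<in> verts H" "e \<in> undirected_edges G" "y \<in> verts H" "e' \<in> undirected_edges G" "e \<times> {x} \<noteq> e' \<times> {y}" for e e' x y
    proof (cases "x = y")
      case True
      then show ?thesis using DG(7)[OF that(2,4)] that(5) unfolding imG[OF that(2)] imG[OF that(4)] Times_Int_Times mp by auto
    next
      case False
      then have "q x \<noteq> q y" using DH(1) that by (auto dest: inj_onD)
      then show ?thesis using False unfolding imG[OF that(2)] imG[OF that(4)] Times_Int_Times mp by auto
    qed
    from d show "?P d d'"
      unfolding undirected_edges_product_graph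
    proof (elim UnE CollectE exE conjE)
      fix u f u' f' assume h: "d = {u} \<times> f" "u \<in> verts G" "f \<in> undirected_edges H" "d' = {u'} \<times> f'" "u' \<in> verts G" "f' \<in> undirected_edges H"
      show ?thesis unfolding h(1,4) by (rule HH[OF h(2,3,5,6)]) (use d(3) h in simp)
    next
      fix u f e x assume h: "d = {u} \<times> f" "u \<in> verts G" "f \<in> undirected_edges H" "d' = e \<times> {x}" "x \<in> verts H" "e \<in> undirected_edges G"
      show ?thesis unfolding h(1,4) by (rule HG[OF h(2,3,5,6)])
    next
      fix u f e x assume h: "d' = {u} \<times> f" "u \<in> verts G" "f \<in> undirected_edges H" "d = e \<times> {x}" "x \<in> verts H" "e \<in> undirected_edges G"
      show ?thesis unfolding h(1,4) Int_commute[of "path_image (?\<gamma> (e \<times> {x}))"] Int_commute[of "e \<times> {x}"]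
        by (rule HG[OF h(2,3,5,6)])
    next
      fix e x e' x' assume h: "d = e \<times> {x}" "x \<in> verts H" "e \<in> undirected_edges G" "d' = e' \<times> {x'}" "x' \<in> verts H" "e' \<in> undirected_edges G"
      show ?thesis unfolding h(1,4) by (rule GG[OF h(2,3,5,6)]) (use d(3) h in simp)
    qed
  qed
qed

section \<open>The square on the circle\<close>

lemma length_2_bool: "length xs = 2 \<longleftrightarrow> xs \<in> {[False, False], [False, True], [True, True], [True, False]}"
  by (auto simp: length_Suc_conv numeral_2_eq_2)

lemma cube_graph_simps [simp]:
  "verts (cube_graph d) = {xs. length xs = d}"
  "arcs_ends (cube_graph d) = {(xs, ys). length xs = d \<and> length ys = d \<and> card {i. i < d \<and> xs ! i \<noteq> ys ! i} = 1}"
  by (simp_all add: cube_graph_def)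

lemma card_differences_Cons:
  "card {i. i < Suc d \<and> (x # xs) ! i \<noteq> (y # ys) ! i} = (if x = y then 0 else 1) + card {i. i < d \<and> xs ! i \<noteq> ys ! i}"
proof -
  have "{i. i < Suc d \<and> (x # xs) ! i \<noteq> (y # ys) ! i} = (if x = y then {} else {0}) \<union> Suc ` {i. i < d \<and> xs ! i \<noteq> ys ! i}"
    by (auto simp: less_Suc_eq_0_disj)
  then show ?thesis by (simp add: card_image card_insert_if image_iff)
qed

text \<open>The circle is divided into four quarters. Equal points differ by a whole number of
  turns, so \<open>4 * m - k + l\<close>, being a difference of two local parameters, is -1, 0 or
  1.\<close>

lemma circle_quarters_eq:
  assumes "k < 4" "l < 4" "s \<in> {0..1}" "t \<in> {0..1}"
    and "cis (pi / 2 * (real k + s)) = cis (pi / 2 * (real l + t))"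
  shows "k = l \<and> s = t \<or> l = (k + 1) mod 4 \<and> s = 1 \<and> t = 0 \<or> k = (l + 1) mod 4 \<and> s = 0 \<and> t = 1"
proof -
  have "cis (2 * pi * ((real k + s) / 4)) = cis (2 * pi * ((real l + t) / 4))" using assms(5) by simp
  then have "(real k + s) / 4 - (real l + t) / 4 \<in> \<int>" by (simp only: cis_2pi_eq_iff)
  then obtain m :: int where m: "(real k + s) / 4 - (real l + t) / 4 = of_int m" by (elim Ints_cases)
  then have "of_int (4 * m - int k + int l) = s - t" by (simp add: field_simps)
  moreover define c where "c = 4 * m - int k + int l"
  ultimately have c: "of_int c = s - t" by simp
  then have "real_of_int c \<le> of_int 1" "real_of_int (-1) \<le> of_int c" using assms(3,4) by auto
  then have "c \<in> {-1, 0, 1}" unfolding of_int_le_iff by auto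
  then show ?thesis
  proof (elim insertE emptyE)
    assume "c = -1"
    moreover from this have "s = 0" "t = 1" using c assms(3,4) by auto
    moreover have "k = (l + 1) mod 4" using \<open>c = -1\<close> assms(1,2) unfolding c_def by presburger
    ultimately show ?thesis by simp
  next
    assume "c = 0"
    moreover from this have "s = t" using c by simp
    moreover have "k = l" using \<open>c = 0\<close> assms(1,2) unfolding c_def by presburger
    ultimately show ?thesis by simp
  next
    assume "c = 1"
    moreover from this have "s = 1" "t = 0" using c assms(3,4) by auto
    moreover have "l = (k + 1) mod 4" using \<open>c = 1\<close> assms(1,2) unfolding c_def by presburger
    ultimately show ?thesis by simp
  qed
qed

text \<open>The vertices in cyclic order around the square, taken modulo 4 so that edge 3 leads back
  to vertex 0.\<close>

definition square_vertex :: "nat \<Rightarrow> bool list" where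
  "square_vertex k = [[False, False], [False, True], [True, True], [True, False]] ! (k mod 4)"

definition square_edge :: "nat \<Rightarrow> bool list set" where
  "square_edge k = {square_vertex k, square_vertex (Suc k)}"

lemma nat_less_4: "k < 4 \<longleftrightarrow> k \<in> {0, 1, 2, 3::nat}" by auto

lemma square_vertex_eq_iff: "square_vertex k = square_vertex l \<longleftrightarrow> k mod 4 = l mod 4"
proof -
  have "k mod 4 < 4" "l mod 4 < 4" by simp_all
  then show ?thesis unfolding square_vertex_def nat_less_4 by auto
qed

lemma verts_square: "verts (cube_graph 2) = square_vertex ` {..<4}"
proof -
  have "{..<4::nat} = {0, 1, 2, 3}" by auto
  then show ?thesis by (auto simp: length_2_bool square_vertex_def)
qed

lemma undirected_edges_square: "undirected_edges (cube_graph 2) = square_edge ` {..<4}"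
proof -
  have card2: "card {i. i < Suc (Suc 0) \<and> [a, b] ! i \<noteq> [c, d] ! i} = (if a = c then 0 else 1) + (if b = d then 0 else 1)" for a b c d :: bool
    by (subst card_differences_Cons)+ simp
  have adj: "([a, b], [c, d]) \<in> arcs_ends (cube_graph 2) \<longleftrightarrow> (a = c) \<noteq> (b = d)" for a b c d
    unfolding cube_graph_simps mem_Collect_eq prod.case numeral_2_eq_2 card2 by simp
  have edges: "square_edge ` {..<4} = {{[False, False], [False, True]}, {[False, True], [True, True]},
      {[True, True], [True, False]}, {[True, False], [False, False]}}"
  proof -
    have 4: "{..<4::nat} = {0, 1, 2, 3}" by auto
    show ?thesis unfolding 4 by (simp add: square_edge_def square_vertex_def)
  qed
  show ?thesis
  proof
    show "undirected_edges (cube_graph 2) \<subseteq> square_edge ` {..<4}"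
    proof
      fix e assume "e \<in> undirected_edges (cube_graph 2)"
      then obtain xs ys where e: "e = {xs, ys}" "(xs, ys) \<in> arcs_ends (cube_graph 2)"
        by (auto simp only: undirected_edges_def)
      have "length xs = 2" "length ys = 2" using e(2) by simp_all
      then obtain a b c d where "xs = [a, b]" "ys = [c, d]"
        by (auto simp: length_Suc_conv numeral_2_eq_2)
      then show "e \<in> square_edge ` {..<4}"
        using e adj unfolding edges by (cases a; cases b; cases c; cases d) (simp_all add: insert_commute)
    qed
    show "square_edge ` {..<4} \<subseteq> undirected_edges (cube_graph 2)"
      unfolding edges using undirected_edgesI[OF adj[THEN iffD2]] by simp
  qed
qed

lemma square_edge_inj: "k < 4 \<Longrightarrow> l < 4 \<Longrightarrow> square_edge k = square_edge l \<longleftrightarrow> k = l"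
  unfolding nat_less_4 by (auto simp: square_edge_def square_vertex_def doubleton_eq_iff)

lemma circle_square:
  obtains p \<gamma> where "crossing_free_drawing (sphere (0::complex) 1) (cube_graph 2) p \<gamma>"
proof -
  define p where "p xs = cis (pi / 2 * real (inv_into {..<4} square_vertex xs))" for xs
  define \<gamma> where "\<gamma> e t = cis (pi / 2 * (real (inv_into {..<4} square_edge e) + t))" for e t
  have inj: "inj_on square_vertex {..<4}" "inj_on square_edge {..<4}"
    by (auto simp: inj_on_def square_vertex_eq_iff square_edge_inj)
  have p: "p (square_vertex k) = cis (pi / 2 * (real k + 0))" if "k < 4" for k
    using that inj(1) by (simp add: p_def)
  have \<gamma>: "\<gamma> (square_edge k) t = cis (pi / 2 * (real k + t))" if "k < 4" for k t
    using that inj(2) by (simp add: \<gamma>_def)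
  have suc: "p (square_vertex (Suc k)) = cis (pi / 2 * (real k + 1))" if "k < 4" for k
  proof (cases "k = 3")
    case True
    have "square_vertex (Suc 3) = square_vertex 0" by (simp add: square_vertex_eq_iff)
    moreover have "pi / 2 * (real 3 + 1) = 2 * pi" by simp
    ultimately show ?thesis using p[of 0] True by (simp only:) simp
  next
    case False
    then show ?thesis using p[of "Suc k"] that by (simp add: add.commute)
  qed
  have ps: "p ` square_edge k = {cis (pi / 2 * (real k + 0)), cis (pi / 2 * (real k + 1))}" if "k < 4" for k
    using p[OF that] suc[OF that] by (simp add: square_edge_def)
  have im: "path_image (\<gamma> (square_edge k)) = (\<lambda>t. cis (pi / 2 * (real k + t))) ` {0..1}" if "k < 4" for k
    using \<gamma>[OF that] by (simp add: path_image_def)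
  have sub: "p ` square_edge k \<subseteq> path_image (\<gamma> (square_edge k))" if "k < 4" for k
    unfolding ps[OF that] im[OF that] by (intro insert_subsetI empty_subsetI imageI) simp_all
  have qinj: "s = t" if "k < 4" "s \<in> {0..1}" "t \<in> {0..1}" "cis (pi / 2 * (real k + s)) = cis (pi / 2 * (real k + t))" for k s t
  proof -
    have "k \<noteq> (k + 1) mod 4" using that(1) by presburger
    then show ?thesis using circle_quarters_eq[OF that(1,1,2,3,4)] by blast
  qed
  have "crossing_free_drawing (sphere 0 1) (cube_graph 2) p \<gamma>"
    unfolding crossing_free_drawing_def verts_square undirected_edges_square
  proof (intro conjI ballI impI)
    show "inj_on p (square_vertex ` {..<4})"
      using circle_quarters_eq[of _ _ 0 0] by (auto simp: inj_on_def p simp del: add_0_right)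
    show "p ` square_vertex ` {..<4} \<subseteq> sphere 0 1" by (auto simp: p_def)
  next
    fix e assume "e \<in> square_edge ` {..<4}"
    then obtain k where k: "k < 4" "e = square_edge k" by auto
    have "\<gamma> e = (\<lambda>t. cis (pi / 2 * (real k + t)))" using k \<gamma> by auto
    moreover have "continuous_on {0..1} (\<lambda>t. cis (pi / 2 * (real k + t)))" by (intro continuous_intros)
    moreover have "inj_on (\<lambda>t. cis (pi / 2 * (real k + t))) {0..1}" using qinj[OF k(1)] by (rule inj_onI)
    ultimately show "arc (\<gamma> e)" by (simp add: arc_def path_def)
    show "path_image (\<gamma> e) \<subseteq> sphere 0 1" by (auto simp: path_image_def \<gamma>_def)
    show "{pathstart (\<gamma> e), pathfinish (\<gamma> e)} = p ` e"
      using k by (simp add: pathstart_def pathfinish_def \<gamma> ps)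
    have "p ` e \<subseteq> path_image (\<gamma> e)" unfolding k(2) by (rule sub[OF k(1)])
    moreover have "e \<subseteq> square_vertex ` {..<4}"
      using k by (auto simp: square_edge_def square_vertex_def simp flip: verts_square)
    moreover have "path_image (\<gamma> e) \<inter> p ` square_vertex ` {..<4} \<subseteq> p ` e"
    proof
      fix z assume "z \<in> path_image (\<gamma> e) \<inter> p ` square_vertex ` {..<4}"
      then obtain t l where t: "t \<in> {0..1}" "z = cis (pi / 2 * (real k + t))" and l: "l < 4" "z = cis (pi / 2 * (real l + 0))"
        using k by (auto simp: im p)
      have "t = 0 \<or> t = 1" using circle_quarters_eq[OF k(1) l(1) t(1), of 0] t l by auto
      then show "z \<in> p ` e" unfolding k(2) ps[OF k(1)] using t(2) by auto
    qed
    ultimately show "path_image (\<gamma> e) \<inter> p ` square_vertex ` {..<4} = p ` e" by blast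
    fix f assume f: "f \<in> square_edge ` {..<4}" "e \<noteq> f"
    then obtain l where l: "l < 4" "f = square_edge l" by auto
    have kl: "k \<noteq> l" using f k l by auto
    show "path_image (\<gamma> e) \<inter> path_image (\<gamma> f) = p ` (e \<inter> f)"
    proof
      show "p ` (e \<inter> f) \<subseteq> path_image (\<gamma> e) \<inter> path_image (\<gamma> f)"
        unfolding k(2) l(2) using sub[OF k(1)] sub[OF l(1)] by blast
      show "path_image (\<gamma> e) \<inter> path_image (\<gamma> f) \<subseteq> p ` (e \<inter> f)"
      proof
        fix z assume "z \<in> path_image (\<gamma> e) \<inter> path_image (\<gamma> f)"
        then obtain s t where t: "s \<in> {0..1}" "t \<in> {0..1}" "z = cis (pi / 2 * (real k + s))" "cis (pi / 2 * (real k + s)) = cis (pi / 2 * (real l + t))"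
          using k l by (auto simp: im)
        from circle_quarters_eq[OF k(1) l(1) t(1,2,4)] kl
        consider "l = (k + 1) mod 4" "s = 1" | "k = (l + 1) mod 4" "s = 0" by blast
        then show "z \<in> p ` (e \<inter> f)"
        proof cases
          case 1
          then have "square_vertex l = square_vertex (Suc k)" by (simp add: square_vertex_eq_iff)
          then have "square_vertex (Suc k) \<in> e \<inter> f" unfolding k(2) l(2) square_edge_def by auto
          moreover have "z = p (square_vertex (Suc k))" using suc[OF k(1)] t(3) 1 by simp
          ultimately show ?thesis by blast
        next
          case 2
          then have "square_vertex k = square_vertex (Suc l)" by (simp add: square_vertex_eq_iff)
          then have "square_vertex k \<in> e \<inter> f" unfolding k(2) l(2) square_edge_def by auto
          moreover have "z = p (square_vertex k)" using p[OF k(1)] t(3) 2 by simp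
          ultimately show ?thesis by blast
        qed
      qed
    qed
  qed
  then show thesis using that by blast
qed

section \<open>Cubes of dimensions four and five\<close>

text \<open>The Hamming distance in a form that evaluates on concrete lists; it replaces the
  cardinality in the arcs of \<open>cube_graph\<close>.\<close>

definition differences :: "'a list \<Rightarrow> 'a list \<Rightarrow> nat" where
  "differences xs ys = length (filter (\<lambda>(x, y). x \<noteq> y) (zip xs ys))"

lemma differences_simps [simp]:
  "differences [] ys = 0"
  "differences (x # xs) (y # ys) = (if x = y then 0 else 1) + differences xs ys"
  by (auto simp: differences_def)

lemma card_differences:
  "length xs = d \<Longrightarrow> length ys = d \<Longrightarrow> card {i. i < d \<and> xs ! i \<noteq> ys ! i} = differences xs ys"
proof (induction d arbitrary: xs ys)
  case (Suc d)
  then obtain x xs' y ys' where "xs = x # xs'" "ys = y # ys'" by (metis length_Suc_conv)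
  then show ?case using Suc card_differences_Cons[of d x xs' y ys'] by simp
qed simp

lemma arcs_ends_cube_graph [simp]:
  "(xs, ys) \<in> arcs_ends (cube_graph d) \<longleftrightarrow> length xs = d \<and> length ys = d \<and> differences xs ys = 1"
  unfolding cube_graph_simps mem_Collect_eq prod.case using card_differences[of xs d ys] by metis

declare cube_graph_simps(2) [simp del]

lemma differences_append:
  "length xs = length ys \<Longrightarrow> differences (xs @ xs') (ys @ ys') = differences xs ys + differences xs' ys'"
  by (simp add: differences_def)

lemma differences_same [simp]: "differences xs xs = 0"
  by (induction xs) auto

lemma differences_eq_0: "length xs = length ys \<Longrightarrow> differences xs ys = 0 \<longleftrightarrow> xs = ys"
  by (induction xs ys rule: list_induct2) auto

lemma wf_cube_graph: "arcs_ends (cube_graph d) \<subseteq> verts (cube_graph d) \<times> verts (cube_graph d)"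
  by auto

text \<open>The 4-cube is the Cartesian product of two squares, the torus is the product of two
  circles, and a square can be drawn on a circle.\<close>

lemma toroidal_cube_4: "toroidal (cube_graph 4)"
proof (rule toroidal_embed)
  obtain p \<gamma> where "crossing_free_drawing (sphere (0::complex) 1) (cube_graph 2) p \<gamma>" by (rule circle_square)
  from crossing_free_drawing_product[OF this this wf_cube_graph wf_cube_graph]
  show "toroidal (product_graph (cube_graph 2) (cube_graph 2))" unfolding toroidal_def torus_def by blast
  let ?f = "\<lambda>xs::bool list. (take 2 xs, drop 2 xs)"
  show "inj_on ?f (verts (cube_graph 4))" by (rule inj_onI) (metis append_take_drop_id prod.inject)
  show "?f ` verts (cube_graph 4) \<subseteq> verts (product_graph (cube_graph 2) (cube_graph 2))"
    by (auto simp: product_graph_def)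
  fix u v assume uv: "(u, v) \<in> arcs_ends (cube_graph 4)"
  then have len: "length u = 4" "length v = 4" and one: "differences u v = 1" by auto
  have "differences (take 2 u) (take 2 v) + differences (drop 2 u) (drop 2 v) = 1"
    using differences_append[of "take 2 u" "take 2 v" "drop 2 u" "drop 2 v"] len one by simp
  then have "take 2 u = take 2 v \<and> differences (drop 2 u) (drop 2 v) = 1 \<or> differences (take 2 u) (take 2 v) = 1 \<and> drop 2 u = drop 2 v"
    using differences_eq_0[of "take 2 u" "take 2 v"] differences_eq_0[of "drop 2 u" "drop 2 v"] len
    by (cases "differences (take 2 u) (take 2 v)") auto
  then have "(?f u, ?f v) \<in> arcs_ends (product_graph (cube_graph 2) (cube_graph 2))"
    using len by (auto simp: product_graph_def)
  then show "{?f u, ?f v} \<in> undirected_edges (product_graph (cube_graph 2) (cube_graph 2))"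
    by (rule undirected_edgesI)
qed (rule wf_cube_graph)

lemma toroidal_cube:
  assumes "toroidal (cube_graph d)" "k \<le> d"
  shows "toroidal (cube_graph k)"
proof (rule toroidal_embed[OF assms(1)])
  let ?f = "\<lambda>xs. xs @ replicate (d - k) False"
  show "inj_on ?f (verts (cube_graph k))" by (auto simp: inj_on_def)
  show "?f ` verts (cube_graph k) \<subseteq> verts (cube_graph d)" using assms(2) by auto
  show "{?f u, ?f v} \<in> undirected_edges (cube_graph d)" if "(u, v) \<in> arcs_ends (cube_graph k)" for u v
    using that assms(2) by (intro undirected_edgesI) (simp add: differences_append)
qed (rule wf_cube_graph)

lemma edges_of_successively:
  "successively (\<lambda>u v. (u, v) \<in> arcs_ends G) xs \<Longrightarrow> edges_of xs \<subseteq> undirected_edges G"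
  by (induction xs rule: edges_of.induct) (auto intro: undirected_edgesI)

definition cube_paths :: "nat \<Rightarrow> bool list list list \<Rightarrow> bool" where
  "cube_paths d ps \<longleftrightarrow> length ps = 9 \<and>
     (\<forall>xs\<in>set ps. (\<forall>v\<in>set xs. length v = d) \<and> successively (\<lambda>u v. differences u v = 1) xs)"

lemma paths_in_cube_graph:
  assumes "cube_paths d ps"
  shows "paths_in (cube_graph d) ps"
proof -
  have "edges_of xs \<subseteq> undirected_edges (cube_graph d)" if "xs \<in> set ps" for xs
  proof (rule edges_of_successively)
    have "successively (\<lambda>u v. differences u v = 1) xs" "\<forall>v\<in>set xs. length v = d"
      using assms that unfolding cube_paths_def by blast+
    then show "successively (\<lambda>u v. (u, v) \<in> arcs_ends (cube_graph d)) xs"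
      by (induction xs rule: induct_list012) auto
  qed
  then show ?thesis using assms by (auto simp: paths_in_def cube_paths_def)
qed

text \<open>A subdivision of K33 in the 4-cube with branch vertices 0000, 0001, 0110 and 0010, 0100,
  1000. It serves twice: in two opposite facets of the 5-cube, and to draw K33 itself on the
  torus.\<close>

definition cube_K33 :: "bool list list list" where
  "cube_K33 = map (map (map ((=) (1::nat))))
    [[[0,0,0,0], [0,0,1,0]], [[0,0,0,0], [0,1,0,0]], [[0,0,0,0], [1,0,0,0]],
     [[0,0,0,1], [0,0,1,1], [0,0,1,0]], [[0,0,0,1], [0,1,0,1], [0,1,0,0]], [[0,0,0,1], [1,0,0,1], [1,0,0,0]],
     [[0,1,1,0], [0,0,1,0]], [[0,1,1,0], [0,1,0,0]], [[0,1,1,0], [1,1,1,0], [1,0,1,0], [1,0,0,0]]]"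

lemma all_less_3: "(\<forall>i<3. P i) \<longleftrightarrow> P 0 \<and> P 1 \<and> P (2::nat)"
proof -
  have "i < 3 \<longleftrightarrow> i = 0 \<or> i = 1 \<or> i = 2" for i :: nat by auto
  then show ?thesis by auto
qed

lemma cube_K33:
  "K33_paths cube_K33" "cube_paths 4 cube_K33"
  "cube_paths 5 (map (map (Cons False)) cube_K33)" "cube_paths 5 (map (map (Cons True)) cube_K33)"
proof -
  show "K33_paths cube_K33" by (simp add: K33_paths_def all_less_3 cube_K33_def)
  show "cube_paths 4 cube_K33" "cube_paths 5 (map (map (Cons False)) cube_K33)" "cube_paths 5 (map (map (Cons True)) cube_K33)"
    by (simp_all add: cube_paths_def cube_K33_def)
qed

lemma not_toroidal_cube_5: "\<not> toroidal (cube_graph 5)"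
proof (rule not_toroidal_disjoint_K33)
  have 9: "length cube_K33 = 9" by (simp add: cube_K33_def)
  show "K33_paths (map (map (Cons False)) cube_K33)" "K33_paths (map (map (Cons True)) cube_K33)"
    by (rule K33_paths_map[OF cube_K33(1) 9]; simp)+
  show "paths_in (cube_graph 5) (map (map (Cons False)) cube_K33)" "paths_in (cube_graph 5) (map (map (Cons True)) cube_K33)"
    by (rule paths_in_cube_graph[OF cube_K33(3)], rule paths_in_cube_graph[OF cube_K33(4)])
qed auto

text \<open>The subdivision inside the drawn 4-cube becomes a drawing of K33 when each of its nine
  paths is taken as one curve.\<close>

lemma toroidal_K33:
  assumes "complete_bipartite_digraph 3 3 G"
  shows "toroidal G"
proof -
  obtain U V where UV: "verts G = U \<union> V" "U \<inter> V = {}" "card U = 3" "card V = 3" "arcs_ends G = U \<times> V \<union> V \<times> U"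
    using assms unfolding complete_bipartite_digraph_def by blast
  have "finite U" "finite V" using UV by (auto intro: card_ge_0_finite)
  then obtain f g where f: "bij_betw f U {..<3::nat}" and g: "bij_betw g V {..<3::nat}"
    using UV(3,4) by (metis ex_bij_betw_finite_nat atLeast0LessThan)
  have f3: "f u < 3" "f u = f u' \<longleftrightarrow> u = u'" if "u \<in> U" "u' \<in> U" for u u'
    using f that by (auto simp: bij_betw_def inj_on_def)
  have g3: "g u < 3" "g u = g u' \<longleftrightarrow> u = u'" if "u \<in> V" "u' \<in> V" for u u'
    using g that by (auto simp: bij_betw_def inj_on_def)
  obtain p \<gamma> where "crossing_free_drawing torus (cube_graph 4) p \<gamma>" using toroidal_cube_4 unfolding toroidal_def by blast
  then interpret crossing_free torus "cube_graph 4" p \<gamma> by unfold_locales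
  obtain a b \<delta> where K: "K33_drawing a b \<delta>" and torus: "\<And>i j. i < 3 \<Longrightarrow> j < 3 \<Longrightarrow> path_image (\<delta> i j) \<subseteq> torus"
  proof
    show "K33_drawing (\<lambda>i. p (hd (cube_K33 ! (3 * i)))) (\<lambda>j. p (last (cube_K33 ! j))) (\<lambda>i j. vpath (cube_K33 ! (3 * i + j)))"
      by (rule K33_paths_drawing(1)[OF cube_K33(1) paths_in_cube_graph[OF cube_K33(2)]])
    fix i j :: nat assume ij: "i < 3" "j < 3"
    then have "cube_K33 ! (3 * i + j) \<in> set cube_K33" by (intro nth_mem) (simp add: cube_K33_def)
    then have "edges_of (cube_K33 ! (3 * i + j)) \<subseteq> undirected_edges (cube_graph 4)"
      using paths_in_cube_graph[OF cube_K33(2)] by (simp add: paths_in_def)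
    then show "path_image (vpath (cube_K33 ! (3 * i + j))) \<subseteq> torus"
      unfolding K33_paths_drawing(2)[OF cube_K33(1) paths_in_cube_graph[OF cube_K33(2)] ij] using D(4) by blast
  qed
  define q where "q x = (if x \<in> U then a (f x) else b (g x))" for x
  \<comment> \<open>Each edge has exactly one end in either class, which \<open>the_elem\<close>
    extracts.\<close>
  define \<epsilon> where "\<epsilon> e = \<delta> (f (the_elem (e \<inter> U))) (g (the_elem (e \<inter> V)))" for e
  have edges: "undirected_edges G = {{u, v} | u v. u \<in> U \<and> v \<in> V}"
    unfolding undirected_edges_def UV(5) by (auto simp: insert_commute)
  have \<epsilon>: "\<epsilon> {u, v} = \<delta> (f u) (g v)" if "u \<in> U" "v \<in> V" for u v
  proof -
    have "{u, v} \<inter> U = {u}" "{u, v} \<inter> V = {v}" using that UV(2) by auto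
    then show ?thesis by (simp add: \<epsilon>_def)
  qed
  have q: "q u = a (f u)" "q v = b (g v)" if "u \<in> U" "v \<in> V" for u v
    using that UV(2) by (auto simp: q_def)
  note KD = K33_drawingD[OF K] and KV = K33_drawing_vertices[OF K]
  have on: "a k \<in> path_image (\<delta> i j) \<longleftrightarrow> i = k" "b k \<in> path_image (\<delta> i j) \<longleftrightarrow> j = k" if "i < 3" "j < 3" "k < 3" for i j k
  proof -
    have "s = 0 \<and> i = k" if "s \<in> {0..1}" "a k = \<delta> i j s" for s
      using K33_drawing_inj[OF K \<open>i < 3\<close> \<open>j < 3\<close> \<open>k < 3\<close> \<open>j < 3\<close> that(1), of 0] that(2) KD(4)[OF \<open>k < 3\<close> \<open>j < 3\<close>] by auto
    moreover have "a i \<in> path_image (\<delta> i j)" using KD(2)[OF that(1,2)] pathstart_in_path_image by metis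
    ultimately show "a k \<in> path_image (\<delta> i j) \<longleftrightarrow> i = k" by (auto simp: path_image_def)
    have "s = 1 \<and> j = k" if "s \<in> {0..1}" "b k = \<delta> i j s" for s
      using K33_drawing_inj[OF K \<open>i < 3\<close> \<open>j < 3\<close> \<open>i < 3\<close> \<open>k < 3\<close> that(1), of 1] that(2) KD(5)[OF \<open>i < 3\<close> \<open>k < 3\<close>] by auto
    moreover have "b j \<in> path_image (\<delta> i j)" using KD(3)[OF that(1,2)] pathfinish_in_path_image by metis
    ultimately show "b k \<in> path_image (\<delta> i j) \<longleftrightarrow> j = k" by (auto simp: path_image_def)
  qed
  have "crossing_free_drawing torus G q \<epsilon>"
    unfolding crossing_free_drawing_def
  proof (intro conjI ballI impI)
    show "inj_on q (verts G)"
      unfolding inj_on_def UV(1) using KV f3 g3 UV(2) by (auto simp: q_def)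
    have "a i \<in> torus" "b i \<in> torus" if "i < 3" for i
      using on[of i 0 i] on[of 0 i i] torus[of i 0] torus[of 0 i] that by auto
    then show "q ` verts G \<subseteq> torus" unfolding UV(1) using f3 g3 by (auto simp: q_def)
  next
    fix e assume "e \<in> undirected_edges G"
    then obtain u v where e: "e = {u, v}" "u \<in> U" "v \<in> V" unfolding edges by blast
    note uv = f3(1)[OF e(2,2)] g3(1)[OF e(3,3)]
    show "arc (\<epsilon> e)" "path_image (\<epsilon> e) \<subseteq> torus" "{pathstart (\<epsilon> e), pathfinish (\<epsilon> e)} = q ` e"
      using K33_drawing_arc[OF K uv] torus[OF uv] KD[OF uv] e q by (simp_all add: \<epsilon>)
    show "path_image (\<epsilon> e) \<inter> q ` verts G = q ` e"
      unfolding UV(1) e(1) \<epsilon>[OF e(2,3)] using on[OF uv] f3 g3 e q UV(2) by (auto simp: q_def)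
    fix e' assume "e' \<in> undirected_edges G" and ne: "e \<noteq> e'"
    then obtain u' v' where e': "e' = {u', v'}" "u' \<in> U" "v' \<in> V" unfolding edges by blast
    note uv' = f3(1)[OF e'(2,2)] g3(1)[OF e'(3,3)]
    have "(f u, g v) \<noteq> (f u', g v')" using ne e e' f3(2) g3(2) by auto
    from K33_drawing_Int[OF K uv uv' this]
    have "path_image (\<epsilon> e) \<inter> path_image (\<epsilon> e') = (if u = u' then {q u} else {}) \<union> (if v = v' then {q v} else {})"
      using f3(2) g3(2) e e' q by (simp add: \<epsilon>)
    also have "\<dots> = q ` (e \<inter> e')" using e e' UV(2) by auto
    finally show "path_image (\<epsilon> e) \<inter> path_image (\<epsilon> e') = q ` (e \<inter> e')" .
  qed
  then show ?thesis unfolding toroidal_def by blast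
qed

lemma toroidal_complete:
  assumes "complete_digraph k G" "k = 1 \<or> k = 2"
  shows "toroidal G"
proof -
  have V: "card (verts G) = k" "arcs_ends G = {(u,v). (u,v) \<in> verts G \<times> verts G \<and> u \<noteq> v}"
    using assms(1) by (auto simp: complete_digraph_def)
  \<comment> \<open>For a graph with one vertex, \<open>x\<close> and \<open>y\<close>
    coincide.\<close>
  obtain x y where xy: "verts G = {x, y}"
    using V(1) assms(2) by (metis card_1_singletonE card_2_iff insert_absorb2)
  let ?f = "\<lambda>z. [False, False, False, z = x]"
  show ?thesis
  proof (rule toroidal_embed[OF toroidal_cube_4])
    show "inj_on ?f (verts G)" using xy by (auto simp: inj_on_def)
    show "?f ` verts G \<subseteq> verts (cube_graph 4)" by auto
    show "arcs_ends G \<subseteq> verts G \<times> verts G" using V by auto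
    show "{?f u, ?f v} \<in> undirected_edges (cube_graph 4)" if "(u, v) \<in> arcs_ends G" for u v
      using that unfolding V xy by (intro undirected_edgesI) auto
  qed
qed

lemma toroidal_digraph_iso_cube:
  assumes "digraph_iso G (cube_graph k)" "k \<le> 4"
  shows "toroidal G"
proof -
  obtain h where h: "pre_digraph.digraph_isomorphism G h" "cube_graph k = app_iso h G"
    using assms(1) unfolding digraph_iso_def by blast
  have wf: "wf_digraph G" "inj_on (iso_verts h) (verts G)"
    using h(1) by (auto simp: pre_digraph.digraph_isomorphism_def)
  have E: "arcs_ends (cube_graph k) = (\<lambda>(u, v). (iso_verts h u, iso_verts h v)) ` arcs_ends G"
    unfolding h(2) by (rule wf_digraph.arcs_ends_app_iso_eq[OF wf(1) h(1)])
  show ?thesis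
  proof (rule toroidal_embed[OF toroidal_cube[OF toroidal_cube_4 assms(2)]])
    show "iso_verts h ` verts G \<subseteq> verts (cube_graph k)" by (simp add: h(2))
    show "arcs_ends G \<subseteq> verts G \<times> verts G"
      using wf(1) by (auto simp: arcs_ends_def arc_to_ends_def wf_digraph_def)
    show "{iso_verts h u, iso_verts h v} \<in> undirected_edges (cube_graph k)" if "(u, v) \<in> arcs_ends G" for u v
      using that E by (intro undirected_edgesI) force
  qed (use wf in auto)
qed

section \<open>Bruhat order and subwords\<close>

abbreviation swp :: "nat \<Rightarrow> nat \<Rightarrow> nat" where
  "swp a \<equiv> Transposition.transpose a (Suc a)"

text \<open>Adjacency in the underlying graph without reference to lengths or to \<open>n\<close>.
  Unlike the order, it is invariant under multiplication from either side, which is what carries a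
  K33 to its cosets.\<close>

definition refl_adj :: "(nat \<Rightarrow> nat) \<Rightarrow> (nat \<Rightarrow> nat) \<Rightarrow> bool" where
  "refl_adj x y \<longleftrightarrow> (\<exists>i j. i \<noteq> j \<and> x = y \<circ> Transposition.transpose i j)"

lemma swp_swp_comp [simp]: "swp a \<circ> (swp a \<circ> f) = f"
  by (simp add: fun_eq_iff)

lemma adj_word_prod_append: "adj_word_prod (us @ vs) = adj_word_prod us \<circ> adj_word_prod vs"
  by (induction us) (auto simp: comp_assoc)

lemma bij_adj_word_prod: "bij (adj_word_prod ws)"
  by (induction ws) (simp_all only: adj_word_prod_simps bij_id bij_comp bij_transpose)

lemma comp_transpose: "inj f \<Longrightarrow> f \<circ> Transposition.transpose i j = Transposition.transpose (f i) (f j) \<circ> f"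
  by (auto simp: fun_eq_iff Transposition.transpose_def dest: injD)

lemma transpose_comp:
  assumes "bij f"
  shows "Transposition.transpose i j \<circ> f = f \<circ> Transposition.transpose (inv f i) (inv f j)"
  using assms by (simp add: comp_transpose bij_is_inj bij_is_surj surj_f_inv_f)

lemma refl_adj_sym: "refl_adj x y \<Longrightarrow> refl_adj y x"
  unfolding refl_adj_def by (metis comp_assoc comp_id transpose_comp_involutory)

lemma refl_adj_irrefl:
  assumes "bij x"
  shows "\<not> refl_adj x x"
proof
  assume "refl_adj x x"
  then obtain i j where ij: "i \<noteq> j" "x = x \<circ> Transposition.transpose i j" unfolding refl_adj_def by blast
  then have "x i = x j" by (metis comp_apply transpose_apply_first)
  then show False using ij(1) assms by (auto dest: injD[OF bij_is_inj])
qed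

lemma refl_adj_left:
  assumes "bij f"
  shows "refl_adj (f \<circ> x) (f \<circ> y) \<longleftrightarrow> refl_adj x y"
proof -
  have "f \<circ> x = f \<circ> z \<longleftrightarrow> x = z" for z
    using bij_is_inj[OF assms] by (auto simp: fun_eq_iff dest: injD)
  then show ?thesis by (simp add: refl_adj_def comp_assoc)
qed

lemma refl_adj_right:
  assumes "bij f"
  shows "refl_adj (x \<circ> f) (y \<circ> f) \<longleftrightarrow> refl_adj x y"
proof -
  have one: "refl_adj (x \<circ> f) (y \<circ> f)" if xy: "refl_adj x y" and f: "bij f" for x y :: "nat \<Rightarrow> nat" and f
  proof -
    obtain i j where ij: "i \<noteq> j" "x = y \<circ> Transposition.transpose i j" using xy unfolding refl_adj_def by blast
    have "inv f i \<noteq> inv f j" using ij(1) surj_f_inv_f[OF bij_is_surj[OF f]] by metis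
    moreover have "x \<circ> f = y \<circ> f \<circ> Transposition.transpose (inv f i) (inv f j)"
      unfolding ij(2) comp_assoc by (simp only: transpose_comp[OF f, of i j])
    ultimately show ?thesis unfolding refl_adj_def by blast
  qed
  have "refl_adj x y" if "refl_adj (x \<circ> f) (y \<circ> f)"
  proof -
    have "z \<circ> f \<circ> inv f = z" for z :: "nat \<Rightarrow> nat"
      using assms by (simp add: fun_eq_iff bij_is_surj surj_f_inv_f)
    then show ?thesis using one[OF that bij_imp_bij_inv[OF assms]] by simp
  qed
  then show ?thesis using one assms by blast
qed

text \<open>Deleting a letter multiplies by a conjugate of it, which is again a
  transposition.\<close>

lemma refl_adj_delete: "refl_adj (adj_word_prod (us @ vs)) (adj_word_prod (us @ a # vs))"
proof -
  have "refl_adj (adj_word_prod vs) (swp a \<circ> adj_word_prod vs)"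
  proof -
    have "inv (adj_word_prod vs) a \<noteq> inv (adj_word_prod vs) (Suc a)"
      using bij_adj_word_prod by (metis bij_inv_eq_iff n_not_Suc_n)
    then have "refl_adj (swp a \<circ> adj_word_prod vs) (adj_word_prod vs)"
      unfolding transpose_comp[OF bij_adj_word_prod] refl_adj_def by blast
    then show ?thesis by (rule refl_adj_sym)
  qed
  then show ?thesis
    by (simp add: adj_word_prod_append refl_adj_left[OF bij_adj_word_prod])
qed

text \<open>Strong exchange: reading the word from the right, the letter at which the images of \<open>i\<close>
  and \<open>j\<close> change order can be deleted.\<close>

lemma strong_exchange:
  assumes "i < j" "adj_word_prod ws j < adj_word_prod ws i"
  shows "\<exists>us. subseq us ws \<and> Suc (length us) = length ws \<and>
    adj_word_prod ws \<circ> Transposition.transpose i j = adj_word_prod us"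
  using assms(2)
proof (induction ws)
  case Nil
  then show ?case using assms(1) by simp
next
  case (Cons a ws)
  let ?z = "adj_word_prod ws"
  show ?case
  proof (cases "?z j < ?z i")
    case True
    then obtain us where us: "subseq us ws" "Suc (length us) = length ws" "?z \<circ> Transposition.transpose i j = adj_word_prod us"
      using Cons.IH by blast
    then show ?thesis by (intro exI[of _ "a # us"]) (simp add: fun_eq_iff)
  next
    case False
    have ne: "?z i \<noteq> ?z j" using assms(1) bij_adj_word_prod[of ws] by (metis bij_is_inj injD less_irrefl)
    have "?z i = a \<and> ?z j = Suc a"
      using False ne Cons.prems adj_transpose_less_iff[of "?z j" "?z i" a] by auto
    then have "?z \<circ> Transposition.transpose i j = swp a \<circ> ?z"
      using comp_transpose[OF bij_is_inj[OF bij_adj_word_prod], of ws i j] by simp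
    then have "adj_word_prod (a # ws) \<circ> Transposition.transpose i j = ?z"
      by (simp only: adj_word_prod_simps comp_assoc swp_swp_comp)
    moreover have "subseq ws (a # ws)" by auto
    ultimately show ?thesis by (metis length_Cons)
  qed
qed

lemma perm_length_adj_word_prod_le:
  "set ws \<subseteq> {1..<n} \<Longrightarrow> perm_length n (adj_word_prod ws) \<le> length ws"
  using perm_length_eq_card_inversion_set[OF adj_word_prod_permutes]
    card_inversion_set_adj_word_prod by fastforce

definition reduced_word :: "nat \<Rightarrow> (nat \<Rightarrow> nat) \<Rightarrow> nat list \<Rightarrow> bool" where
  "reduced_word n \<sigma> ws \<longleftrightarrow> set ws \<subseteq> {1..<n} \<and> \<sigma> = adj_word_prod ws \<and> length ws = perm_length n \<sigma>"

lemma ex_reduced_word: "\<sigma> permutes {1..n} \<Longrightarrow> \<exists>ws. reduced_word n \<sigma> ws"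
  using ex_adj_word[of \<sigma> n] perm_length_eq_card_inversion_set[of \<sigma> n] by (auto simp: reduced_word_def)

lemma subseq_ConsE: "subseq us (a # ws) \<Longrightarrow> subseq us ws \<or> (\<exists>us'. us = a # us' \<and> subseq us' ws)"
  by (cases us) (auto simp: subseq_Cons2_iff split: if_splits)

lemma subseq_set: "subseq us ws \<Longrightarrow> set us \<subseteq> set ws"
  by (auto dest: list_emb_set)

text \<open>Strong exchange applied to a reduced word turns the removal of an inversion into the
  removal of a letter.\<close>

lemma perm_length_less:
  assumes "\<sigma> permutes {1..n}" "i < j" "\<sigma> j < \<sigma> i"
  shows "perm_length n (\<sigma> \<circ> Transposition.transpose i j) < perm_length n \<sigma>"
proof -
  obtain ws where ws: "set ws \<subseteq> {1..<n}" "\<sigma> = adj_word_prod ws" "length ws = perm_length n \<sigma>"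
    using ex_reduced_word[OF assms(1)] unfolding reduced_word_def by blast
  then obtain us where us: "subseq us ws" "Suc (length us) = length ws" "\<sigma> \<circ> Transposition.transpose i j = adj_word_prod us"
    using strong_exchange[of i j ws] assms by auto
  have "set us \<subseteq> {1..<n}" using subseq_set[OF us(1)] ws(1) by blast
  then show ?thesis using perm_length_adj_word_prod_le[of us n] us ws by simp
qed

lemma perm_length_transpose:
  assumes "\<sigma> permutes {1..n}" "i \<in> {1..n}" "j \<in> {1..n}" "i < j"
  shows "perm_length n (\<sigma> \<circ> Transposition.transpose i j) < perm_length n \<sigma> \<longleftrightarrow> \<sigma> j < \<sigma> i"
    and "\<sigma> i < \<sigma> j \<Longrightarrow> perm_length n \<sigma> < perm_length n (\<sigma> \<circ> Transposition.transpose i j)"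
proof -
  have p: "\<sigma> \<circ> Transposition.transpose i j permutes {1..n}"
    using assms by (intro permutes_compose permutes_swap_id)
  show up: "perm_length n \<sigma> < perm_length n (\<sigma> \<circ> Transposition.transpose i j)" if "\<sigma> i < \<sigma> j"
    using perm_length_less[OF p assms(4)] that by (simp add: comp_assoc)
  have "\<sigma> i \<noteq> \<sigma> j" using assms(1,4) by (metis permutes_inj injD less_irrefl)
  then show "perm_length n (\<sigma> \<circ> Transposition.transpose i j) < perm_length n \<sigma> \<longleftrightarrow> \<sigma> j < \<sigma> i"
    using up perm_length_less[OF assms(1,4)] by (metis less_asym linorder_neqE_nat)
qed

lemma bruhat_stepE:
  assumes "bruhat_step n \<sigma> \<tau>"
  obtains i j where "i \<in> {1..n}" "j \<in> {1..n}" "i < j" "\<sigma> = \<tau> \<circ> Transposition.transpose i j" "\<tau> j < \<tau> i"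
proof -
  obtain i j where ij: "i \<in> {1..n}" "j \<in> {1..n}" "i \<noteq> j" "\<sigma> = \<tau> \<circ> Transposition.transpose i j"
    and \<tau>: "\<tau> permutes {1..n}" and less: "perm_length n \<sigma> < perm_length n \<tau>"
    using assms unfolding bruhat_step_def by blast
  show thesis
  proof (cases "i < j")
    case True
    then show thesis using that ij less perm_length_transpose(1)[OF \<tau>] by blast
  next
    case False
    then have "j < i" "\<sigma> = \<tau> \<circ> Transposition.transpose j i" using ij by (simp_all add: transpose_commute)
    then show thesis using that[of j i] ij less perm_length_transpose(1)[OF \<tau>] by blast
  qed
qed

lemma refl_adj_iff_bruhat_step:
  assumes "\<sigma> permutes {1..n}" "\<tau> permutes {1..n}"
  shows "refl_adj \<sigma> \<tau> \<longleftrightarrow> bruhat_step n \<sigma> \<tau> \<or> bruhat_step n \<tau> \<sigma>"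
proof
  assume "refl_adj \<sigma> \<tau>"
  then obtain i' j' where "i' \<noteq> j'" "\<sigma> = \<tau> \<circ> Transposition.transpose i' j'" unfolding refl_adj_def by blast
  then obtain i j where ij: "i < j" "\<sigma> = \<tau> \<circ> Transposition.transpose i j"
    by (metis linorder_neqE_nat transpose_commute)
  have \<sigma>: "\<sigma> i = \<tau> j" "\<sigma> j = \<tau> i" using ij by simp_all
  have inj: "inj \<sigma>" "inj \<tau>" using assms permutes_inj by blast+
  \<comment> \<open>Both permutations fix everything outside {1..n}, so a transposition relating
    them acts within that set.\<close>
  have "i \<in> {1..n}"
  proof (rule ccontr)
    assume "i \<notin> {1..n}"
    then have "\<sigma> i = i" "\<tau> i = i" using assms by (auto intro: permutes_not_in)
    then show False using \<sigma> ij(1) injD[OF inj(2), of i j] by simp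
  qed
  moreover have "j \<in> {1..n}"
  proof (rule ccontr)
    assume "j \<notin> {1..n}"
    then have "\<sigma> j = j" "\<tau> j = j" using assms by (auto intro: permutes_not_in)
    then show False using \<sigma> ij(1) injD[OF inj(2), of i j] by simp
  qed
  moreover have "\<tau> i \<noteq> \<tau> j" using ij(1) inj(2) by (auto dest: injD)
  moreover have "\<tau> = \<sigma> \<circ> Transposition.transpose i j" using ij(2) by (simp add: comp_assoc)
  ultimately show "bruhat_step n \<sigma> \<tau> \<or> bruhat_step n \<tau> \<sigma>"
    using perm_length_transpose[OF assms(2) _ _ ij(1)] assms ij unfolding bruhat_step_def
    by (metis less_irrefl linorder_neqE_nat)
next
  assume "bruhat_step n \<sigma> \<tau> \<or> bruhat_step n \<tau> \<sigma>"
  moreover have "refl_adj x y" if "bruhat_step n x y" for x y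
    using that unfolding bruhat_step_def refl_adj_def by blast
  ultimately show "refl_adj \<sigma> \<tau>" using refl_adj_sym by blast
qed

lemma perm_length_swp_le:
  assumes "x permutes {1..n}" "a \<in> {1..<n}"
  shows "perm_length n (swp a \<circ> x) \<le> Suc (perm_length n x)"
proof -
  obtain ws where ws: "set ws \<subseteq> {1..<n}" "x = adj_word_prod ws" "length ws = perm_length n x"
    using ex_reduced_word[OF assms(1)] unfolding reduced_word_def by blast
  then show ?thesis using perm_length_adj_word_prod_le[of "a # ws" n] assms(2) by simp
qed

lemma refl_adj_swp: "bij x \<Longrightarrow> refl_adj (swp a \<circ> x) x"
proof -
  assume x: "bij x"
  have "inv x a \<noteq> inv x (Suc a)" using surj_f_inv_f[OF bij_is_surj[OF x]] by (metis n_not_Suc_n)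
  then show ?thesis unfolding transpose_comp[OF x] refl_adj_def by blast
qed

lemma swp_permutes: "x permutes {1..n} \<Longrightarrow> a \<in> {1..<n} \<Longrightarrow> swp a \<circ> x permutes {1..n}"
  by (intro permutes_compose adj_transpose_permutes)

lemma bruhat_step_swp:
  assumes "x permutes {1..n}" "a \<in> {1..<n}"
  shows "bruhat_step n x (swp a \<circ> x) \<or> bruhat_step n (swp a \<circ> x) x"
  using refl_adj_iff_bruhat_step[OF swp_permutes[OF assms] assms(1)] refl_adj_swp[of x a]
    permutes_bij[OF assms(1)] by blast

section \<open>The lifting property and the subword property\<close>

text \<open>The step down from \<open>y\<close> deletes a letter of the word \<open>a # vs\<close>.
  If it is the first, then \<open>swp a \<circ> z = y\<close>. Otherwise
  \<open>swp a \<circ> z\<close> is one step below \<open>swp a \<circ> y\<close>, hence below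
  \<open>y\<close>.\<close>

lemma bruhat_lift_descent:
  assumes z: "bruhat_step n z y" and a: "a \<in> {1..<n}" and down: "bruhat_step n (swp a \<circ> y) y"
  shows "bruhat_le n (swp a \<circ> z) y"
proof -
  obtain i j where ij: "i < j" "z = y \<circ> Transposition.transpose i j" "y j < y i"
    using z by (elim bruhat_stepE) blast
  have perm: "z permutes {1..n}" "y permutes {1..n}" "swp a \<circ> y permutes {1..n}" "perm_length n (swp a \<circ> y) < perm_length n y"
    using z down by (auto simp: bruhat_step_def)
  obtain vs where vs: "set vs \<subseteq> {1..<n}" "swp a \<circ> y = adj_word_prod vs" "length vs = perm_length n (swp a \<circ> y)"
    using ex_reduced_word[OF perm(3)] unfolding reduced_word_def by blast
  have y: "y = adj_word_prod (a # vs)" by (simp flip: vs(2))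
  obtain us where us: "subseq us (a # vs)" "Suc (length us) = length (a # vs)" "z = adj_word_prod us"
    using strong_exchange[of i j "a # vs"] ij y by auto
  from subseq_ConsE[OF us(1)] show ?thesis
  proof (elim disjE exE conjE)
    assume "subseq us vs"
    then have "us = vs" using us(2) by (simp add: subseq_same_length)
    then have "swp a \<circ> z = y" unfolding us(3) y by simp
    then show ?thesis by (simp add: bruhat_le_def)
  next
    fix us' assume "us = a # us'" "subseq us' vs"
    then have us': "us = a # us'" "subseq us' vs" "length vs = Suc (length us')" using us(2) by auto
    have "set us' \<subseteq> {1..<n}" using us'(2) subseq_set vs(1) by blast
    moreover have "swp a \<circ> z = adj_word_prod us'" unfolding us(3) us'(1) by simp
    ultimately have "perm_length n (swp a \<circ> z) < perm_length n (swp a \<circ> y)"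
      using perm_length_adj_word_prod_le[of us' n] us'(3) vs(3) by simp
    moreover have "refl_adj (swp a \<circ> z) (swp a \<circ> y)"
      using refl_adj_iff_bruhat_step[OF perm(1,2)] z by (simp add: refl_adj_left bij_transpose)
    ultimately have "bruhat_step n (swp a \<circ> z) (swp a \<circ> y)"
      using refl_adj_iff_bruhat_step[OF swp_permutes[OF perm(1) a] perm(3)] by (auto simp: bruhat_step_def)
    then show ?thesis using down unfolding bruhat_le_def by (meson converse_rtranclp_into_rtranclp r_into_rtranclp)
  qed
qed

text \<open>The lifting property of the Bruhat order. The two halves are proved together by
  induction along the chain from \<open>x\<close> to \<open>y\<close>, because multiplication by
  \<open>swp a\<close> may raise some of its elements and lower others.\<close>

lemma bruhat_lift:
  assumes "bruhat_le n x y" and x: "x permutes {1..n}" and a: "a \<in> {1..<n}"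
  shows "(bruhat_step n y (swp a \<circ> y) \<longrightarrow> bruhat_le n (swp a \<circ> x) (swp a \<circ> y)) \<and>
    (bruhat_step n (swp a \<circ> y) y \<longrightarrow> bruhat_le n (swp a \<circ> x) y)"
  using assms(1) unfolding bruhat_le_def
proof (induction rule: rtranclp_induct)
  case base
  then show ?case by auto
next
  case (step z y)
  have perm: "z permutes {1..n}" "y permutes {1..n}" "perm_length n z < perm_length n y"
    using step(2) by (auto simp: bruhat_step_def)
  from bruhat_step_swp[OF perm(1) a] show ?case
  proof
    assume up: "bruhat_step n z (swp a \<circ> z)"
    then have IH: "(bruhat_step n)\<^sup>*\<^sup>* (swp a \<circ> x) (swp a \<circ> z)" using step.IH by blast
    have upper: "bruhat_step n (swp a \<circ> z) (swp a \<circ> y)" if "bruhat_step n y (swp a \<circ> y)"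
    proof -
      have "perm_length n (swp a \<circ> z) \<le> perm_length n y" using perm_length_swp_le[OF perm(1) a] perm(3) by simp
      then have "perm_length n (swp a \<circ> z) < perm_length n (swp a \<circ> y)" using that by (simp add: bruhat_step_def)
      moreover have "refl_adj (swp a \<circ> z) (swp a \<circ> y)"
        using refl_adj_iff_bruhat_step[OF perm(1,2)] step(2) by (simp add: refl_adj_left bij_transpose)
      ultimately show ?thesis
        using refl_adj_iff_bruhat_step[OF swp_permutes[OF perm(1) a] swp_permutes[OF perm(2) a]] by (auto simp: bruhat_step_def)
    qed
    have lower: "(bruhat_step n)\<^sup>*\<^sup>* (swp a \<circ> z) y" if "bruhat_step n (swp a \<circ> y) y"
      using bruhat_lift_descent[OF step(2) a that] by (simp add: bruhat_le_def)
    show ?thesis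
      using rtranclp.rtrancl_into_rtrancl[OF IH] upper rtranclp_trans[OF IH] lower by blast
  next
    assume "bruhat_step n (swp a \<circ> z) z"
    then have "(bruhat_step n)\<^sup>*\<^sup>* (swp a \<circ> x) z" using step.IH by blast
    from rtranclp.rtrancl_into_rtrancl[where r = "bruhat_step n", OF this step(2)]
    have below: "(bruhat_step n)\<^sup>*\<^sup>* (swp a \<circ> x) y" .
    show ?thesis
      using below rtranclp.rtrancl_into_rtrancl[where r = "bruhat_step n", OF below] by blast
  qed
qed

lemma reduced_word_ConsD:
  assumes "reduced_word n \<sigma> (a # ws)"
  shows "a \<in> {1..<n}" "reduced_word n (adj_word_prod ws) ws" "bruhat_step n (adj_word_prod ws) \<sigma>"
proof -
  have ws: "set (a # ws) \<subseteq> {1..<n}" "\<sigma> = swp a \<circ> adj_word_prod ws" "Suc (length ws) = perm_length n \<sigma>"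
    using assms by (auto simp: reduced_word_def)
  show a: "a \<in> {1..<n}" using ws by simp
  have perm: "adj_word_prod ws permutes {1..n}" using ws by (intro adj_word_prod_permutes) simp
  have "perm_length n (adj_word_prod ws) \<le> length ws" using ws by (intro perm_length_adj_word_prod_le) simp
  moreover have "perm_length n \<sigma> \<le> Suc (perm_length n (adj_word_prod ws))"
    unfolding ws(2) by (rule perm_length_swp_le[OF perm a])
  ultimately have l: "perm_length n (adj_word_prod ws) = length ws" using ws(3) by simp
  then show "reduced_word n (adj_word_prod ws) ws" using ws(1) by (simp add: reduced_word_def)
  show "bruhat_step n (adj_word_prod ws) \<sigma>"
    using bruhat_step_swp[OF perm a] l ws(3) by (auto simp: bruhat_step_def ws(2))
qed

text \<open>Induction on the reduced word: a subword without the first letter is reached through the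
  ascent to \<open>\<sigma>\<close>, and one with it by lifting the relation between the remaining
  words.\<close>

lemma subword_bruhat_le:
  assumes "reduced_word n \<sigma> ws" "subseq us ws"
  shows "bruhat_le n (adj_word_prod us) \<sigma>"
  using assms
proof (induction ws arbitrary: \<sigma> us)
  case Nil
  then have "us = []" "\<sigma> = adj_word_prod []" by (simp_all add: reduced_word_def)
  then show ?case by (simp only: bruhat_le_def rtranclp.rtrancl_refl)
next
  case (Cons a ws)
  note D = reduced_word_ConsD[OF Cons.prems(1)]
  have \<sigma>: "\<sigma> = swp a \<circ> adj_word_prod ws" using Cons.prems(1) by (simp add: reduced_word_def)
  have IH: "bruhat_le n (adj_word_prod vs) (adj_word_prod ws)" if "subseq vs ws" for vs
    using Cons.IH[OF D(2) that] .
  from subseq_ConsE[OF Cons.prems(2)] show ?case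
  proof (elim disjE exE conjE)
    assume "subseq us ws"
    then show ?thesis using IH[of us] D(3) unfolding bruhat_le_def by (simp add: rtranclp.rtrancl_into_rtrancl)
  next
    fix us' assume us: "us = a # us'" "subseq us' ws"
    have "set us' \<subseteq> {1..<n}" using subseq_set[OF us(2)] Cons.prems(1) by (auto simp: reduced_word_def)
    then have "adj_word_prod us' permutes {1..n}" by (rule adj_word_prod_permutes)
    from bruhat_lift[OF IH[OF us(2)] this D(1)] D(3) show ?thesis unfolding us(1) \<sigma> by (simp only: adj_word_prod_simps simp_thms)
  qed
qed

text \<open>Each step down the chain deletes one more letter by strong exchange.\<close>

lemma bruhat_le_subword:
  assumes "bruhat_le n \<tau> (adj_word_prod ws)"
  shows "\<exists>us. subseq us ws \<and> \<tau> = adj_word_prod us"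
  using assms unfolding bruhat_le_def
proof (induction rule: converse_rtranclp_induct)
  case base
  then show ?case by blast
next
  case (step \<rho> \<tau>)
  then obtain us where us: "subseq us ws" "\<tau> = adj_word_prod us" by blast
  from step(1) show ?case
  proof (rule bruhat_stepE)
    fix i j assume "i < j" "\<rho> = \<tau> \<circ> Transposition.transpose i j" "\<tau> j < \<tau> i"
    then show ?thesis using strong_exchange[of i j us] us by (metis subseq_order.trans)
  qed
qed

theorem lower_bruhat_graph_subwords:
  assumes "reduced_word n \<sigma> ws"
  shows "verts (underlying_graph (lower_bruhat_graph n \<sigma>)) = adj_word_prod ` {us. subseq us ws}"
    and "arcs_ends (underlying_graph (lower_bruhat_graph n \<sigma>)) = {(u, v).
      u \<in> adj_word_prod ` {us. subseq us ws} \<and> v \<in> adj_word_prod ` {us. subseq us ws} \<and> refl_adj u v}"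
proof -
  have ws: "\<sigma> = adj_word_prod ws" "set ws \<subseteq> {1..<n}" using assms by (simp_all add: reduced_word_def)
  have perm: "adj_word_prod us permutes {1..n}" if "subseq us ws" for us
    using subseq_set[OF that] ws(2) by (intro adj_word_prod_permutes) blast
  have D: "{\<tau>. \<tau> permutes {1..n} \<and> bruhat_le n \<tau> \<sigma>} = adj_word_prod ` {us. subseq us ws}"
    using bruhat_le_subword[of n _ ws] subword_bruhat_le[OF assms] perm by (auto simp: ws(1))
  then show V: "verts (underlying_graph (lower_bruhat_graph n \<sigma>)) = adj_word_prod ` {us. subseq us ws}"
    by (simp add: underlying_graph_def lower_bruhat_graph_def)
  have "arcs_ends (underlying_graph (lower_bruhat_graph n \<sigma>)) = {(u, v).
      u \<in> {\<tau>. \<tau> permutes {1..n} \<and> bruhat_le n \<tau> \<sigma>} \<and> v \<in> {\<tau>. \<tau> permutes {1..n} \<and> bruhat_le n \<tau> \<sigma>} \<and>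
      (bruhat_step n u v \<or> bruhat_step n v u)}"
    by (auto simp: underlying_graph_def lower_bruhat_graph_def bruhat_graph_def mk_symmetric_def)
  also have "\<dots> = {(u, v).
      u \<in> {\<tau>. \<tau> permutes {1..n} \<and> bruhat_le n \<tau> \<sigma>} \<and> v \<in> {\<tau>. \<tau> permutes {1..n} \<and> bruhat_le n \<tau> \<sigma>} \<and> refl_adj u v}"
    using refl_adj_iff_bruhat_step by blast
  finally show "arcs_ends (underlying_graph (lower_bruhat_graph n \<sigma>)) = {(u, v).
      u \<in> adj_word_prod ` {us. subseq us ws} \<and> v \<in> adj_word_prod ` {us. subseq us ws} \<and> refl_adj u v}"
    unfolding D .
qed

section \<open>Words with distinct letters and cubes\<close>

lemma swp_le_iff: "a \<noteq> c \<Longrightarrow> swp a x \<le> c \<longleftrightarrow> x \<le> c"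
  by (auto simp: Transposition.transpose_def)

text \<open>Only the letter \<open>c\<close> moves points across the cut between \<open>c\<close>
  and \<open>Suc c\<close>. Products of words without \<open>c\<close> respect this cut, and one
  extra factor \<open>swp c\<close> breaks it.\<close>

lemma adj_word_prod_le_iff: "c \<notin> set ws \<Longrightarrow> adj_word_prod ws x \<le> c \<longleftrightarrow> x \<le> c"
  by (induction ws arbitrary: x) (auto simp: swp_le_iff)

lemma swp_comp_neq:
  assumes "c \<notin> set us" "c \<notin> set vs"
  shows "swp c \<circ> adj_word_prod us \<noteq> adj_word_prod vs"
proof
  assume eq: "swp c \<circ> adj_word_prod us = adj_word_prod vs"
  obtain x where x: "adj_word_prod us x = c" using bij_adj_word_prod by (metis bij_pointE)
  then have "adj_word_prod vs x = Suc c" by (simp flip: eq)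
  then show False using adj_word_prod_le_iff[OF assms(1), of x] adj_word_prod_le_iff[OF assms(2), of x] x by simp
qed

lemma comp_swp_neq:
  assumes "c \<notin> set us" "c \<notin> set vs"
  shows "adj_word_prod us \<circ> swp c \<noteq> adj_word_prod vs"
proof
  assume eq: "adj_word_prod us \<circ> swp c = adj_word_prod vs"
  then have "adj_word_prod us (Suc c) = adj_word_prod vs c" by (metis comp_apply transpose_apply_first)
  then show False using adj_word_prod_le_iff[OF assms(1), of "Suc c"] adj_word_prod_le_iff[OF assms(2), of c] by simp
qed

text \<open>Both products respect the cut at \<open>c\<close>, while \<open>swp c\<close> carries
  \<open>c\<close> and \<open>Suc c\<close> across it. A transposition that makes up for this must
  move both points across and so is \<open>swp c\<close> itself.\<close>

lemma refl_adj_swp_iff: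
  assumes "c \<notin> set us" "c \<notin> set vs"
  shows "refl_adj (swp c \<circ> adj_word_prod us) (adj_word_prod vs) \<longleftrightarrow> adj_word_prod us = adj_word_prod vs"
proof
  let ?X = "adj_word_prod us" and ?Y = "adj_word_prod vs"
  assume "refl_adj (swp c \<circ> ?X) ?Y"
  then obtain i j where "swp c \<circ> ?X = ?Y \<circ> Transposition.transpose i j" unfolding refl_adj_def by blast
  then obtain p q where eq: "swp c \<circ> ?X = Transposition.transpose p q \<circ> ?Y"
    using comp_transpose[OF bij_is_inj[OF bij_adj_word_prod]] by metis
  have le: "?X x \<le> c \<longleftrightarrow> ?Y x \<le> c" for x using adj_word_prod_le_iff assms by simp
  obtain x where x: "?X x = c" using bij_adj_word_prod by (metis bij_pointE)
  obtain x' where x': "?X x' = Suc c" using bij_adj_word_prod by (metis bij_pointE)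
  have 1: "Transposition.transpose p q (?Y x) = Suc c" "?Y x \<le> c"
    using fun_cong[OF eq, of x] x le[of x] by simp_all
  have 2: "Transposition.transpose p q (?Y x') = c" "\<not> ?Y x' \<le> c"
    using fun_cong[OF eq, of x'] x' le[of x'] by simp_all
  have "p = c \<and> q = Suc c \<or> p = Suc c \<and> q = c"
    using 1 2 by (auto simp: Transposition.transpose_def split: if_splits)
  then have "swp c \<circ> ?X = swp c \<circ> ?Y" using eq by (auto simp: transpose_commute)
  then have "swp c \<circ> (swp c \<circ> ?X) = swp c \<circ> (swp c \<circ> ?Y)" by simp
  then show "?X = ?Y" unfolding swp_swp_comp .
next
  assume "adj_word_prod us = adj_word_prod vs"
  then show "refl_adj (swp c \<circ> adj_word_prod us) (adj_word_prod vs)"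
    using refl_adj_swp[OF bij_adj_word_prod] by metis
qed

definition select :: "bool list \<Rightarrow> nat list \<Rightarrow> nat list" where
  "select bs ws = map snd (filter fst (zip bs ws))"

lemma select_simps [simp]:
  "select [] ws = []" "select (True # bs) (w # ws) = w # select bs ws" "select (False # bs) (w # ws) = select bs ws"
  by (simp_all add: select_def)

lemma set_select: "set (select bs ws) \<subseteq> set ws"
  by (auto simp: select_def dest: set_zip_rightD)

lemma subseq_select: "{us. subseq us ws} = (\<lambda>bs. select bs ws) ` {bs. length bs = length ws}"
proof (induction ws)
  case (Cons a ws)
  have "{us. subseq us (a # ws)} = {us. subseq us ws} \<union> (#) a ` {us. subseq us ws}"
    by (auto dest: subseq_ConsE)
  also have "\<dots> = (\<lambda>bs. select bs (a # ws)) ` ((#) False ` {bs. length bs = length ws} \<union> (#) True ` {bs. length bs = length ws})"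
    unfolding Cons.IH by (simp add: image_Un image_image)
  also have "(#) False ` {bs. length bs = length ws} \<union> (#) True ` {bs. length bs = length ws} = {bs. length bs = length (a # ws)}"
    by (auto simp: length_Suc_conv image_iff)
  finally show ?case .
qed auto

text \<open>Induction on the word. Its first letter occurs nowhere else, so by the cut argument a
  factor \<open>swp a\<close> on one side only makes the products different, and adjacent exactly if
  the remaining products agree.\<close>

lemma distinct_word_select:
  assumes "distinct ws" "length bs = length ws" "length cs = length ws"
  shows "(adj_word_prod (select bs ws) = adj_word_prod (select cs ws) \<longleftrightarrow> bs = cs) \<and>
    (refl_adj (adj_word_prod (select bs ws)) (adj_word_prod (select cs ws)) \<longleftrightarrow> differences bs cs = 1)"
  using assms
proof (induction ws arbitrary: bs cs)
  case Nil
  then show ?case using refl_adj_irrefl[OF bij_id] by (auto simp: id_def)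
next
  case (Cons a ws)
  obtain b bs' c cs' where bc: "bs = b # bs'" "cs = c # cs'" "length bs' = length ws" "length cs' = length ws"
    using Cons.prems by (metis length_Suc_conv length_Cons)
  let ?X = "adj_word_prod (select bs' ws)" and ?Y = "adj_word_prod (select cs' ws)"
  have a: "a \<notin> set (select bs' ws)" "a \<notin> set (select cs' ws)" using Cons.prems(1) set_select by fastforce+
  have IH: "?X = ?Y \<longleftrightarrow> bs' = cs'" "refl_adj ?X ?Y \<longleftrightarrow> differences bs' cs' = 1"
    using Cons bc by simp_all
  have canc: "swp a \<circ> ?X = swp a \<circ> ?Y \<longleftrightarrow> ?X = ?Y" by (metis swp_swp_comp)
  have sym: "refl_adj ?X (swp a \<circ> ?Y) \<longleftrightarrow> ?X = ?Y"
    using refl_adj_swp_iff[OF a(2,1)] refl_adj_sym by metis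
  have len: "length bs' = length cs'" using bc by simp
  have ne: "swp a \<circ> ?X \<noteq> ?Y" "?X \<noteq> swp a \<circ> ?Y"
    using swp_comp_neq[OF a] swp_comp_neq[OF a(2,1)] by metis+
  have left: "refl_adj (swp a \<circ> ?X) (swp a \<circ> ?Y) \<longleftrightarrow> refl_adj ?X ?Y" by (rule refl_adj_left) simp
  have one: "1 + differences bs' cs' = 1 \<longleftrightarrow> bs' = cs'" using differences_eq_0[OF len] by simp
  show ?case
    unfolding bc
    by (cases b; cases c)
      (simp_all only: select_simps adj_word_prod_simps differences_simps canc sym left one ne refl_adj_swp_iff[OF a] IH
        list.inject simp_thms if_True if_False add_0)
qed

lemma digraph_iso_with_proj:
  assumes "parcs P \<subseteq> pverts P \<times> pverts P" "parcs Q \<subseteq> pverts Q \<times> pverts Q" "bij_betw f (pverts P) (pverts Q)"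
    "\<And>u v. u \<in> pverts P \<Longrightarrow> v \<in> pverts P \<Longrightarrow> (f u, f v) \<in> parcs Q \<longleftrightarrow> (u, v) \<in> parcs P"
  shows "digraph_iso (with_proj P) (with_proj Q)"
proof -
  define h where "h = \<lparr>iso_verts = f, iso_arcs = map_prod f f, iso_head = snd, iso_tail = fst\<rparr>"
  have inj: "inj_on f (pverts P)" and im: "f ` pverts P = pverts Q" using assms(3) by (auto simp: bij_betw_def)
  have "inj_on (map_prod f f) (parcs P)"
    by (rule inj_on_subset[OF map_prod_inj_on[OF inj inj] assms(1)])
  then have "pre_digraph.digraph_isomorphism (with_proj P) h"
    using inj assms(1) unfolding pre_digraph.digraph_isomorphism_def wf_digraph_def h_def by auto
  moreover have "map_prod f f ` parcs P = parcs Q"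
  proof
    show "map_prod f f ` parcs P \<subseteq> parcs Q" using assms(1,4) by auto
    show "parcs Q \<subseteq> map_prod f f ` parcs P"
    proof
      fix e assume e: "e \<in> parcs Q"
      then obtain u v where "u \<in> pverts P" "v \<in> pverts P" "e = (f u, f v)" using assms(2) im by blast
      then show "e \<in> map_prod f f ` parcs P" using e assms(4) by force
    qed
  qed
  then have "with_proj Q = app_iso h (with_proj P)"
    using im by (simp add: app_iso_def h_def with_proj_def)
  ultimately show ?thesis unfolding digraph_iso_def by blast
qed

lemma with_proj_sel: "pverts P = verts (with_proj P)" "parcs P = arcs_ends (with_proj P)"
  by simp_all

text \<open>The graph depends on the word alone; for a reduced word it is the lower Bruhat graph, by
  the subword property.\<close>

definition subword_graph :: "nat list \<Rightarrow> ((nat \<Rightarrow> nat), (nat \<Rightarrow> nat) \<times> (nat \<Rightarrow> nat)) pre_digraph" where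
  "subword_graph ws = with_proj \<lparr> pverts = adj_word_prod ` {us. subseq us ws},
     parcs = {(u, v). u \<in> adj_word_prod ` {us. subseq us ws} \<and> v \<in> adj_word_prod ` {us. subseq us ws} \<and> refl_adj u v} \<rparr>"

lemma subword_graph_simps:
  "verts (subword_graph ws) = adj_word_prod ` {us. subseq us ws}"
  "arcs_ends (subword_graph ws) = {(u, v). u \<in> verts (subword_graph ws) \<and> v \<in> verts (subword_graph ws) \<and> refl_adj u v}"
  by (simp_all add: subword_graph_def)

lemma lower_bruhat_graph_eq_subword_graph:
  assumes "reduced_word n \<sigma> ws"
  shows "underlying_graph (lower_bruhat_graph n \<sigma>) = subword_graph ws"
proof -
  have eqI: "with_proj P = with_proj Q" if "verts (with_proj P) = verts (with_proj Q)" "arcs_ends (with_proj P) = arcs_ends (with_proj Q)"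
    for P Q :: "(nat \<Rightarrow> nat) pair_pre_digraph"
    using that unfolding arcs_ends_with_proj by (simp add: with_proj_def)
  show ?thesis
    using lower_bruhat_graph_subwords[OF assms] unfolding underlying_graph_def subword_graph_def
    by (intro eqI) (simp_all del: arcs_ends_with_proj add: arcs_ends_with_proj[of "\<lparr>pverts = _, parcs = _\<rparr>"])
qed

lemma subword_graph_distinct:
  assumes "distinct ws"
  shows "bij_betw (\<lambda>bs. adj_word_prod (select bs ws)) {bs. length bs = length ws} (verts (subword_graph ws))"
    "length bs = length ws \<Longrightarrow> length cs = length ws \<Longrightarrow>
      (adj_word_prod (select bs ws), adj_word_prod (select cs ws)) \<in> arcs_ends (subword_graph ws) \<longleftrightarrow> differences bs cs = 1"
proof -
  show "bij_betw (\<lambda>bs. adj_word_prod (select bs ws)) {bs. length bs = length ws} (verts (subword_graph ws))"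
    using distinct_word_select[OF assms]
    by (auto simp: bij_betw_def inj_on_def subword_graph_simps subseq_select image_image)
  show "length bs = length ws \<Longrightarrow> length cs = length ws \<Longrightarrow>
      (adj_word_prod (select bs ws), adj_word_prod (select cs ws)) \<in> arcs_ends (subword_graph ws) \<longleftrightarrow> differences bs cs = 1"
    using distinct_word_select[OF assms, of bs cs] by (auto simp: subword_graph_simps subseq_select)
qed

lemma subword_graph_cube:
  assumes "distinct ws"
  shows "digraph_iso (subword_graph ws) (cube_graph (length ws))"
proof -
  let ?F = "\<lambda>bs. adj_word_prod (select bs ws)"
  define f where "f = the_inv_into {bs. length bs = length ws} ?F"
  note D = subword_graph_distinct[OF assms]
  have bij: "bij_betw f (verts (subword_graph ws)) {bs. length bs = length ws}"
    unfolding f_def by (rule bij_betw_the_inv_into[OF D(1)])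
  have f: "f (?F bs) = bs" if "length bs = length ws" for bs
    unfolding f_def using D(1) that by (intro the_inv_into_f_f) (auto simp: bij_betw_def)
  have F: "\<exists>bs. length bs = length ws \<and> u = ?F bs" if "u \<in> verts (subword_graph ws)" for u
    using that D(1) by (auto simp: bij_betw_def)
  show ?thesis
    unfolding subword_graph_def cube_graph_def
  \<comment> \<open>The obligations speak of raw records; \<open>with_proj_sel\<close> restates them
    for the vertices and arcs of the two named graphs.\<close>
  proof (rule digraph_iso_with_proj; unfold with_proj_sel; fold subword_graph_def cube_graph_def)
    show "arcs_ends (subword_graph ws) \<subseteq> verts (subword_graph ws) \<times> verts (subword_graph ws)"
      by (auto simp: subword_graph_simps(2))
    show "arcs_ends (cube_graph (length ws)) \<subseteq> verts (cube_graph (length ws)) \<times> verts (cube_graph (length ws))"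
      by (rule wf_cube_graph)
    show "bij_betw f (verts (subword_graph ws)) (verts (cube_graph (length ws)))"
      using bij by simp
    show "(f u, f v) \<in> arcs_ends (cube_graph (length ws)) \<longleftrightarrow> (u, v) \<in> arcs_ends (subword_graph ws)"
      if "u \<in> verts (subword_graph ws)" "v \<in> verts (subword_graph ws)" for u v
      using F[OF that(1)] F[OF that(2)] D(2) f by auto
  qed
qed

lemma subword_graph_complete:
  assumes "length ws = 0 \<and> k = 1 \<or> length ws = 1 \<and> k = 2"
  shows "complete_digraph k (subword_graph ws)"
proof -
  have d: "distinct ws" using assms by (auto simp: length_Suc_conv)
  note D = subword_graph_distinct[OF d]
  have L: "{bs::bool list. length bs = 0} = {[]}" "{bs. length bs = 1} = {[False], [True]}"
    by (auto simp: length_Suc_conv)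
  have card: "card (verts (subword_graph ws)) = k" "finite (verts (subword_graph ws))"
  proof -
    have "card {bs::bool list. length bs = length ws} = k \<and> finite {bs::bool list. length bs = length ws}"
      using assms by (elim disjE conjE) (simp_all only: L, simp_all)
    then show "card (verts (subword_graph ws)) = k" "finite (verts (subword_graph ws))"
      using bij_betw_same_card[OF D(1)] bij_betw_finite[OF D(1)] by simp_all
  qed
  have F: "\<exists>bs. length bs = length ws \<and> u = adj_word_prod (select bs ws)" if "u \<in> verts (subword_graph ws)" for u
    using that D(1) by (auto simp: bij_betw_def)
  have "(u, v) \<in> arcs_ends (subword_graph ws) \<longleftrightarrow> u \<noteq> v" if uv: "u \<in> verts (subword_graph ws)" "v \<in> verts (subword_graph ws)" for u v
  proof -
    obtain bs where bs: "length bs = length ws" "u = adj_word_prod (select bs ws)" using F[OF uv(1)] by blast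
    obtain cs where cs: "length cs = length ws" "v = adj_word_prod (select cs ws)" using F[OF uv(2)] by blast
    note bc = bs cs
    have "differences bs cs = 1 \<longleftrightarrow> bs \<noteq> cs" using bc(1,3) assms by (auto simp: length_Suc_conv split: if_splits)
    then show ?thesis using D(2)[OF bc(1,3)] distinct_word_select[OF d bc(1,3)] bc(2,4) by simp
  qed
  then have "arcs_ends (subword_graph ws) = {(u, v). (u, v) \<in> verts (subword_graph ws) \<times> verts (subword_graph ws) \<and> u \<noteq> v}"
    by (auto simp: subword_graph_simps(2))
  then show ?thesis
    using card unfolding subword_graph_def complete_digraph_pair_def by simp
qed

lemma not_toroidal_distinct:
  assumes "distinct ws" "5 \<le> length ws"
  shows "\<not> toroidal (subword_graph ws)"
proof
  assume t: "toroidal (subword_graph ws)"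
  note D = subword_graph_distinct[OF assms(1)]
  \<comment> \<open>Padding with \<open>False\<close> selects the subcube spanned by the first five
    letters.\<close>
  let ?f = "\<lambda>bs. bs @ replicate (length ws - 5) False"
  have len: "length (?f bs) = length ws" if "length bs = 5" for bs using that assms(2) by simp
  have "toroidal (cube_graph 5)"
  proof (rule toroidal_embed[OF t])
    show "inj_on (\<lambda>bs. adj_word_prod (select (?f bs) ws)) (verts (cube_graph 5))"
      using distinct_word_select[OF assms(1)] len by (auto simp: inj_on_def)
    show "(\<lambda>bs. adj_word_prod (select (?f bs) ws)) ` verts (cube_graph 5) \<subseteq> verts (subword_graph ws)"
      using D(1) len by (auto simp: bij_betw_def)
    show "{adj_word_prod (select (?f u) ws), adj_word_prod (select (?f v) ws)} \<in> undirected_edges (subword_graph ws)"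
      if "(u, v) \<in> arcs_ends (cube_graph 5)" for u v
    proof (intro undirected_edgesI)
      have uv: "length u = 5" "length v = 5" "differences u v = 1" using that by auto
      show "(adj_word_prod (select (?f u) ws), adj_word_prod (select (?f v) ws)) \<in> arcs_ends (subword_graph ws)"
        unfolding D(2)[OF len[OF uv(1)] len[OF uv(2)]] using uv by (simp add: differences_append)
    qed
  qed (rule wf_cube_graph)
  then show False using not_toroidal_cube_5 by blast
qed

section \<open>Words with a repeated letter\<close>

lemma paths_in_map:
  assumes "length ps = 9" "\<And>xs x. xs \<in> set ps \<Longrightarrow> x \<in> set xs \<Longrightarrow> f x \<in> verts G"
    "\<And>xs. xs \<in> set ps \<Longrightarrow> successively (\<lambda>x y. (f x, f y) \<in> arcs_ends G) xs"
  shows "paths_in G (map (map f) ps)"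
proof -
  have "edges_of (map f xs) \<subseteq> undirected_edges G" if "xs \<in> set ps" for xs
    using edges_of_successively[of G "map f xs"] assms(3)[OF that] unfolding successively_map .
  then show ?thesis using assms(1,2) by (auto simp: paths_in_def)
qed

lemma swp_commute:
  assumes "a \<noteq> b" "a \<noteq> Suc b" "b \<noteq> Suc a"
  shows "swp a \<circ> swp b = swp b \<circ> swp a"
  using assms by (simp add: fun_eq_iff Transposition.transpose_def)

lemma swp_commute_comp:
  assumes "a \<noteq> b" "a \<noteq> Suc b" "b \<noteq> Suc a"
  shows "swp a \<circ> (swp b \<circ> f) = swp b \<circ> (swp a \<circ> f)"
  using swp_commute[OF assms] by (simp flip: comp_assoc)

lemma swp_braid:
  assumes "a = Suc b \<or> b = Suc a"
  shows "swp a \<circ> (swp b \<circ> (swp a \<circ> f)) = swp b \<circ> (swp a \<circ> (swp b \<circ> f))"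
proof -
  have "swp a \<circ> (swp b \<circ> swp a) = swp b \<circ> (swp a \<circ> swp b)"
    using assms by (elim disjE) (simp_all add: fun_eq_iff Transposition.transpose_def)
  then have "swp a \<circ> (swp b \<circ> swp a) \<circ> f = swp b \<circ> (swp a \<circ> swp b) \<circ> f" by simp
  then show ?thesis by (simp only: comp_assoc)
qed

section \<open>Dihedral subgroups of order 6 and their cosets\<close>

text \<open>Indices 0, 1, 2 form one class and 3, 4, 5 the other; every path is a single
  edge.\<close>

definition K33_edges :: "nat list list" where
  "K33_edges = [[0, 3], [0, 4], [0, 5], [1, 3], [1, 4], [1, 5], [2, 3], [2, 4], [2, 5]]"

lemma K33_paths_edges: "K33_paths K33_edges" "length K33_edges = 9"
  by (simp_all add: K33_edges_def K33_paths_def all_less_3)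

text \<open>For neighbouring letters this is the dihedral group of order 6, with the even elements
  before the odd ones to match \<open>K33_edges\<close>.\<close>

definition rank2_words :: "nat \<Rightarrow> nat \<Rightarrow> nat list list" where
  "rank2_words a b = [[], [a, b], [b, a], [a], [b], [a, b, a]]"

lemma rank2_distinct:
  assumes "a = Suc b \<or> b = Suc a"
  shows "distinct (map adj_word_prod (rank2_words a b))"
proof -
  have "distinct (map (\<lambda>f. (f m, f (Suc m), f (Suc (Suc m)))) (map adj_word_prod (rank2_words m (Suc m))))"
    "distinct (map (\<lambda>f. (f m, f (Suc m), f (Suc (Suc m)))) (map adj_word_prod (rank2_words (Suc m) m)))" for m
    by (simp_all add: rank2_words_def Transposition.transpose_def)
  then have "distinct (map adj_word_prod (rank2_words m (Suc m)))" "distinct (map adj_word_prod (rank2_words (Suc m) m))" for m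
    by (simp_all only: distinct_map[of "\<lambda>f. (f _, f (Suc _), f (Suc (Suc _)))"])
  then show ?thesis using assms by blast
qed

lemma rank2_adj:
  assumes "i < 3" "3 \<le> j" "j < 6"
  shows "refl_adj (adj_word_prod (rank2_words a b ! i)) (adj_word_prod (rank2_words a b ! j))"
proof -
  have d: "refl_adj (adj_word_prod us) (adj_word_prod vs)"
    if "k < length vs" "us = take k vs @ drop (Suc k) vs" for us vs k
    using refl_adj_delete[of "take k vs" "drop (Suc k) vs" "vs ! k"] that by (simp add: id_take_nth_drop[symmetric])
  \<comment> \<open>Deleting the middle letter of \<open>[a, b, a]\<close> leaves a square, which is
    the identity; the other pairs are plain deletions.\<close>
  have "refl_adj (adj_word_prod []) (adj_word_prod [a, b, a])"
    using d[of 1 "[a, b, a]" "[a, a]"] by simp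
  moreover have "refl_adj (adj_word_prod []) (adj_word_prod [a])" "refl_adj (adj_word_prod []) (adj_word_prod [b])"
    by (rule d[of 0]; simp)+
  moreover have "refl_adj (adj_word_prod [a, b]) (adj_word_prod [a])" "refl_adj (adj_word_prod [a, b]) (adj_word_prod [b])"
    "refl_adj (adj_word_prod [b, a]) (adj_word_prod [a])" "refl_adj (adj_word_prod [b, a]) (adj_word_prod [b])"
    by (rule refl_adj_sym, rule d[of 1] d[of 0], simp, simp; fail)+
  moreover have "refl_adj (adj_word_prod [a, b]) (adj_word_prod [a, b, a])" "refl_adj (adj_word_prod [b, a]) (adj_word_prod [a, b, a])"
    by (rule d[of 2], simp, simp, rule d[of 0], simp, simp)
  moreover have "i \<in> {0, 1, 2}" "j \<in> {3, 4, 5}" using assms by auto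
  ultimately show ?thesis by (elim insertE emptyE) (simp_all add: rank2_words_def del: adj_word_prod_simps)
qed

text \<open>The dihedral subgroup generated by two neighbouring letters spans a \<open>K\<^sub>3\<^sub>,\<^sub>3\<close>, and so does
  each of its cosets.\<close>

lemma not_toroidal_two_cosets:
  assumes ab: "a = Suc b \<or> b = Suc a" and G: "G = subword_graph ws"
    and F: "inj F" "\<And>x y. refl_adj x y \<Longrightarrow> refl_adj (F x) (F y)"
    and V: "\<And>h. h \<in> set (rank2_words a b) \<Longrightarrow> adj_word_prod h \<in> verts G"
      "\<And>h. h \<in> set (rank2_words a b) \<Longrightarrow> F (adj_word_prod h) \<in> verts G"
    and disj: "\<And>h h'. h \<in> set (rank2_words a b) \<Longrightarrow> h' \<in> set (rank2_words a b) \<Longrightarrow> F (adj_word_prod h) \<noteq> adj_word_prod h'"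
  shows "\<not> toroidal G"
proof -
  define e where "e i = adj_word_prod (rank2_words a b ! i)" for i
  have len: "length (rank2_words a b) = 6" by (simp add: rank2_words_def)
  have mem: "rank2_words a b ! i \<in> set (rank2_words a b)" if "i < 6" for i using that len by simp
  have lt: "i < 6" if "xs \<in> set K33_edges" "i \<in> set xs" for xs i using that by (auto simp: K33_edges_def)
  have inj: "inj_on e (\<Union> (set ` set K33_edges))"
  proof (rule inj_on_subset)
    show "inj_on e {..<6}"
      using rank2_distinct[OF ab] len by (auto simp: inj_on_def e_def distinct_conv_nth)
    show "\<Union> (set ` set K33_edges) \<subseteq> {..<6}" using lt by auto
  qed
  have inj': "inj_on (F \<circ> e) (\<Union> (set ` set K33_edges))"
    using inj F(1) by (meson comp_inj_on inj_on_subset subset_UNIV)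
  have adj: "successively (\<lambda>i j. refl_adj (e i) (e j)) xs" if "xs \<in> set K33_edges" for xs
    using that rank2_adj[of _ _ a b] by (auto simp: K33_edges_def e_def)
  have p1: "paths_in G (map (map e) K33_edges)"
  proof (rule paths_in_map)
    show "e i \<in> verts G" if "xs \<in> set K33_edges" "i \<in> set xs" for xs i
      unfolding e_def by (rule V(1)[OF mem[OF lt[OF that]]])
    then show "successively (\<lambda>x y. (e x, e y) \<in> arcs_ends G) xs" if "xs \<in> set K33_edges" for xs
      using adj[OF that] that unfolding G subword_graph_simps(2) by (auto simp: K33_edges_def)
  qed (rule K33_paths_edges(2))
  have p2: "paths_in G (map (map (F \<circ> e)) K33_edges)"
  proof (rule paths_in_map)
    show vert: "(F \<circ> e) i \<in> verts G" if "xs \<in> set K33_edges" "i \<in> set xs" for xs i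
      unfolding e_def o_def by (rule V(2)[OF mem[OF lt[OF that]]])
    show "successively (\<lambda>x y. ((F \<circ> e) x, (F \<circ> e) y) \<in> arcs_ends G) xs" if "xs \<in> set K33_edges" for xs
    proof -
      have "successively (\<lambda>x y. refl_adj ((F \<circ> e) x) ((F \<circ> e) y)) xs"
        using successively_mono[OF adj[OF that]] F(2) by simp
      moreover have "x \<in> set xs \<Longrightarrow> (F \<circ> e) x \<in> verts G" for x using vert[OF that] .
      ultimately show ?thesis
        unfolding G subword_graph_simps(2) by (induction xs rule: induct_list012) auto
    qed
  qed (rule K33_paths_edges(2))
  show ?thesis
  proof (rule not_toroidal_disjoint_K33[OF K33_paths_map[OF K33_paths_edges inj] p1 K33_paths_map[OF K33_paths_edges inj'] p2])
    fix xs ys assume "xs \<in> set (map (map e) K33_edges)" "ys \<in> set (map (map (F \<circ> e)) K33_edges)"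
    then obtain xs' ys' where *: "xs = map e xs'" "ys = map (F \<circ> e) ys'" "xs' \<in> set K33_edges" "ys' \<in> set K33_edges" by auto
    have "F (e i) \<noteq> e j" if "i \<in> set ys'" "j \<in> set xs'" for i j
      unfolding e_def using disj[OF mem mem] lt * that by blast
    then show "set xs \<inter> set ys = {}" unfolding *(1,2) by fastforce
  qed
qed

text \<open>Transpositions change the sign, so there are no edges among the even or among the odd
  elements; all others are present by \<open>rank2_adj\<close>.\<close>

lemma subword_graph_K33:
  assumes "a = Suc b \<or> b = Suc a"
  shows "complete_bipartite_digraph 3 3 (subword_graph [a, b, a])"
proof -
  define e where "e i = adj_word_prod (rank2_words a b ! i)" for i
  have len: "length (rank2_words a b) = 6" by (simp add: rank2_words_def)
  have inj: "inj_on e {..<6}"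
    using rank2_distinct[OF assms] len by (auto simp: inj_on_def e_def distinct_conv_nth)
  have 6: "{..<6} = {0, 1, 2, 3, 4, 5::nat}" by auto
  have "{us. subseq us [a, b, a]} = set (subseqs [a, b, a])" by (rule set_subseqs_eq[symmetric])
  also have "adj_word_prod ` \<dots> = e ` {..<6}"
    unfolding 6 by (auto simp: e_def rank2_words_def Let_def)
  also have "e ` {..<6} = e ` {0, 1, 2} \<union> e ` {3, 4, 5}" unfolding 6 by auto
  finally have V: "verts (subword_graph [a, b, a]) = e ` {0, 1, 2} \<union> e ` {3, 4, 5}"
    by (simp only: subword_graph_simps(1))
  have perm: "permutation (adj_word_prod us)" for us
    by (induction us) (simp_all only: adj_word_prod_simps permutation_compose permutation_swap_id permutation_id)
  have even: "evenperm (adj_word_prod us) \<longleftrightarrow> even (length us)" for us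
    by (induction us) (simp_all only: adj_word_prod_simps evenperm_comp[OF permutation_swap_id perm] evenperm_swap
      evenperm_id list.size even_Suc even_zero n_not_Suc_n add_0_right add_Suc_right simp_thms)
  have odd: "evenperm x \<noteq> evenperm y" if "refl_adj x y" "permutation y" for x y
    using that unfolding refl_adj_def by (auto simp: evenperm_comp permutation_swap_id evenperm_swap)
  define A where "A = e ` {0, 1, 2}"
  define B where "B = e ` {3, 4, 5}"
  have A: "evenperm u \<and> permutation u" if "u \<in> A" for u
    using that unfolding A_def e_def rank2_words_def
    by (elim imageE insertE emptyE) (simp_all add: perm even del: adj_word_prod_simps)
  have B: "\<not> evenperm u \<and> permutation u" if "u \<in> B" for u
    using that unfolding B_def e_def rank2_words_def
    by (elim imageE insertE emptyE) (simp_all add: perm even del: adj_word_prod_simps)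
  have adj: "refl_adj u v" if "u \<in> A" "v \<in> B" for u v
    using that unfolding A_def B_def e_def
    by (elim imageE; clarify) (intro rank2_adj; auto)
  have disj: "A \<inter> B = {}" using A B by blast
  have E: "arcs_ends (subword_graph [a, b, a]) = A \<times> B \<union> B \<times> A"
  proof -
    have "refl_adj u v \<longleftrightarrow> (u, v) \<in> A \<times> B \<union> B \<times> A" if "u \<in> A \<union> B" "v \<in> A \<union> B" for u v
    proof -
      have "\<not> refl_adj u v" if "u \<in> A \<and> v \<in> A \<or> u \<in> B \<and> v \<in> B" using that A B odd by blast
      moreover have "refl_adj u v" if "u \<in> A \<and> v \<in> B \<or> u \<in> B \<and> v \<in> A" using that adj refl_adj_sym by blast
      ultimately show ?thesis using that disj by blast
    qed
    then show ?thesis unfolding subword_graph_simps(2) V A_def[symmetric] B_def[symmetric] by blast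
  qed
  have "inj_on e {0, 1, 2}" "inj_on e {3, 4, 5}" using inj unfolding 6 by (auto intro: inj_on_subset)
  then have "card A = 3" "card B = 3" unfolding A_def B_def by (simp_all add: card_image)
  then have "\<exists>U W. verts (subword_graph [a, b, a]) = U \<union> W \<and> U \<inter> W = {} \<and> card U = 3 \<and> card W = 3 \<and>
      arcs_ends (subword_graph [a, b, a]) = U \<times> W \<union> W \<times> U"
    using V E disj unfolding A_def[symmetric] B_def[symmetric] by blast
  moreover have "finite (verts (subword_graph [a, b, a]))" unfolding V by simp
  ultimately show ?thesis
    unfolding subword_graph_def complete_bipartite_digraph_pair_def by simp
qed

section \<open>The pattern s_2 s_1 s_3 s_2\<close>

text \<open>The elements below \<open>3412 = s\<^sub>2 s\<^sub>1 s\<^sub>3 s\<^sub>2\<close> are referred to by their position in \<open>middle_words\<close>.  Path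
  \<open>3 i + j\<close> of \<open>middle_K33\<close> joins \<open>a\<^sub>i\<close> to \<open>b\<^sub>j\<close> in the \<open>K\<^sub>3\<^sub>,\<^sub>3\<close> generated by \<open>s\<^sub>1\<close> and \<open>s\<^sub>2\<close>, and
  \<open>middle_subdivision i j\<close> avoids the cycle \<open>a\<^sub>i b\<^sub>j a\<^sub>1 b\<^sub>1\<close> of it (found by computer search).\<close>

definition middle_words :: "nat \<Rightarrow> nat list list" where
  "middle_words x = (let y = Suc x; z = Suc (Suc x) in
    [[], [y], [x], [z], [y, x], [y, z], [x, z], [x, y], [z, y], [y, x, z], [y, x, y], [y, z, y], [x, z, y], [y, x, z, y]])"

definition middle_K33 :: "nat list list" where
  "middle_K33 = [[0, 1], [0, 2], [0, 10], [4, 1], [4, 2], [4, 10], [7, 1], [7, 2], [7, 10]]"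

definition middle_subdivision :: "nat \<Rightarrow> nat \<Rightarrow> nat list list" where
  "middle_subdivision i j =
    (if i = 0 then [[1, 5], [1, 8], [1, 7, 12], [3, 5], [3, 8], [3, 6, 12], [11, 5], [11, 8], [11, 13, 12]]
     else if j = 2 then [[0, 1], [0, 3], [0, 11], [5, 1], [5, 3], [5, 11], [8, 1], [8, 3], [8, 11]]
     else [[0, 3], [0, 11], [0, 10, 13], [5, 3], [5, 11], [5, 9, 13], [8, 3], [8, 11], [8, 12, 13]])"

text \<open>The adjacencies along the chosen paths, each in one direction.\<close>

definition middle_adj :: "nat \<Rightarrow> nat \<Rightarrow> bool" where
  "middle_adj i j \<longleftrightarrow> (i, j) \<in> {(0,1), (0,2), (0,3), (0,10), (0,11), (1,4), (1,5), (1,7), (1,8), (2,4), (2,7), (3,5), (3,6),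
     (3,8), (4,10), (5,9), (5,11), (6,12), (7,10), (7,12), (8,11), (8,12), (9,13), (10,13), (11,13), (12,13)}"

lemma middle_adj:
  assumes "middle_adj i j"
  shows "refl_adj (adj_word_prod (middle_words x ! i)) (adj_word_prod (middle_words x ! j))"
proof -
  define y where "y = Suc x"
  define z where "z = Suc (Suc x)"
  note del = refl_adj_delete[of "[]" "[]" y] refl_adj_delete[of "[]" "[]" x] refl_adj_delete[of "[]" "[]" z]
    refl_adj_delete[of "[y]" "[]" x] refl_adj_delete[of "[y]" "[]" z] refl_adj_delete[of "[]" "[y]" x]
    refl_adj_delete[of "[]" "[y]" z] refl_adj_delete[of "[]" "[x]" y] refl_adj_delete[of "[x]" "[]" y]
    refl_adj_delete[of "[]" "[z]" y] refl_adj_delete[of "[]" "[z]" x] refl_adj_delete[of "[z]" "[]" y]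
    refl_adj_delete[of "[y, x]" "[]" y] refl_adj_delete[of "[y]" "[z]" x] refl_adj_delete[of "[y, z]" "[]" y]
    refl_adj_delete[of "[x, z]" "[]" y] refl_adj_delete[of "[]" "[x, y]" y] refl_adj_delete[of "[x]" "[y]" z]
    refl_adj_delete[of "[]" "[z, y]" y] refl_adj_delete[of "[]" "[z, y]" x]
    refl_adj_delete[of "[y, x, z]" "[]" y] refl_adj_delete[of "[y, x]" "[y]" z]
    refl_adj_delete[of "[y]" "[z, y]" x] refl_adj_delete[of "[]" "[x, z, y]" y]
  \<comment> \<open>Deleting the middle letter leaves the square of \<open>y\<close>, which is the
    identity; the other listed pairs are the single deletions in \<open>del\<close>.\<close>
  have e: "refl_adj (adj_word_prod []) (adj_word_prod [y, x, y])" "refl_adj (adj_word_prod []) (adj_word_prod [y, z, y])"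
    using refl_adj_delete[of "[y]" "[y]" x] refl_adj_delete[of "[y]" "[y]" z] by simp_all
  have w: "middle_words x = [[], [y], [x], [z], [y, x], [y, z], [x, z], [x, y], [z, y], [y, x, z], [y, x, y], [y, z, y], [x, z, y], [y, x, z, y]]"
    by (simp add: middle_words_def y_def z_def)
  show ?thesis
    using assms unfolding middle_adj_def w
    by (elim insertE emptyE Pair_inject)
      (simp_all del: adj_word_prod_simps add: e del[unfolded append.simps])
qed

lemma middle_distinct: "distinct (map adj_word_prod (middle_words x))"
proof -
  have "distinct (map (\<lambda>f. (f x, f (Suc x), f (Suc (Suc x)), f (Suc (Suc (Suc x))))) (map adj_word_prod (middle_words x)))"
    by (simp add: middle_words_def Let_def Transposition.transpose_def)
  then show ?thesis by (simp only: distinct_map[of "\<lambda>f. (f x, f (Suc x), f (Suc (Suc x)), f (Suc (Suc (Suc x))))"])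
qed

lemma middle_paths:
  "K33_paths middle_K33" "length middle_K33 = 9"
  "ij \<in> {(0, 2), (2, 2), (2, 0)} \<Longrightarrow> K33_paths (middle_subdivision (fst ij) (snd ij)) \<and> length (middle_subdivision (fst ij) (snd ij)) = 9"
  by (auto simp: middle_K33_def middle_subdivision_def K33_paths_def all_less_3)

text \<open>All conditions on the paths are evaluated on indices and then carried over by the
  injective map \<open>e\<close>. For \<open>i = j = 2\<close> the avoiding K33 is the dihedral
  subgroup of the upper two letters; the other two cycles need genuine subdivisions.\<close>

lemma not_toroidal_middle:
  assumes V: "\<And>h. h \<in> set (middle_words x) \<Longrightarrow> adj_word_prod h \<in> verts (subword_graph ws)"
  shows "\<not> toroidal (subword_graph ws)"
proof -
  let ?G = "subword_graph ws"
  define e where "e i = adj_word_prod (middle_words x ! i)" for i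
  have len: "length (middle_words x) = 14" by (simp add: middle_words_def Let_def)
  have eV: "e i \<in> verts ?G" if "i < 14" for i unfolding e_def using V len that by simp
  have inj: "inj_on e {..<14}"
    using middle_distinct[of x] len by (auto simp: inj_on_def e_def distinct_conv_nth)
  define good where "good ps \<longleftrightarrow> K33_paths ps \<and> length ps = 9 \<and>
    (\<forall>xs\<in>set ps. set xs \<subseteq> {..<14} \<and> successively (\<lambda>i j. middle_adj i j \<or> middle_adj j i) xs)" for ps
  have good: "K33_paths (map (map e) ps)" "paths_in ?G (map (map e) ps)" if "good ps" for ps
  proof -
    have sub: "\<Union> (set ` set ps) \<subseteq> {..<14}" using that unfolding good_def by blast
    show "K33_paths (map (map e) ps)"
      using that inj_on_subset[OF inj sub] unfolding good_def by (intro K33_paths_map) auto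
    show "paths_in ?G (map (map e) ps)"
    proof (rule paths_in_map)
      show "length ps = 9" using that by (simp add: good_def)
      show vert: "e i \<in> verts ?G" if "xs \<in> set ps" "i \<in> set xs" for xs i
        using sub that by (intro eV) auto
      show "successively (\<lambda>i j. (e i, e j) \<in> arcs_ends ?G) xs" if xs: "xs \<in> set ps" for xs
      proof -
        have "successively (\<lambda>i j. middle_adj i j \<or> middle_adj j i) xs" using \<open>good ps\<close> xs unfolding good_def by blast
        then have "successively (\<lambda>i j. refl_adj (e i) (e j)) xs"
          by (rule successively_mono) (use middle_adj refl_adj_sym in \<open>unfold e_def, blast\<close>)
        moreover have "i \<in> set xs \<Longrightarrow> e i \<in> verts ?G" for i using vert[OF xs] .
        ultimately show ?thesis unfolding subword_graph_simps(2) by (induction xs rule: induct_list012) auto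
      qed
    qed
  qed
  have gK: "good middle_K33" unfolding good_def using middle_paths(1,2) by (auto simp: middle_K33_def middle_adj_def)
  show ?thesis
  proof (rule not_toroidalI[OF good[OF gK]])
    fix i j :: nat assume ij: "(i, j) \<in> {(0, 2), (2, 2), (2, 0)}"
    have gS: "good (middle_subdivision i j)"
      using middle_paths(3)[OF ij] ij unfolding good_def by (auto simp: middle_subdivision_def middle_adj_def)
    have "set (map (map e) middle_K33 ! (3 * u + v)) \<inter> set ys = {}"
      if uv: "u \<in> {i, 1}" "v \<in> {j, 1}" and ys: "ys \<in> set (map (map e) (middle_subdivision i j))" for u v ys
    proof -
      obtain zs where zs: "ys = map e zs" "zs \<in> set (middle_subdivision i j)" using ys by auto
      have "u < 3" "v < 3" using uv ij by auto
      then have lt: "3 * u + v < length middle_K33" using middle_paths(2) by simp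
      have "set (middle_K33 ! (3 * u + v)) \<inter> set zs = {}"
        using ij uv zs(2) by (auto simp: middle_K33_def middle_subdivision_def)
      moreover have "set (middle_K33 ! (3 * u + v)) \<subseteq> {..<14}" "set zs \<subseteq> {..<14}"
        using gK gS lt zs(2) nth_mem unfolding good_def by blast+
      ultimately have "e ` set (middle_K33 ! (3 * u + v)) \<inter> e ` set zs = {}"
        using inj_on_image_Int[OF inj] by (metis image_empty)
      then show ?thesis unfolding zs(1) using lt by simp
    qed
    then show "\<exists>qs. K33_paths qs \<and> paths_in ?G qs \<and>
        (\<forall>u\<in>{i, 1}. \<forall>v\<in>{j, 1}. \<forall>ys\<in>set qs. set (map (map e) middle_K33 ! (3 * u + v)) \<inter> set ys = {})"
      using good[OF gS] by blast
  qed
qed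

section \<open>Closest occurrences of a repeated letter\<close>

lemma subseq_pair: "x \<in> set m \<Longrightarrow> y \<in> set m \<Longrightarrow> x \<noteq> y \<Longrightarrow> subseq [x, y] m \<or> subseq [y, x] m"
  by (induction m) (auto simp: subseq_singleton_left)

text \<open>The shortest prefix with a repetition ends with the second occurrence of
  \<open>a\<close>; before it all letters are distinct.\<close>

lemma not_distinct_close_repeat:
  assumes "\<not> distinct ws"
  shows "\<exists>p a m q. ws = p @ a # m @ a # q \<and> distinct (a # m)"
proof -
  obtain xs a q where *: "a \<in> set xs" "distinct xs" "ws = xs @ a # q"
    using assms not_distinct_conv_prefix[of ws] by auto
  moreover from *(1) obtain p m where "xs = p @ a # m" by (metis split_list)
  ultimately show ?thesis by auto
qed

lemma adj_word_prod_commute: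
  assumes "\<And>c. c \<in> set m \<Longrightarrow> c \<noteq> a \<and> c \<noteq> Suc a \<and> a \<noteq> Suc c"
  shows "adj_word_prod (m @ a # q) = adj_word_prod (a # m @ q)"
  using assms
proof (induction m)
  case (Cons c m)
  have "adj_word_prod (m @ a # q) = adj_word_prod (a # m @ q)" by (rule Cons.IH) (simp add: Cons.prems)
  moreover have "swp c \<circ> (swp a \<circ> f) = swp a \<circ> (swp c \<circ> f)" for f
    using Cons.prems[of c] by (intro swp_commute_comp) auto
  ultimately show ?case by (simp only: append_Cons adj_word_prod_simps)
qed simp

lemma reduced_word_le:
  assumes "reduced_word n \<sigma> ws" "set us \<subseteq> {1..<n}" "adj_word_prod us = adj_word_prod ws"
  shows "length ws \<le> length us"
  using assms perm_length_adj_word_prod_le[OF assms(2)] by (simp add: reduced_word_def)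

text \<open>The six elements are closed under left multiplication by either letter; the two products
  that need the braid relation are b a b = a b a and b a b a = a b.\<close>

lemma rank2_closed:
  assumes ab: "a = Suc b \<or> b = Suc a" and "set us \<subseteq> {a, b}"
  shows "\<exists>h\<in>set (rank2_words a b). adj_word_prod us = adj_word_prod h"
  using assms(2)
proof (induction us)
  case (Cons c us)
  then obtain h where h: "h \<in> set (rank2_words a b)" "adj_word_prod us = adj_word_prod h" by auto
  have c: "c = a \<or> c = b" using Cons.prems by auto
  have braid: "swp b \<circ> (swp a \<circ> (swp b \<circ> id)) = swp a \<circ> (swp b \<circ> (swp a \<circ> id))"
    by (rule swp_braid) (use ab in auto)
  have inverse: "swp b \<circ> (swp a \<circ> (swp b \<circ> (swp a \<circ> id))) = swp a \<circ> (swp b \<circ> id)"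
    using swp_braid[of a b id] ab by (simp only: swp_swp_comp simp_thms)
  have "\<exists>h'\<in>set (rank2_words a b). adj_word_prod (c # h) = adj_word_prod h'"
    using h(1) c unfolding rank2_words_def
    by (elim disjE; simp only: list.set insert_iff empty_iff simp_thms; elim disjE)
      (simp_all only: adj_word_prod_simps swp_swp_comp bex_simps braid inverse simp_thms)
  then show ?case using h(2) by (simp only: adj_word_prod_simps)
qed (auto simp: rank2_words_def)

lemma subword_vertex: "subseq us ws \<Longrightarrow> adj_word_prod us \<in> verts (subword_graph ws)"
  by (auto simp: subword_graph_simps)

text \<open>A further letter \<open>c\<close> yields a coset disjoint from the dihedral group, as no
  word in \<open>a\<close> and \<open>b\<close> contains \<open>c\<close>. The position of
  \<open>c\<close> decides the side: before the first \<open>a\<close> it is a left factor, after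
  the second a right factor, and in between it commutes with \<open>a\<close> and can be moved past
  it.\<close>

lemma not_toroidal_third_letter:
  assumes ab: "a = Suc b \<or> b = Suc a" and ws: "ws = p @ a # m @ a # q" and b: "b \<in> set m" "a \<notin> set m"
    and comm: "\<And>c. c \<in> set m \<Longrightarrow> c \<noteq> b \<Longrightarrow> c \<noteq> Suc a \<and> a \<noteq> Suc c"
    and c: "c \<in> set ws" "c \<noteq> a" "c \<noteq> b"
  shows "\<not> toroidal (subword_graph ws)"
proof -
  have ne: "a \<noteq> b" using ab by auto
  let ?V = "verts (subword_graph ws)"
  have notin: "c \<notin> set h" if "h \<in> set (rank2_words a b)" for h
    using that c by (auto simp: rank2_words_def)
  have bm: "subseq [b] m" using b by (simp add: subseq_singleton_left)
  have sub: "subseq (us1 @ [a] @ us2 @ [a] @ us3) ws" if "subseq us1 p" "subseq us2 m" "subseq us3 q" for us1 us2 us3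
    unfolding ws using that by (auto intro!: list_emb_append_mono)
  have aba: "subseq [a, b, a] ws" using sub[of "[]" "[b]" "[]"] bm by simp
  have V1: "adj_word_prod h \<in> ?V" if "h \<in> set (rank2_words a b)" for h
  proof -
    have "subseq h [a, b, a]" using that ne by (auto simp: rank2_words_def)
    then show ?thesis using subword_vertex aba subseq_order.trans by blast
  qed
  have L: "\<not> toroidal (subword_graph ws)" if V2: "\<And>h. h \<in> set (rank2_words a b) \<Longrightarrow> swp c \<circ> adj_word_prod h \<in> ?V"
  proof (rule not_toroidal_two_cosets[OF ab refl])
    show "inj ((\<circ>) (swp c))" by (rule injI) (metis swp_swp_comp)
    show "refl_adj (swp c \<circ> x) (swp c \<circ> y)" if "refl_adj x y" for x y using that by (simp add: refl_adj_left)
    show "swp c \<circ> adj_word_prod h \<noteq> adj_word_prod h'" if "h \<in> set (rank2_words a b)" "h' \<in> set (rank2_words a b)" for h h'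
      using swp_comp_neq notin that by blast
  qed (use V1 V2 in auto)
  have R: "\<not> toroidal (subword_graph ws)" if V2: "\<And>h. h \<in> set (rank2_words a b) \<Longrightarrow> adj_word_prod h \<circ> swp c \<in> ?V"
  proof (rule not_toroidal_two_cosets[OF ab refl])
    show "inj (\<lambda>x. x \<circ> swp c)" by (rule injI) (metis comp_assoc comp_id transpose_comp_involutory)
    show "refl_adj (x \<circ> swp c) (y \<circ> swp c)" if "refl_adj x y" for x y using that by (simp add: refl_adj_right)
    show "adj_word_prod h \<circ> swp c \<noteq> adj_word_prod h'" if "h \<in> set (rank2_words a b)" "h' \<in> set (rank2_words a b)" for h h'
      using comp_swp_neq notin that by blast
  qed (use V1 V2 in auto)
  have right: "adj_word_prod h \<circ> swp c = adj_word_prod (h @ [c])" for h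
    by (simp only: adj_word_prod_append adj_word_prod_simps comp_id)
  have left: "swp c \<circ> adj_word_prod h = adj_word_prod (c # h)" for h by simp
  have mem: "adj_word_prod us \<in> ?V" if "subseq us vs" "subseq vs ws" for us vs
    using subword_vertex subseq_order.trans that by blast
  consider "c \<in> set p" | "c \<in> set q" | "c \<in> set m" using c ws by auto
  then show ?thesis
  proof cases
    case 1
    then have s: "subseq [c, a, b, a] ws" using sub[of "[c]" "[b]" "[]"] bm by (simp add: subseq_singleton_left)
    show ?thesis
    proof (rule L)
      fix h assume "h \<in> set (rank2_words a b)"
      then have "subseq (c # h) [c, a, b, a]" using ne by (auto simp: rank2_words_def)
      then show "swp c \<circ> adj_word_prod h \<in> ?V" unfolding left using mem s by blast
    qed
  next
    case 2
    then have s: "subseq [a, b, a, c] ws" using sub[of "[]" "[b]" "[c]"] bm by (simp add: subseq_singleton_left)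
    show ?thesis
    proof (rule R)
      fix h assume "h \<in> set (rank2_words a b)"
      then have "subseq (h @ [c]) [a, b, a, c]" using ne c(2,3) by (auto simp: rank2_words_def)
      then show "adj_word_prod h \<circ> swp c \<in> ?V" unfolding right using mem s by blast
    qed
  next
    case 3
    then have com: "c \<noteq> Suc a" "a \<noteq> Suc c" using comm c(3) by auto
    have ca: "swp c \<circ> (swp a \<circ> f) = swp a \<circ> (swp c \<circ> f)" for f
      using com c(2) by (intro swp_commute_comp) auto
    from subseq_pair[OF 3 b(1) c(3)] show ?thesis
    proof
      \<comment> \<open>Here \<open>c\<close> precedes \<open>b\<close> and moves left past the
        first \<open>a\<close>; in the opposite case it moves right past the second.\<close>
      assume "subseq [c, b] m"
      then have s: "subseq [a, c, b, a] ws" using sub[of "[]" "[c, b]" "[]"] by simp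
      show ?thesis
      proof (rule L)
        fix h assume h: "h \<in> set (rank2_words a b)"
        have "\<exists>us. subseq us [a, c, b, a] \<and> swp c \<circ> adj_word_prod h = adj_word_prod us"
        \<comment> \<open>These are the words that do not begin with \<open>a\<close>, so
          \<open>c\<close> can be put in front of them directly.\<close>
        proof (cases "h \<in> {[], [b], [b, a]}")
          case True
          then show ?thesis using ne c(2,3) by (intro exI[of _ "c # h"]) auto
        next
          case False
          then obtain h' where h': "h = a # h'" "h' \<in> {[], [b], [b, a]}" using h by (auto simp: rank2_words_def)
          have "swp c \<circ> adj_word_prod h = adj_word_prod (a # c # h')"
            unfolding h'(1) by (simp only: adj_word_prod_simps ca)
          moreover have "subseq (a # c # h') [a, c, b, a]" using h'(2) ne c(2,3) by auto
          ultimately show ?thesis by blast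
        qed
        then show "swp c \<circ> adj_word_prod h \<in> ?V" using mem s by metis
      qed
    next
      assume "subseq [b, c] m"
      then have s: "subseq [a, b, c, a] ws" using sub[of "[]" "[b, c]" "[]"] by simp
      show ?thesis
      proof (rule R)
        fix h assume h: "h \<in> set (rank2_words a b)"
        have "\<exists>us. subseq us [a, b, c, a] \<and> adj_word_prod h \<circ> swp c = adj_word_prod us"
        \<comment> \<open>These are the words that do not end with \<open>a\<close>, so
          \<open>c\<close> can be appended directly.\<close>
        proof (cases "h \<in> {[], [b], [a, b]}")
          case True
          then show ?thesis unfolding right using ne c(2,3) by (intro exI[of _ "h @ [c]"]) auto
        next
          case False
          then obtain h' where h': "h = h' @ [a]" "h' \<in> {[], [b], [a, b]}" using h by (auto simp: rank2_words_def)
          have "adj_word_prod (h' @ [a, c]) = adj_word_prod (h' @ [c, a])"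
            unfolding adj_word_prod_append using ca[of id] by (simp only: adj_word_prod_simps)
          then show ?thesis unfolding right h'(1) using h'(2) ne c(2,3)
            by (intro exI[of _ "h' @ [c, a]"] conjI) auto
        qed
        then show "adj_word_prod h \<circ> swp c \<in> ?V" using mem s by metis
      qed
    qed
  qed
qed

lemma subword_graph_repeated_letter:
  assumes red: "reduced_word n \<sigma> ws" and "\<not> distinct ws"
  shows "\<not> toroidal (subword_graph ws) \<or> complete_bipartite_digraph 3 3 (subword_graph ws)"
proof -
  obtain p a m q where ws: "ws = p @ a # m @ a # q" and am: "a \<notin> set m" "distinct m"
    using not_distinct_close_repeat[OF assms(2)] by auto
  let ?V = "verts (subword_graph ws)"
  have sub: "subseq ([a] @ us @ [a]) ws" if "subseq us m" for us
  proof -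
    have "subseq (us @ [a]) (m @ a # q)" by (rule list_emb_append_mono[OF that]) simp
    then have "subseq ([a] @ us @ [a]) (a # m @ a # q)" by simp
    then show ?thesis unfolding ws by (rule list_emb_append2)
  qed
  show ?thesis
  proof (cases "Suc a \<in> set m \<and> (\<exists>x. a = Suc x \<and> x \<in> set m)")
    case True
    then obtain x where x: "a = Suc x" "x \<in> set m" "Suc (Suc x) \<in> set m" by auto
    let ?y = "Suc x" and ?z = "Suc (Suc x)"
    have xz: "swp ?z \<circ> (swp x \<circ> f) = swp x \<circ> (swp ?z \<circ> f)" for f by (rule swp_commute_comp) auto
    have "adj_word_prod h \<in> ?V" if "h \<in> set (middle_words x)" for h
    proof -
      from subseq_pair[OF x(2,3)] have "subseq [?y, x, ?z, ?y] ws \<or> subseq [?y, ?z, x, ?y] ws"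
        using sub[of "[x, ?z]"] sub[of "[?z, x]"] x(1) by auto
      then show ?thesis
      proof
        assume s: "subseq [?y, x, ?z, ?y] ws"
        have "subseq h [?y, x, ?z, ?y]" using that by (auto simp: middle_words_def Let_def)
        then show ?thesis using s subword_vertex subseq_order.trans by blast
      next
        \<comment> \<open>The outer letters \<open>x\<close> and \<open>?z\<close> commute, so a
          word of the pattern that contains them in the order \<open>x\<close>, \<open>?z\<close> is
          rearranged.\<close>
        assume s: "subseq [?y, ?z, x, ?y] ws"
        have "\<exists>us. subseq us [?y, ?z, x, ?y] \<and> adj_word_prod h = adj_word_prod us"
        proof (cases "\<exists>us vs. h = us @ [x, ?z] @ vs")
          case True
          then obtain us vs where h: "h = us @ [x, ?z] @ vs" by blast
          have "adj_word_prod h = adj_word_prod (us @ [?z, x] @ vs)"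
            unfolding h adj_word_prod_append by (simp only: adj_word_prod_simps xz comp_assoc)
          moreover have "subseq (us @ [?z, x] @ vs) [?y, ?z, x, ?y]"
            using that unfolding h by (auto simp: middle_words_def Let_def append_eq_Cons_conv Cons_eq_append_conv)
          ultimately show ?thesis by blast
        next
          case False
          have "subseq h [?y, ?z, x, ?y] \<or> h \<in> {[] @ [x, ?z] @ [], [?y] @ [x, ?z] @ [], [] @ [x, ?z] @ [?y], [?y] @ [x, ?z] @ [?y]}"
            using that by (auto simp: middle_words_def Let_def)
          then show ?thesis using False by blast
        qed
        then show ?thesis using s subword_vertex subseq_order.trans by metis
      qed
    qed
    then show ?thesis using not_toroidal_middle by blast
  next
    case False
    show ?thesis
    proof (cases "\<exists>b\<in>set m. b = Suc a \<or> a = Suc b")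
      case nb: True
      then obtain b where b: "b \<in> set m" "a = Suc b \<or> b = Suc a" by blast
      have comm: "c \<noteq> Suc a \<and> a \<noteq> Suc c" if "c \<in> set m" "c \<noteq> b" for c using False that b by auto
      show ?thesis
      proof (cases "\<exists>c\<in>set ws. c \<noteq> a \<and> c \<noteq> b")
        case True
        then show ?thesis using not_toroidal_third_letter[OF b(2) ws b(1) am(1) comm] by blast
      next
        case False
        \<comment> \<open>With two letters only, the product lies in a group whose elements have
          words of length at most 3, so the reduced word is \<open>[a, b, a]\<close> itself.\<close>
        then have ab: "set ws \<subseteq> {a, b}" by auto
        obtain h where h: "h \<in> set (rank2_words a b)" "adj_word_prod ws = adj_word_prod h"
          using rank2_closed[OF b(2) ab] by blast
        have "set h \<subseteq> {a, b}" "length h \<le> 3" using h(1) by (auto simp: rank2_words_def)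
        moreover have "{a, b} \<subseteq> {1..<n}" using red b(1) unfolding reduced_word_def ws by auto
        ultimately have "length ws \<le> 3" using reduced_word_le[OF red _ h(2)[symmetric]] by (meson order_trans)
        moreover have "subseq [a, b, a] ws" using sub[of "[b]"] b(1) by (simp add: subseq_singleton_left)
        ultimately have "ws = [a, b, a]" using list_emb_length[of "(=)" "[a, b, a]" ws] subseq_same_length[of "[a, b, a]" ws] by simp
        then show ?thesis using subword_graph_K33[OF b(2)] by simp
      qed
    next
      case nb: False
      \<comment> \<open>With no neighbour of \<open>a\<close> in between, the second
        \<open>a\<close> moves left to the first and cancels, which shortens a reduced word.\<close>
      have "adj_word_prod (m @ a # q) = adj_word_prod (a # m @ q)"
        by (rule adj_word_prod_commute) (use nb am in auto)
      then have "adj_word_prod ws = adj_word_prod (p @ m @ q)"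
        unfolding ws adj_word_prod_append[of p] by (simp only: adj_word_prod_simps swp_swp_comp)
      moreover have "set (p @ m @ q) \<subseteq> {1..<n}" using red unfolding reduced_word_def ws by auto
      ultimately have "length ws \<le> length (p @ m @ q)" using reduced_word_le[OF red] by metis
      then show ?thesis unfolding ws by simp
    qed
  qed
qed

theorem corollary4p2:
  fixes n :: nat and \<sigma> :: "nat \<Rightarrow> nat"
  assumes "n \<ge> 1" and "\<sigma> permutes {1..n}"
  shows "toroidal (underlying_graph (lower_bruhat_graph n \<sigma>)) \<longleftrightarrow>
    complete_digraph 1 (underlying_graph (lower_bruhat_graph n \<sigma>)) \<or>
    complete_digraph 2 (underlying_graph (lower_bruhat_graph n \<sigma>)) \<or>
    digraph_iso (underlying_graph (lower_bruhat_graph n \<sigma>)) (cube_graph 2) \<or>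
    digraph_iso (underlying_graph (lower_bruhat_graph n \<sigma>)) (cube_graph 3) \<or>
    digraph_iso (underlying_graph (lower_bruhat_graph n \<sigma>)) (cube_graph 4) \<or>
    complete_bipartite_digraph 3 3 (underlying_graph (lower_bruhat_graph n \<sigma>))"
proof -
  obtain ws where red: "reduced_word n \<sigma> ws" using ex_reduced_word[OF assms(2)] by blast
  note eq = lower_bruhat_graph_eq_subword_graph[OF red]
  show ?thesis
    unfolding eq
  proof (intro iffI)
    assume t: "toroidal (subword_graph ws)"
    show "complete_digraph 1 (subword_graph ws) \<or> complete_digraph 2 (subword_graph ws) \<or>
      digraph_iso (subword_graph ws) (cube_graph 2) \<or> digraph_iso (subword_graph ws) (cube_graph 3) \<or>
      digraph_iso (subword_graph ws) (cube_graph 4) \<or> complete_bipartite_digraph 3 3 (subword_graph ws)"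
    proof (cases "distinct ws")
      case True
      then have "length ws < 5" using t not_toroidal_distinct[OF True] by force
      \<comment> \<open>The cubes of dimensions 0 and 1 appear as complete graphs.\<close>
      then have "length ws = 0 \<or> length ws = 1 \<or> length ws = 2 \<or> length ws = 3 \<or> length ws = 4" by presburger
      then show ?thesis
        using subword_graph_complete[of ws 1] subword_graph_complete[of ws 2] subword_graph_cube[OF True]
        by (elim disjE) simp_all
    next
      case False
      then show ?thesis using t subword_graph_repeated_letter[OF red] by blast
    qed
  next
    assume "complete_digraph 1 (subword_graph ws) \<or> complete_digraph 2 (subword_graph ws) \<or>
      digraph_iso (subword_graph ws) (cube_graph 2) \<or> digraph_iso (subword_graph ws) (cube_graph 3) \<or>
      digraph_iso (subword_graph ws) (cube_graph 4) \<or> complete_bipartite_digraph 3 3 (subword_graph ws)"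
    then show "toroidal (subword_graph ws)"
      using toroidal_complete toroidal_digraph_iso_cube[of "subword_graph ws" 2] toroidal_digraph_iso_cube[of "subword_graph ws" 3]
        toroidal_digraph_iso_cube[of "subword_graph ws" 4] toroidal_K33 by auto
  qed
qed

end
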